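(* Let $P$, $F$, $W=F$ and $G$ be as in the context, with the feedback interconnection $[\![P,-F]\!]$ stable, and let $$G(s)=\begin{bmatrix} C_z\\ C_v\end{bmatrix}(sI-A)^{-1}\begin{bmatrix} B_d & B_w\end{bmatrix}+\begin{bmatrix} D_{zd}& D_{zw}\\ D_{vd}& D_{vw}\end{bmatrix}$$ be any state-space realization of $G$ with $A$ Hurwitz. Given $h>0$ and $\delta\ge0$, let $$\beta=\Big(\tfrac{2(1+\delta)h}{\pi}+\sqrt{(1+\delta)h^2\cdot\min\{\delta,1\}}\Big)^2,\qquad \eta=h\cdot\min\{\delta,1\}.$$ Let $\gamma>0$. If there exist real numbers $X\ge0$, $Y\ge0$ and a real symmetric matrix $Q=Q^\top$ such that $$\begin{bmatrix} A & B_d& B_w\\ I&0&0\end{bmatrix}^\top\begin{bmatrix}0&Q\\ Q&0\end{bmatrix}\begin{bmatrix} A & B_d & B_w\\ I&0&0\end{bmatrix}+\begin{bmatrix} C_z& D_{zd}&D_{zw}\\ C_v& D_{vd}&D_{vw}\\ 0& I&0\\ 0&0&I\end{bmatrix}^\top\begin{bmatrix}I&0&0&0\\ 0&\beta X+\eta Y&0& Y\\ 0&0&-\gamma^2I&0\\ 0&Y&0&-X\end{bmatrix}\begin{bmatrix} C_z& D_{zd}&D_{zw}\\ C_v& D_{vd}&D_{vw}\\ 0& I&0\\ 0&0&I\end{bmatrix}\prec0,$$ then, for all admissible event sequences $T'$ and $T^\star$ that satisfy the bounds (B) given in the context with $$\tau'=h,\quad \tau^\star=(1+\delta)h,\quad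 \tau^\circ=\delta h,\quad \tau^\natural=h\cdot\min\{\delta,1\},$$ the feedback interconnection $[\![P,-\mathscr{H}_{T^\star}\mathscr{S}_{T^\star}\mathscr{H}_{T'}\mathscr{S}_{T'}F]\!]$ is stable and the closed-loop map $d\mapsto z=Wu$, where $u=d-\mathscr{H}_{T^\star}\mathscr{S}_{T^\star}\mathscr{H}_{T'}\mathscr{S}_{T'}Fy$ and $y=Pu$, has induced $\mathbf{L}_2$ norm $\|d\mapsto z\|\le\gamma$.
   Context: Signals are scalar. $\mathbf{L}_2$ is the space of square integrable functions $\mathbb{R}_{\ge 0}\to\mathbb{R}$. $\mathbf{L}_{2e}$ is the set of functions $f:\mathbb{R}_{\ge0}\to\mathbb{R}$ with $P_\tau f\in\mathbf{L}_2$ for every $\tau>0$, where $(P_\tau f)(t)=f(t)$ for $t\le\tau$ and $0$ otherwise. An operator $M$ on $\mathbf{L}_{2e}$ is causal if $P_\tau MP_\tau=P_\tau M$ for all $\tau>0$; bounded if it maps $\mathbf{L}_2$ into $\mathbf{L}_2$ with finite induced norm $\|M\|=\sup_{u\in\mathbf{L}_2}\|Mu\|_{\mathbf{L}_2}/\|u\|_{\mathbf{L}_2}$; stable if causal and bounded. For symmetric $M$, $M\succ0$ means positive definite and $M\prec0$ means $-M\succ0$. $\mathsf{id}$ is the identity operator. Feedback interconnection: for causal $G_1,\Delta_1:\mathbf{L}_{2e}\to\mathbf{L}_{2e}$, consider $w=\Delta_1v+d_w$, $v=G_1w+d_v$. The interconnection is well-posed if for every $(d_w,d_v)\in\mathbf{L}_{2e}\times\mathbf{L}_{2e}$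 there exist unique $(w,v)\in\mathbf{L}_{2e}\times\mathbf{L}_{2e}$ satisfying these equations and the closed-loop map $[\![G_1,\Delta_1]\!]:(d_w,d_v)\mapsto(w,v)$ is causal. It is stable if in addition the restriction of $[\![G_1,\Delta_1]\!]$ to $\mathbf{L}_2\times\mathbf{L}_2$ has finite induced norm. Systems: $P$ is a causal linear time-invariant system on $\mathbf{L}_{2e}$ given by a transfer function $P(s)$. $F$ is a stable low-pass linear time-invariant system (strictly proper transfer function $F(s)$ with no poles in the closed right-half plane). It is assumed throughout that $[\![P,-F]\!]$ is stable. The performance weight is $W=F$. $\mathscr{I}^\dagger$ denotes differentiation, so $\mathscr{I}^\dagger F$ is the stable system with transfer function $sF(s)$. Define $$G=\begin{bmatrix}G_{zd}&G_{zw}\\ G_{vd}&G_{vw}\end{bmatrix}=\begin{bmatrix}W&0\\0&\mathscr{I}^\dagger F\end{bmatrix}[\![P,-F]\!]\begin{bmatrix}\mathsf{id}&\mathsf{id}\\0&0\end{bmatrix};$$ that is, $G$ maps $(d,w)$ to $(z,v)$ with $u=d+w-Fy$, $y=Pu$, $z=Wu$, $v=\mathscr{I}^\dagger Fy$. Admissible event sequence: $T=(t_k)_{k\in\mathbb{N}_0}\subset\mathbb{R}_{\ge0}$ with $t_0=0$, $t_{k+1}-t_k>0$, $\lim_{k\to\infty}t_k=+\infty$ (also identified with its set of values). The sampling operator $\mathscr{S}_T$ maps a right-continuous signal $v$ in $\mathbf{L}_{2e}$ to the sequence $(v(t_k))_{k\in\mathbb{N}_0}$; the hold operator $\mathscr{H}_T$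 maps a sequence $(\tilde v_k)_{k\in\mathbb{N}_0}$ to the signal equal to $\tilde v_k$ on $[t_k,t_{k+1})$, $k\in\mathbb{N}_0$. Bounds (B): with $T'=(t'_k)$, $T^\star=(t^\star_k)$ and $\phi_k=\min\{t : t\in T^\star\cap[t'_k,+\infty)\}$, for all $k\in\mathbb{N}_0$: $0<t'_{k+1}-t'_k\le\tau'$; $0<t^\star_{k+1}-t^\star_k\le\tau^\star$; $\phi_k-t'_k\le\tau^\circ\le\tau^\star$; and $\phi_k-\max\{t : t\in T'\cap[0,\phi_k]\}\le\tau^\natural\le\min\{\tau^\circ,\tau'\}$. *)

theory Defs
  imports "HOL-Analysis.Analysis" "HOL-Computational_Algebra.Polynomial"
begin

section \<open>Signals\<close>

text \<open>
  A signal on the half line is a function on all of \<open>real\<close> of which only the values on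
  \<open>{0..}\<close> matter. The codomain is a Euclidean space so that a pair of scalar signals is
  one signal with values in \<open>real \<times> real\<close>; its squared norm is then the sum of the two
  squared norms. As usual for these spaces, signals are compared up to null sets.
\<close>

definition L2 :: "(real \<Rightarrow> 'a::euclidean_space) set" where
  "L2 = {f. f \<in> borel_measurable (lebesgue_on {0..}) \<and>
            integrable (lebesgue_on {0..}) (\<lambda>t. (norm (f t))\<^sup>2)}"

definition L2_norm :: "(real \<Rightarrow> 'a::euclidean_space) \<Rightarrow> real" where
  "L2_norm f = sqrt (integral\<^sup>L (lebesgue_on {0..}) (\<lambda>t. (norm (f t))\<^sup>2))"

definition truncation :: "real \<Rightarrow> (real \<Rightarrow> 'a::euclidean_space) \<Rightarrow> real \<Rightarrow> 'a" where
  "truncation \<tau> f = (\<lambda>t. if t \<le> \<tau> then f t else 0)"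

definition L2e :: "(real \<Rightarrow> 'a::euclidean_space) set" where
  "L2e = {f. \<forall>\<tau>>0. truncation \<tau> f \<in> L2}"

definition signal_eq :: "(real \<Rightarrow> 'a::euclidean_space) \<Rightarrow> (real \<Rightarrow> 'a) \<Rightarrow> bool" (infix \<open>\<simeq>\<close> 50) where
  "f \<simeq> g \<longleftrightarrow> (AE t in lebesgue_on {0..}. f t = g t)"

section \<open>Operators\<close>

definition L2e_operator ::
  "((real \<Rightarrow> 'a::euclidean_space) \<Rightarrow> real \<Rightarrow> 'b::euclidean_space) \<Rightarrow> bool" where
  "L2e_operator M \<longleftrightarrow>
     (\<forall>u\<in>L2e. M u \<in> L2e) \<and> (\<forall>u\<in>L2e. \<forall>u'\<in>L2e. u \<simeq> u' \<longrightarrow> M u \<simeq> M u')"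

definition causal ::
  "((real \<Rightarrow> 'a::euclidean_space) \<Rightarrow> real \<Rightarrow> 'b::euclidean_space) \<Rightarrow> bool" where
  "causal M \<longleftrightarrow>
     (\<forall>\<tau>>0. \<forall>u\<in>L2e. truncation \<tau> (M (truncation \<tau> u)) \<simeq> truncation \<tau> (M u))"

text \<open>
  In \<open>ennreal\<close>, \<open>0 / 0 = 0\<close> and \<open>c / 0 = \<infinity>\<close> for \<open>c > 0\<close>, so an operator of finite
  induced norm sends null signals to null signals. \<open>L2_norm\<close> is meaningful on \<open>L2\<close>
  only, so \<open>induced_norm M\<close> is to be used when \<open>M\<close> maps \<open>L2\<close> into \<open>L2\<close>.
\<close>

definition induced_norm ::
  "((real \<Rightarrow> 'a::euclidean_space) \<Rightarrow> real \<Rightarrow> 'b::euclidean_space) \<Rightarrow> ennreal" where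
  "induced_norm M = (SUP u\<in>L2. ennreal (L2_norm (M u)) / ennreal (L2_norm u))"

definition bounded_operator ::
  "((real \<Rightarrow> 'a::euclidean_space) \<Rightarrow> real \<Rightarrow> 'b::euclidean_space) \<Rightarrow> bool" where
  "bounded_operator M \<longleftrightarrow> (\<forall>u\<in>L2. M u \<in> L2) \<and> induced_norm M < \<infinity>"

definition stable_operator ::
  "((real \<Rightarrow> 'a::euclidean_space) \<Rightarrow> real \<Rightarrow> 'b::euclidean_space) \<Rightarrow> bool" where
  "stable_operator M \<longleftrightarrow> causal M \<and> bounded_operator M"

definition neg_op :: "((real \<Rightarrow> real) \<Rightarrow> real \<Rightarrow> real) \<Rightarrow> (real \<Rightarrow> real) \<Rightarrow> real \<Rightarrow> real" where
  "neg_op M = (\<lambda>u t. - M u t)"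

section \<open>Feedback interconnections\<close>

text \<open>External signals and solutions are pairs \<open>(d\<^sub>w, d\<^sub>v)\<close> and \<open>(w, v)\<close>.\<close>

definition feedback_eqs ::
  "((real \<Rightarrow> real) \<Rightarrow> real \<Rightarrow> real) \<Rightarrow> ((real \<Rightarrow> real) \<Rightarrow> real \<Rightarrow> real) \<Rightarrow>
   (real \<Rightarrow> real \<times> real) \<Rightarrow> (real \<Rightarrow> real \<times> real) \<Rightarrow> bool" where
  "feedback_eqs G \<Delta> d x \<longleftrightarrow>
     (fst \<circ> x) \<simeq> (\<lambda>t. \<Delta> (snd \<circ> x) t + fst (d t)) \<and>
     (snd \<circ> x) \<simeq> (\<lambda>t. G (fst \<circ> x) t + snd (d t))"

text \<open>
  \<open>closed_loop G \<Delta>\<close> is the map \<open>\<lbrakk>G, \<Delta>\<rbrakk>\<close>; it is determined (up to null sets) when the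
  interconnection is well-posed.
\<close>

definition closed_loop ::
  "((real \<Rightarrow> real) \<Rightarrow> real \<Rightarrow> real) \<Rightarrow> ((real \<Rightarrow> real) \<Rightarrow> real \<Rightarrow> real) \<Rightarrow>
   (real \<Rightarrow> real \<times> real) \<Rightarrow> real \<Rightarrow> real \<times> real" where
  "closed_loop G \<Delta> d = (SOME x. x \<in> L2e \<and> feedback_eqs G \<Delta> d x)"

definition well_posed ::
  "((real \<Rightarrow> real) \<Rightarrow> real \<Rightarrow> real) \<Rightarrow> ((real \<Rightarrow> real) \<Rightarrow> real \<Rightarrow> real) \<Rightarrow> bool" where
  "well_posed G \<Delta> \<longleftrightarrow>
     (\<forall>d\<in>L2e. \<exists>x\<in>L2e. feedback_eqs G \<Delta> d x \<and> (\<forall>x'\<in>L2e. feedback_eqs G \<Delta> d x' \<longrightarrow> x' \<simeq> x)) \<and>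
     causal (closed_loop G \<Delta>)"

definition stable_interconnection ::
  "((real \<Rightarrow> real) \<Rightarrow> real \<Rightarrow> real) \<Rightarrow> ((real \<Rightarrow> real) \<Rightarrow> real \<Rightarrow> real) \<Rightarrow> bool" where
  "stable_interconnection G \<Delta> \<longleftrightarrow> well_posed G \<Delta> \<and> bounded_operator (closed_loop G \<Delta>)"

section \<open>Linear time-invariant systems and transfer functions\<close>

definition linear_operator :: "((real \<Rightarrow> real) \<Rightarrow> real \<Rightarrow> real) \<Rightarrow> bool" where
  "linear_operator M \<longleftrightarrow>
     (\<forall>u\<in>L2e. \<forall>v\<in>L2e. \<forall>a b. M (\<lambda>t. a * u t + b * v t) \<simeq> (\<lambda>t. a * M u t + b * M v t))"

definition delay :: "real \<Rightarrow> (real \<Rightarrow> real) \<Rightarrow> real \<Rightarrow> real" where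
  "delay \<sigma> u = (\<lambda>t. if t < \<sigma> then 0 else u (t - \<sigma>))"

definition time_invariant :: "((real \<Rightarrow> real) \<Rightarrow> real \<Rightarrow> real) \<Rightarrow> bool" where
  "time_invariant M \<longleftrightarrow> (\<forall>\<sigma>\<ge>0. \<forall>u\<in>L2e. M (delay \<sigma> u) \<simeq> delay \<sigma> (M u))"

definition laplace_integrand :: "(real \<Rightarrow> real) \<Rightarrow> complex \<Rightarrow> real \<Rightarrow> complex" where
  "laplace_integrand u s = (\<lambda>t. exp (- (s * of_real t)) * of_real (u t))"

definition laplace :: "(real \<Rightarrow> real) \<Rightarrow> complex \<Rightarrow> complex" where
  "laplace u s = integral\<^sup>L (lebesgue_on {0..}) (laplace_integrand u s)"

text \<open>
  The transfer function acts on inputs in \<open>L2\<close> and on some right half-plane, so that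
  unstable systems, whose outputs may grow exponentially, are covered. For a causal
  operator this determines the operator on \<open>L2e\<close> up to null sets.
\<close>

definition has_transfer_function ::
  "((real \<Rightarrow> real) \<Rightarrow> real \<Rightarrow> real) \<Rightarrow> (complex \<Rightarrow> complex) \<Rightarrow> bool" where
  "has_transfer_function M H \<longleftrightarrow>
     (\<exists>\<sigma>\<ge>0. \<forall>u\<in>L2. \<forall>s. Re s > \<sigma> \<longrightarrow>
        integrable (lebesgue_on {0..}) (laplace_integrand (M u) s) \<and>
        laplace (M u) s = H s * laplace u s)"

definition lti_system ::
  "((real \<Rightarrow> real) \<Rightarrow> real \<Rightarrow> real) \<Rightarrow> (complex \<Rightarrow> complex) \<Rightarrow> bool" where
  "lti_system M H \<longleftrightarrow>
     L2e_operator M \<and> causal M \<and> linear_operator M \<and> time_invariant M \<and> has_transfer_function M H"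

text \<open>
  The output of a strictly proper system has a unique right-continuous representative;
  the last clause selects it, which makes point samples of the output meaningful.
\<close>

definition stable_low_pass ::
  "((real \<Rightarrow> real) \<Rightarrow> real \<Rightarrow> real) \<Rightarrow> (complex \<Rightarrow> complex) \<Rightarrow> bool" where
  "stable_low_pass F H \<longleftrightarrow>
     lti_system F H \<and> stable_operator F \<and>
     (\<exists>p q :: real poly. degree p < degree q \<and>
        (\<forall>s::complex. Re s \<ge> 0 \<longrightarrow> poly (map_poly of_real q) s \<noteq> 0) \<and>
        (\<forall>s. H s = poly (map_poly of_real p) s / poly (map_poly of_real q) s)) \<and>
     (\<forall>y\<in>L2e. \<forall>t\<ge>0. continuous (at_right t) (F y))"

definition laplace_pair :: "(real \<Rightarrow> real \<times> real) \<Rightarrow> complex \<Rightarrow> complex ^ (1 + 1)" where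
  "laplace_pair u s =
     (\<chi> i. case i of Inl _ \<Rightarrow> laplace (fst \<circ> u) s | Inr _ \<Rightarrow> laplace (snd \<circ> u) s)"

definition has_transfer_matrix ::
  "((real \<Rightarrow> real \<times> real) \<Rightarrow> real \<Rightarrow> real \<times> real) \<Rightarrow> (complex \<Rightarrow> complex ^ (1 + 1) ^ (1 + 1)) \<Rightarrow> bool"
  where
  "has_transfer_matrix M H \<longleftrightarrow>
     (\<exists>\<sigma>\<ge>0. \<forall>u\<in>L2. \<forall>s. Re s > \<sigma> \<longrightarrow>
        integrable (lebesgue_on {0..}) (laplace_integrand (fst \<circ> M u) s) \<and>
        integrable (lebesgue_on {0..}) (laplace_integrand (snd \<circ> M u) s) \<and>
        laplace_pair (M u) s = H s *v laplace_pair u s)"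

text \<open>
  \<open>differentiate \<circ> F\<close> has transfer function \<open>s F(s)\<close>: outputs of a strictly proper
  rational \<open>F\<close> are locally absolutely continuous, hence differentiable almost everywhere.
\<close>

definition differentiate :: "(real \<Rightarrow> real) \<Rightarrow> real \<Rightarrow> real" where
  "differentiate f = (\<lambda>t. deriv f t)"

text \<open>
  The map \<open>(d, w) \<mapsto> (z, v)\<close> with \<open>u = d + w - F y\<close>, \<open>y = P u\<close>, \<open>z = W u\<close> and \<open>v\<close> the
  derivative of \<open>F y\<close>.
\<close>

definition generalized_plant ::
  "((real \<Rightarrow> real) \<Rightarrow> real \<Rightarrow> real) \<Rightarrow> ((real \<Rightarrow> real) \<Rightarrow> real \<Rightarrow> real) \<Rightarrow>
   ((real \<Rightarrow> real) \<Rightarrow> real \<Rightarrow> real) \<Rightarrow> (real \<Rightarrow> real \<times> real) \<Rightarrow> real \<Rightarrow> real \<times> real" where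
  "generalized_plant W P F dw =
     (let uy = closed_loop P (neg_op F) (\<lambda>t. (fst (dw t) + snd (dw t), 0))
      in (\<lambda>t. (W (fst \<circ> uy) t, differentiate (F (snd \<circ> uy)) t)))"

section \<open>Matrices\<close>

definition hcat :: "'a ^ 'c1 ^ 'r \<Rightarrow> 'a ^ 'c2 ^ 'r \<Rightarrow> 'a ^ ('c1 + 'c2) ^ 'r" (infixr \<open>|||\<close> 67) where
  "A ||| B = (\<chi> i j. case j of Inl k \<Rightarrow> A $ i $ k | Inr k \<Rightarrow> B $ i $ k)"

definition vcat :: "'a ^ 'c ^ 'r1 \<Rightarrow> 'a ^ 'c ^ 'r2 \<Rightarrow> 'a ^ 'c ^ ('r1 + 'r2)" (infixr \<open>'/'/'/\<close> 66) where
  "A /// B = (\<chi> i. case i of Inl k \<Rightarrow> A $ k | Inr k \<Rightarrow> B $ k)"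

definition positive_definite :: "real ^ 'n ^ 'n \<Rightarrow> bool" where
  "positive_definite M \<longleftrightarrow> transpose M = M \<and> (\<forall>x. x \<noteq> 0 \<longrightarrow> 0 < x \<bullet> (M *v x))"

definition negative_definite :: "real ^ 'n ^ 'n \<Rightarrow> bool" where
  "negative_definite M \<longleftrightarrow> positive_definite (- M)"

definition complex_matrix :: "real ^ 'c ^ 'r \<Rightarrow> complex ^ 'c ^ 'r" where
  "complex_matrix M = (\<chi> i j. of_real (M $ i $ j))"

definition hurwitz :: "real ^ 'n ^ 'n \<Rightarrow> bool" where
  "hurwitz A \<longleftrightarrow>
     (\<forall>l v. v \<noteq> 0 \<longrightarrow> complex_matrix A *v v = l *s v \<longrightarrow> Re l < 0)"

definition state_space_transfer ::
  "real ^ 'n ^ 'n \<Rightarrow> real ^ 'm ^ 'n \<Rightarrow> real ^ 'n ^ 'p \<Rightarrow> real ^ 'm ^ 'p \<Rightarrow> complex \<Rightarrow> complex ^ 'm ^ 'p"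
  where
  "state_space_transfer A B C D s =
     complex_matrix C ** matrix_inv (mat s - complex_matrix A) ** complex_matrix B + complex_matrix D"

section \<open>Event sequences, sampling and hold\<close>

definition admissible :: "(nat \<Rightarrow> real) \<Rightarrow> bool" where
  "admissible T \<longleftrightarrow> T 0 = 0 \<and> (\<forall>k. T (Suc k) - T k > 0) \<and> filterlim T at_top sequentially"

definition sample :: "(nat \<Rightarrow> real) \<Rightarrow> (real \<Rightarrow> real) \<Rightarrow> nat \<Rightarrow> real" where
  "sample T v = (\<lambda>k. v (T k))"

definition hold :: "(nat \<Rightarrow> real) \<Rightarrow> (nat \<Rightarrow> real) \<Rightarrow> real \<Rightarrow> real" where
  "hold T c = (\<lambda>t. c (THE k. T k \<le> t \<and> t < T (Suc k)))"

definition next_event :: "(nat \<Rightarrow> real) \<Rightarrow> real \<Rightarrow> real" where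
  "next_event T s = (LEAST t. t \<in> range T \<inter> {s..})"

definition last_event :: "(nat \<Rightarrow> real) \<Rightarrow> real \<Rightarrow> real" where
  "last_event T s = (GREATEST t. t \<in> range T \<inter> {0..s})"

definition event_bounds ::
  "(nat \<Rightarrow> real) \<Rightarrow> (nat \<Rightarrow> real) \<Rightarrow> real \<Rightarrow> real \<Rightarrow> real \<Rightarrow> real \<Rightarrow> bool" where
  "event_bounds T' Ts \<tau>' \<tau>s \<tau>c \<tau>n \<longleftrightarrow>
     \<tau>c \<le> \<tau>s \<and> \<tau>n \<le> min \<tau>c \<tau>' \<and>
     (\<forall>k. 0 < T' (Suc k) - T' k \<and> T' (Suc k) - T' k \<le> \<tau>' \<and>
          0 < Ts (Suc k) - Ts k \<and> Ts (Suc k) - Ts k \<le> \<tau>s \<and>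
          next_event Ts (T' k) - T' k \<le> \<tau>c \<and>
          next_event Ts (T' k) - last_event T' (next_event Ts (T' k)) \<le> \<tau>n)"

definition sampled_feedback ::
  "(nat \<Rightarrow> real) \<Rightarrow> (nat \<Rightarrow> real) \<Rightarrow> ((real \<Rightarrow> real) \<Rightarrow> real \<Rightarrow> real) \<Rightarrow> (real \<Rightarrow> real) \<Rightarrow> real \<Rightarrow> real" where
  "sampled_feedback T' Ts F = hold Ts \<circ> sample Ts \<circ> hold T' \<circ> sample T' \<circ> F"

definition performance_map ::
  "((real \<Rightarrow> real) \<Rightarrow> real \<Rightarrow> real) \<Rightarrow> ((real \<Rightarrow> real) \<Rightarrow> real \<Rightarrow> real) \<Rightarrow>
   ((real \<Rightarrow> real) \<Rightarrow> real \<Rightarrow> real) \<Rightarrow> (real \<Rightarrow> real) \<Rightarrow> real \<Rightarrow> real" where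
  "performance_map W P \<Delta> d = W (fst \<circ> closed_loop P \<Delta> (\<lambda>t. (d t, 0)))"

end

theory Submission
  imports Defs "HOL-Computational_Algebra.Fundamental_Theorem_Algebra"
begin

text \<open>
  Write the sampled and held output of \<open>F\<close> as \<open>F y - w\<close>. Outputs of \<open>F\<close> are integrals, so
  \<open>w t\<close> is the integral of the derivative \<open>v\<close> of \<open>F y\<close> over the time since the value in use was
  sampled. A one-sided Wirtinger inequality and the Cauchy-Schwarz inequality show, on every
  horizon \<open>{0..\<tau>}\<close>, that \<open>\<integral> w\<^sup>2 \<le> \<beta> \<integral> v\<^sup>2\<close> and \<open>0 \<le> \<integral> (2 v w + \<eta> v\<^sup>2)\<close>. The sampled loop is
  the nominal loop with \<open>w\<close> added to the input, hence the plant \<open>G\<close> in feedback with \<open>v \<mapsto> w\<close>. The matrix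
  inequality makes \<open>x \<mapsto> x \<bullet> Q x\<close> a storage function for this interconnection; it is nonnegative
  because \<open>A\<close> is Hurwitz, and integration along trajectories bounds the energies of \<open>z\<close> and \<open>w\<close>
  uniformly in the horizon.

  The realization of \<open>G\<close> is connected to the operators through uniqueness of Laplace transforms, for
  which real arguments suffice.
\<close>

text \<open>Before stability is known, nothing ensures that the signals of the sampled loop have
  finite energy or a Laplace transform. Each estimate is therefore made for inputs cut off at
  \<tau>, to which the stable nominal loop responds in \<open>L2\<close>; causality transfers it to
  the sampled loop up to \<tau>. At \<tau> the state need not be small, hence the need for a
  nonnegative storage function.

  A sample is in use up to an age of at most \<open>L = (1 + \<delta>) * h\<close>, and its age is
  at most \<open>\<eta> = h * min \<delta> 1\<close> when the held value changes to it. The error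
  \<open>w\<close> is the drift since that change plus a constant offset. The drift starts at 0 and
  lasts at most \<open>L\<close>, which gives \<open>2 * L / pi\<close>; the offset is an integral
  over a time at most \<eta> and persists for at most \<open>L\<close>, which gives
  \<open>sqrt (L * \<eta>)\<close>. The square of the sum is \<beta>. In the second inequality,
  \<open>2 v w\<close> is the derivative of \<open>w\<^sup>2\<close> between changes, and right
  after a change \<open>w\<^sup>2\<close> is at most \<eta> times the energy of \<open>v\<close>
  since the sample.

  Signals are differentiable only almost everywhere; integration by parts for indefinite integrals
  does the work of derivatives.\<close>

lemmas HK_integral_add = Henstock_Kurzweil_Integration.integral_add
  and HK_integral_diff = Henstock_Kurzweil_Integration.integral_diff
  and HK_integral_cong = Henstock_Kurzweil_Integration.integral_cong

section \<open>Indefinite integrals\<close>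

text \<open>Refining a partition of \<open>{a..b}\<close> makes the sum of the squared increments of
  \<open>m\<close> at most \<open>e * (m b - m a)\<close> with \<open>e\<close> arbitrarily small.
  With an indefinite integral as \<open>m\<close>, this replaces differentiation in the product rule
  below.\<close>

lemma eq_if_square_increments:
  fixes \<psi> m :: "real \<Rightarrow> real"
  assumes ab: "a \<le> b" and cont: "continuous_on {a..b} m"
    and mono: "\<And>s t. a \<le> s \<Longrightarrow> s \<le> t \<Longrightarrow> t \<le> b \<Longrightarrow> m s \<le> m t"
    and bound: "\<And>s t. a \<le> s \<Longrightarrow> s \<le> t \<Longrightarrow> t \<le> b \<Longrightarrow> \<bar>\<psi> t - \<psi> s\<bar> \<le> K * (m t - m s)\<^sup>2"
    and K: "0 \<le> K"
  shows "\<psi> b = \<psi> a"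
proof (rule ccontr)
  assume ne: "\<psi> b \<noteq> \<psi> a"
  \<comment> \<open>Chosen so that \<open>e * K * (m b - m a)\<close> is strictly smaller than the
    increment of \<psi>, against the telescoped bound; the summand 1 keeps the denominator
    positive.\<close>
  define e where "e = \<bar>\<psi> b - \<psi> a\<bar> / (K * (m b - m a) + 1)"
  have mab: "0 \<le> m b - m a" using mono[of a b] ab by simp
  have e: "e > 0" using ne K mab by (simp add: e_def add_nonneg_pos)
  have "uniformly_continuous_on {a..b} m"
    by (intro compact_uniformly_continuous cont) auto
  then obtain d where d: "d > 0" "\<And>s t. s \<in> {a..b} \<Longrightarrow> t \<in> {a..b} \<Longrightarrow> dist t s < d \<Longrightarrow> dist (m t) (m s) < e"
    using e unfolding uniformly_continuous_on_def by metis
  obtain n :: nat where n: "(b - a) / d < n" "n > 0"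
    by (metis reals_Archimedean2 gr0I less_trans of_nat_0 of_nat_0_less_iff zero_less_one of_nat_1 not_less_iff_gr_or_eq)
  define p where "p i = a + real i * ((b - a) / n)" for i
  have p0: "p 0 = a" and pn: "p n = b" using n by (auto simp: p_def)
  have pin: "a \<le> p i" "p i \<le> p (Suc i)" "p i \<le> b" if "i \<le> n" for i
  proof -
    show "a \<le> p i" using ab by (simp add: p_def)
    show "p i \<le> p (Suc i)" using ab by (simp add: p_def divide_right_mono mult_right_mono)
    have "real i / n \<le> 1" using that n by simp
    then have "(real i / n) * (b - a) \<le> 1 * (b - a)" using ab by (intro mult_right_mono) auto
    then show "p i \<le> b" by (simp add: p_def)
  qed
  have step: "p (Suc i) - p i < d" for i
  proof -
    have "p (Suc i) - p i = (b - a) / n" by (simp add: p_def algebra_simps add_divide_distrib diff_divide_distrib)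
    also have "\<dots> < d" using n d(1) by (simp add: field_simps)
    finally show ?thesis .
  qed
  have "\<psi> b - \<psi> a = (\<Sum>i<n. \<psi> (p (Suc i)) - \<psi> (p i))"
    using sum_lessThan_telescope[of "\<lambda>i. \<psi> (p i)" n] p0 pn by simp
  then have "\<bar>\<psi> b - \<psi> a\<bar> \<le> (\<Sum>i<n. \<bar>\<psi> (p (Suc i)) - \<psi> (p i)\<bar>)"
    by (simp add: sum_abs)
  also have "\<dots> \<le> (\<Sum>i<n. K * e * (m (p (Suc i)) - m (p i)))"
  proof (rule sum_mono)
    fix i assume i: "i \<in> {..<n}"
    have le: "a \<le> p i" "p i \<le> p (Suc i)" "p (Suc i) \<le> b" using pin[of i] pin[of "Suc i"] i by auto
    have m0: "0 \<le> m (p (Suc i)) - m (p i)" using mono[OF le] by simp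
    have "dist (m (p (Suc i))) (m (p i)) < e"
      using le step[of i] by (intro d(2)) (auto simp: dist_real_def)
    then have "m (p (Suc i)) - m (p i) \<le> e" by (simp add: dist_real_def)
    then have "(m (p (Suc i)) - m (p i))\<^sup>2 \<le> e * (m (p (Suc i)) - m (p i))"
      unfolding power2_eq_square by (intro mult_right_mono m0)
    then have "K * (m (p (Suc i)) - m (p i))\<^sup>2 \<le> K * (e * (m (p (Suc i)) - m (p i)))"
      by (intro mult_left_mono K)
    with bound[OF le] show "\<bar>\<psi> (p (Suc i)) - \<psi> (p i)\<bar> \<le> K * e * (m (p (Suc i)) - m (p i))"
      by (simp add: mult.assoc)
  qed
  also have "\<dots> = K * e * (m b - m a)"
    using sum_lessThan_telescope[of "\<lambda>i. m (p i)" n] p0 pn by (simp flip: sum_distrib_left)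
  finally have "\<bar>\<psi> b - \<psi> a\<bar> \<le> e * (K * (m b - m a))" by (simp add: ac_simps)
  also have "\<dots> < e * (K * (m b - m a) + 1)" using e by (intro mult_strict_left_mono) auto
  also have "\<dots> = \<bar>\<psi> b - \<psi> a\<bar>" using K mab by (simp add: e_def) (smt (verit) mult_nonneg_nonneg)
  finally show False by simp
qed

lemma continuous_on_indefinite:
  fixes f :: "real \<Rightarrow> 'a::euclidean_space"
  assumes "f absolutely_integrable_on {a..b}"
  shows "continuous_on {a..b} (\<lambda>t. integral {a..t} f)"
  using assms by (intro indefinite_integral_continuous_1 set_lebesgue_integral_eq_integral(1))

lemma abs_int_sub:
  fixes f :: "real \<Rightarrow> 'a::euclidean_space"
  assumes "f absolutely_integrable_on {a..b}" "a \<le> c" "d \<le> b"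
  shows "f absolutely_integrable_on {c..d}"
  using assms absolutely_integrable_on_subcbox[of "{a..b}" f c d] by auto

lemma abs_int_imp_int:
  fixes f :: "real \<Rightarrow> 'a::euclidean_space"
  shows "f absolutely_integrable_on S \<Longrightarrow> f integrable_on S"
  using set_lebesgue_integral_eq_integral(1) by blast

lemma indefinite_diff:
  fixes f :: "real \<Rightarrow> 'a::euclidean_space"
  assumes "f absolutely_integrable_on {a..b}" "a \<le> s" "s \<le> t" "t \<le> b"
  shows "integral {a..t} f - integral {a..s} f = integral {s..t} f"
  using Henstock_Kurzweil_Integration.integral_combine[of a s t f] assms abs_int_imp_int[OF abs_int_sub[OF assms(1), of a t]]
  by (simp add: algebra_simps)

lemma abs_int_inner_cont:
  fixes f g :: "real \<Rightarrow> 'a::euclidean_space"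
  assumes "f absolutely_integrable_on {a..b}" "continuous_on {a..b} g"
  shows "(\<lambda>t. f t \<bullet> g t) absolutely_integrable_on {a..b}" "(\<lambda>t. g t \<bullet> f t) absolutely_integrable_on {a..b}"
proof -
  have bl: "bilinear (inner :: 'a \<Rightarrow> 'a \<Rightarrow> real)" by (simp add: bilinear_conv_bounded_bilinear bounded_bilinear_inner)
  have "bounded (g ` {a..b})" using assms(2) by (intro compact_imp_bounded compact_continuous_image) auto
  moreover have "g \<in> borel_measurable (lebesgue_on {a..b})"
    using assms(2) by (intro continuous_imp_measurable_on_sets_lebesgue) auto
  ultimately show "(\<lambda>t. g t \<bullet> f t) absolutely_integrable_on {a..b}"
    by (intro absolutely_integrable_bounded_measurable_product[OF bl] assms(1)) auto
  then show "(\<lambda>t. f t \<bullet> g t) absolutely_integrable_on {a..b}" by (simp add: inner_commute)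
qed

text \<open>Product rule for absolutely continuous functions. On \<open>{s..t}\<close> the increment
  of \<open>F \<bullet> G\<close> and the integral of \<open>q\<close> differ by a term of second
  order in the integral of \<open>norm f + norm g\<close>, so \<open>eq_if_square_increments\<close>
  applies and no pointwise derivative is taken.\<close>

lemma integral_inner_by_parts:
  fixes f g :: "real \<Rightarrow> 'a::euclidean_space"
  assumes ab: "a \<le> b" and f: "f absolutely_integrable_on {a..b}" and g: "g absolutely_integrable_on {a..b}"
  shows "(\<lambda>t. f t \<bullet> integral {a..t} g + integral {a..t} f \<bullet> g t) absolutely_integrable_on {a..b}" (is ?th1)
    and "integral {a..b} f \<bullet> integral {a..b} g =
      integral {a..b} (\<lambda>t. f t \<bullet> integral {a..t} g + integral {a..t} f \<bullet> g t)" (is ?th2)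
proof -
  define F where "F t = integral {a..t} f" for t
  define G where "G t = integral {a..t} g" for t
  define n where "n t = norm (f t) + norm (g t)" for t
  define m where "m t = integral {a..t} n" for t
  define q where "q t = f t \<bullet> G t + F t \<bullet> g t" for t
  have cF: "continuous_on {a..b} F" and cG: "continuous_on {a..b} G"
    unfolding F_def G_def using f g by (auto intro!: continuous_on_indefinite)
  have q: "q absolutely_integrable_on {a..b}"
    unfolding q_def using f g cF cG by (intro set_integral_add(1) abs_int_inner_cont)
  then show ?th1 unfolding q_def F_def G_def .
  have n: "n absolutely_integrable_on {a..b}" unfolding n_def using f g by (intro set_integral_add(1) absolutely_integrable_norm[unfolded o_def])
  have "(F b \<bullet> G b - integral {a..b} q) = (F a \<bullet> G a - integral {a..a} q)"
  proof (rule eq_if_square_increments[OF ab, of m _ 2])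
    show "continuous_on {a..b} m" unfolding m_def by (rule continuous_on_indefinite[OF n])
    fix s t assume st: "a \<le> s" "s \<le> t" "t \<le> b"
    have mdiff: "m t - m s = integral {s..t} n" unfolding m_def by (rule indefinite_diff[OF n st])
    have n': "n integrable_on {s..t}" by (rule abs_int_imp_int[OF abs_int_sub[OF n]]) (use st in auto)
    show mst: "m s \<le> m t" using mdiff integral_nonneg[OF n'] by (simp add: n_def)
    have fi: "f absolutely_integrable_on {s..t}" and gi: "g absolutely_integrable_on {s..t}"
      and qi: "q absolutely_integrable_on {s..t}" using abs_int_sub[OF f] abs_int_sub[OF g] abs_int_sub[OF q] st by auto
    have Fd: "norm (F r - F r') \<le> m t - m s" if "s \<le> r'" "r' \<le> r" "r \<le> t" for r r'
    proof -
      have "norm (F r - F r') = norm (integral {r'..r} f)" unfolding F_def using indefinite_diff[OF f, of r' r] that st by simp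
      also have "\<dots> \<le> integral {r'..r} n"
        using that st by (intro integral_norm_bound_integral abs_int_imp_int abs_int_sub[OF f] abs_int_sub[OF n]) (auto simp: n_def)
      also have "\<dots> \<le> integral {s..t} n"
        using that st by (intro integral_subset_le abs_int_imp_int abs_int_sub[OF n]) (auto simp: n_def)
      finally show ?thesis using mdiff by simp
    qed
    have Gd: "norm (G r - G r') \<le> m t - m s" if "s \<le> r'" "r' \<le> r" "r \<le> t" for r r'
    proof -
      have "norm (G r - G r') = norm (integral {r'..r} g)" unfolding G_def using indefinite_diff[OF g, of r' r] that st by simp
      also have "\<dots> \<le> integral {r'..r} n"
        using that st by (intro integral_norm_bound_integral abs_int_imp_int abs_int_sub[OF g] abs_int_sub[OF n]) (auto simp: n_def)
      also have "\<dots> \<le> integral {s..t} n"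
        using that st by (intro integral_subset_le abs_int_imp_int abs_int_sub[OF n]) (auto simp: n_def)
      finally show ?thesis using mdiff by simp
    qed
    \<comment> \<open>With \<open>G\<close> frozen at \<open>s\<close> and \<open>F\<close> frozen
      at \<open>t\<close>, the increment of \<open>F \<bullet> G\<close> splits exactly into two
      integrals; the error of freezing is estimated under the integral.\<close>
    have e1: "(F t - F s) \<bullet> G s = integral {s..t} (\<lambda>r. f r \<bullet> G s)"
      using indefinite_diff[OF f st] integral_linear[OF abs_int_imp_int[OF fi] bounded_linear_inner_left[of "G s"]]
      by (simp add: F_def o_def)
    have e2: "F t \<bullet> (G t - G s) = integral {s..t} (\<lambda>r. F t \<bullet> g r)"
      using indefinite_diff[OF g st] integral_linear[OF abs_int_imp_int[OF gi] bounded_linear_inner_right[of "F t"]]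
      by (simp add: G_def o_def)
    have i1: "(\<lambda>r. f r \<bullet> G s) integrable_on {s..t}"
      using integrable_linear[OF abs_int_imp_int[OF fi] bounded_linear_inner_left[of "G s"]] by (simp add: o_def)
    have i2: "(\<lambda>r. F t \<bullet> g r) integrable_on {s..t}"
      using integrable_linear[OF abs_int_imp_int[OF gi] bounded_linear_inner_right[of "F t"]] by (simp add: o_def)
    have "(F t \<bullet> G t - integral {a..t} q) - (F s \<bullet> G s - integral {a..s} q)
        = (F t - F s) \<bullet> G s + F t \<bullet> (G t - G s) - integral {s..t} q"
      using indefinite_diff[OF q st] by (simp add: algebra_simps inner_diff_left inner_diff_right)
    also have "\<dots> = integral {s..t} (\<lambda>r. f r \<bullet> G s + F t \<bullet> g r - q r)"
      using e1 e2 i1 i2 abs_int_imp_int[OF qi]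
      by (simp add: HK_integral_add HK_integral_diff integrable_add)
    also have "norm \<dots> \<le> integral {s..t} (\<lambda>r. (m t - m s) * n r)"
    proof (rule integral_norm_bound_integral)
      show "(\<lambda>r. f r \<bullet> G s + F t \<bullet> g r - q r) integrable_on {s..t}"
        using i1 i2 abs_int_imp_int[OF qi] by (intro integrable_diff integrable_add)
      show "(\<lambda>r. (m t - m s) * n r) integrable_on {s..t}" using n' by (rule integrable_on_mult_right)
      fix r assume r: "r \<in> {s..t}"
      have "norm (f r \<bullet> G s + F t \<bullet> g r - q r) = norm (f r \<bullet> (G s - G r) + (F t - F r) \<bullet> g r)"
        by (simp add: q_def inner_diff_left inner_diff_right algebra_simps)
      also have "\<dots> \<le> norm (f r) * norm (G s - G r) + norm (F t - F r) * norm (g r)"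
        using norm_triangle_ineq[of "f r \<bullet> (G s - G r)" "(F t - F r) \<bullet> g r"]
          Cauchy_Schwarz_ineq2[of "f r" "G s - G r"] Cauchy_Schwarz_ineq2[of "F t - F r" "g r"] by simp
      also have "\<dots> \<le> norm (f r) * (m t - m s) + (m t - m s) * norm (g r)"
        using Gd[of s r] Fd[of r t] r mst by (intro add_mono mult_left_mono mult_right_mono) (auto simp: norm_minus_commute)
      finally show "norm (f r \<bullet> G s + F t \<bullet> g r - q r) \<le> (m t - m s) * n r" by (simp add: n_def algebra_simps)
    qed
    also have "\<dots> = (m t - m s)\<^sup>2" by (simp add: mdiff power2_eq_square)
    finally show "\<bar>(F t \<bullet> G t - integral {a..t} q) - (F s \<bullet> G s - integral {a..s} q)\<bar> \<le> 2 * (m t - m s)\<^sup>2"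
      by simp
  qed auto
  then have "F b \<bullet> G b = integral {a..b} q" by (simp add: F_def)
  then show ?th2 unfolding q_def F_def G_def .
qed

text \<open>The integral of \<open>(v - \<theta> * p)\<^sup>2 / p\<close> is a nonnegative quadratic
  polynomial in \<theta>. The weight serves the Schur test in the Wirtinger inequality.\<close>

lemma integral_Cauchy_Schwarz_weight:
  fixes v p :: "real \<Rightarrow> real"
  assumes p: "\<And>t. t \<in> S \<Longrightarrow> 0 < p t" and v: "v integrable_on S" and N: "(\<lambda>t. (v t)\<^sup>2 / p t) integrable_on S"
    and pi: "p integrable_on S"
  shows "(integral S v)\<^sup>2 \<le> integral S (\<lambda>t. (v t)\<^sup>2 / p t) * integral S p"
proof -
  let ?V = "integral S v" and ?N = "integral S (\<lambda>t. (v t)\<^sup>2 / p t)" and ?P = "integral S p"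
  have P0: "0 \<le> ?P" using p pi by (intro integral_nonneg) (auto intro: less_imp_le)
  have q: "0 \<le> ?N - 2 * \<theta> * ?V + \<theta>\<^sup>2 * ?P" for \<theta>
  proof -
    have "0 \<le> integral S (\<lambda>t. (v t)\<^sup>2 / p t - 2 * \<theta> * v t + \<theta>\<^sup>2 * p t)"
    proof (rule integral_nonneg)
      show "(\<lambda>t. (v t)\<^sup>2 / p t - 2 * \<theta> * v t + \<theta>\<^sup>2 * p t) integrable_on S"
        using v N pi by (intro integrable_add integrable_diff integrable_on_mult_right)
      fix t assume "t \<in> S"
      then have "(v t)\<^sup>2 / p t - 2 * \<theta> * v t + \<theta>\<^sup>2 * p t = (v t - \<theta> * p t)\<^sup>2 / p t"
        using p[of t] by (simp add: field_simps power2_eq_square)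
      also have "\<dots> \<ge> 0" using p[OF \<open>t \<in> S\<close>] by simp
      finally show "0 \<le> (v t)\<^sup>2 / p t - 2 * \<theta> * v t + \<theta>\<^sup>2 * p t" .
    qed
    also have "\<dots> = ?N - 2 * \<theta> * ?V + \<theta>\<^sup>2 * ?P"
      using v N pi by (simp add: HK_integral_add HK_integral_diff
          integrable_add integrable_diff integrable_on_mult_right)
    finally show ?thesis .
  qed
  show ?thesis
  proof (cases "?P = 0")
    case False
    then show ?thesis using q[of "?V / ?P"] P0 by (simp add: field_simps power2_eq_square)
  next
    case True
    have "?V = 0"
    proof (rule ccontr)
      assume "?V \<noteq> 0"
      \<comment> \<open>For \<open>?P = 0\<close> the polynomial is affine in \<theta>, and this
        \<theta> gives it the value -1.\<close>
      then show False using q[of "(?N + 1) / (2 * ?V)"] True by simp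
    qed
    then show ?thesis using True by simp
  qed
qed

lemma integral_Cauchy_Schwarz_interval:
  fixes v :: "real \<Rightarrow> real"
  assumes "a \<le> b" and v: "v integrable_on {a..b}" and N: "(\<lambda>t. (v t)\<^sup>2) integrable_on {a..b}"
  shows "(integral {a..b} v)\<^sup>2 \<le> (b - a) * integral {a..b} (\<lambda>t. (v t)\<^sup>2)"
  using integral_Cauchy_Schwarz_weight[of "{a..b}" "\<lambda>_. 1" v] assms integrable_const_ivl[of 1 a b] by (simp add: mult.commute)

text \<open>Schur test with weight \<open>cos (c * (t - a))\<close>; letting \<open>c\<close> tend to \<open>pi / (2 * (b - a))\<close> keeps the weight
  bounded away from zero.\<close>
lemma Wirtinger_one_sided:
  fixes v :: "real \<Rightarrow> real"
  assumes ab: "a \<le> b" and v: "v absolutely_integrable_on {a..b}" and v2: "(\<lambda>t. (v t)\<^sup>2) absolutely_integrable_on {a..b}"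
  shows "integral {a..b} (\<lambda>t. (integral {a..t} v)\<^sup>2) \<le> (2 * (b - a) / pi)\<^sup>2 * integral {a..b} (\<lambda>t. (v t)\<^sup>2)"
proof (cases "a = b")
  case False
  then have ab': "a < b" using ab by simp
  let ?J = "integral {a..b} (\<lambda>t. (integral {a..t} v)\<^sup>2)" and ?E = "integral {a..b} (\<lambda>t. (v t)\<^sup>2)"
  have main: "c\<^sup>2 * ?J \<le> ?E" if c: "0 < c" "c < pi / (2 * (b - a))" for c
  proof -
    \<comment> \<open>\<open>p\<close> solves \<open>p'' = - c\<^sup>2 p\<close>, and
      \<open>k\<close> is its integral from \<open>a\<close>. Integrating \<open>k\<close> again
      returns \<open>(1 - p) / c\<^sup>2\<close>; this self-reproduction of the weight produces the
      constant \<open>c\<^sup>2\<close>.\<close>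
    define p where "p t = cos (c * (t - a))" for t
    define k where "k t = sin (c * (t - a)) / c" for t
    define nu where "nu t = (v t)\<^sup>2 / p t" for t
    have p: "0 < p t" if "t \<in> {a..b}" for t
    proof -
      have "c * (t - a) \<le> c * (b - a)" using that c by simp
      also have "\<dots> < pi / 2" using c ab' by (simp add: field_simps)
      finally show ?thesis unfolding p_def using that c by (intro cos_gt_zero_pi) (auto intro: less_le_trans[of _ 0])
    qed
    have contp: "continuous_on A p" and contk: "continuous_on A k" for A using c by (auto simp: p_def k_def intro!: continuous_intros)
    have nu: "nu absolutely_integrable_on {a..b}"
    proof -
      have "(\<lambda>t. (v t)\<^sup>2 \<bullet> (1 / p t)) absolutely_integrable_on {a..b}"
        using p by (intro abs_int_inner_cont v2 continuous_on_divide contp) (auto simp: less_le)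
      then show ?thesis by (simp add: nu_def[abs_def])
    qed
    have k_int: "integral {a..t} p = k t" if "a \<le> t" for t
    proof -
      have "(p has_integral (k t - k a)) {a..t}"
        using that c unfolding p_def k_def
        by (intro fundamental_theorem_of_calculus) (auto intro!: derivative_eq_intros simp flip: has_real_derivative_iff_has_vector_derivative)
      then show ?thesis by (auto simp: k_def)
    qed
    have kk_int: "integral {a..t} k = (1 - p t) / c\<^sup>2" if "a \<le> t" for t
    proof -
      have "(k has_integral ((- p t / c\<^sup>2) - (- p a / c\<^sup>2))) {a..t}"
        using that c unfolding p_def k_def
        by (intro fundamental_theorem_of_calculus) (auto intro!: derivative_eq_intros simp: power2_eq_square simp flip: has_real_derivative_iff_has_vector_derivative)
      then show ?thesis by (auto simp: p_def diff_divide_distrib)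
    qed
    have kai: "k absolutely_integrable_on {a..b}" by (rule absolutely_integrable_continuous_real[OF contk])
    have cN: "continuous_on {a..b} (\<lambda>t. integral {a..t} nu)" by (rule continuous_on_indefinite[OF nu])
    have N0: "0 \<le> integral {a..b} nu"
      using abs_int_imp_int[OF nu] p by (intro integral_nonneg) (auto simp: nu_def less_imp_le)
    \<comment> \<open>Integration by parts moves the integral from \<open>nu\<close> to
      \<open>k\<close>. Since \<open>nu * p\<close> is the square of \<open>v\<close>, all that
      survives is the energy of \<open>v\<close> and a boundary term of favourable sign.\<close>
    have "integral {a..b} (\<lambda>t. integral {a..t} nu * k t) = integral {a..b} nu * ((1 - p b) / c\<^sup>2) - integral {a..b} (\<lambda>t. nu t * ((1 - p t) / c\<^sup>2))"
    proof -
      have i1: "(\<lambda>t. nu t * ((1 - p t) / c\<^sup>2)) integrable_on {a..b}"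
        using abs_int_imp_int[OF abs_int_inner_cont(1)[OF nu continuous_on_divide[OF continuous_on_diff[OF continuous_on_const contp] continuous_on_const], of "c\<^sup>2" 1]] c by simp
      have i2: "(\<lambda>t. integral {a..t} nu * k t) integrable_on {a..b}"
        by (intro integrable_continuous_real continuous_intros cN contk)
      have "integral {a..b} nu * ((1 - p b) / c\<^sup>2) = integral {a..b} (\<lambda>t. nu t * integral {a..t} k + integral {a..t} nu * k t)"
        using integral_inner_by_parts(2)[OF ab nu kai] kk_int[of b] ab by simp
      also have "\<dots> = integral {a..b} (\<lambda>t. nu t * ((1 - p t) / c\<^sup>2) + integral {a..t} nu * k t)"
        by (rule HK_integral_cong) (simp add: kk_int)
      also have "\<dots> = integral {a..b} (\<lambda>t. nu t * ((1 - p t) / c\<^sup>2)) + integral {a..b} (\<lambda>t. integral {a..t} nu * k t)"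
        by (rule HK_integral_add[OF i1 i2])
      finally show ?thesis by simp
    qed
    also have "integral {a..b} (\<lambda>t. nu t * ((1 - p t) / c\<^sup>2)) = (integral {a..b} nu - ?E) / c\<^sup>2"
    proof -
      have "integral {a..b} (\<lambda>t. nu t * ((1 - p t) / c\<^sup>2)) = integral {a..b} (\<lambda>t. (nu t - (v t)\<^sup>2) / c\<^sup>2)"
        by (rule HK_integral_cong) (use p in \<open>force simp: nu_def field_simps\<close>)
      also have "\<dots> = (integral {a..b} nu - ?E) / c\<^sup>2"
        using abs_int_imp_int[OF nu] abs_int_imp_int[OF v2] by (simp add: HK_integral_diff)
      finally show ?thesis .
    qed
    also have "integral {a..b} nu * ((1 - p b) / c\<^sup>2) - (integral {a..b} nu - ?E) / c\<^sup>2 = (?E - integral {a..b} nu * p b) / c\<^sup>2"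
      using c by (simp add: field_simps)
    also have "\<dots> \<le> ?E / c\<^sup>2" using N0 p[of b] ab by (intro divide_right_mono) auto
    finally have *: "integral {a..b} (\<lambda>t. integral {a..t} nu * k t) \<le> ?E / c\<^sup>2" .
    have "?J \<le> integral {a..b} (\<lambda>t. integral {a..t} nu * k t)"
    proof (rule integral_le)
      show "(\<lambda>t. (integral {a..t} v)\<^sup>2) integrable_on {a..b}"
        by (intro integrable_continuous_real continuous_intros continuous_on_indefinite v)
      show "(\<lambda>t. integral {a..t} nu * k t) integrable_on {a..b}"
        by (intro integrable_continuous_real continuous_intros cN contk)
      fix t assume t: "t \<in> {a..b}"
      have "(integral {a..t} v)\<^sup>2 \<le> integral {a..t} (\<lambda>t. (v t)\<^sup>2 / p t) * integral {a..t} p"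
        using t p by (intro integral_Cauchy_Schwarz_weight abs_int_imp_int abs_int_sub[OF v] abs_int_sub[OF nu, unfolded nu_def]
            integrable_continuous_real contp) auto
      then show "(integral {a..t} v)\<^sup>2 \<le> integral {a..t} nu * k t" using t k_int[of t] by (simp add: nu_def[abs_def])
    qed
    with * have "?J \<le> ?E / c\<^sup>2" by simp
    then show ?thesis using c by (simp add: field_simps)
  qed
  define C where "C = pi / (2 * (b - a))"
  have C: "C > 0" using ab' by (simp add: C_def)
  have "C\<^sup>2 * ?J \<le> ?E"
  proof (rule tendsto_upperbound[where F = "at_left C"])
    show "((\<lambda>c. c\<^sup>2 * ?J) \<longlongrightarrow> C\<^sup>2 * ?J) (at_left C)" by (intro tendsto_intros)
    show "\<forall>\<^sub>F c in at_left C. c\<^sup>2 * ?J \<le> ?E"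
      using eventually_at_left_real[OF C] by eventually_elim (use main C_def in auto)
  qed auto
  then have "?J \<le> ?E / C\<^sup>2" using C by (simp add: field_simps)
  also have "\<dots> = (2 * (b - a) / pi)\<^sup>2 * ?E" by (simp add: C_def power_divide field_simps power_mult_distrib)
  finally show ?thesis .
qed auto

section \<open>Square-integrable signals\<close>

lemma L2_iff:
  fixes f :: "real \<Rightarrow> 'a::euclidean_space"
  shows "f \<in> L2 \<longleftrightarrow> f \<in> borel_measurable (lebesgue_on {0..}) \<and> (\<lambda>t. (norm (f t))\<^sup>2) absolutely_integrable_on {0..}"
  by (simp add: L2_def set_integrable_def integrable_restrict_space)

lemma L2_norm_sq:
  fixes f :: "real \<Rightarrow> 'a::euclidean_space"
  assumes "f \<in> L2"
  shows "(L2_norm f)\<^sup>2 = integral {0..} (\<lambda>t. (norm (f t))\<^sup>2)"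
proof -
  have "integrable (lebesgue_on {0..}) (\<lambda>t. (norm (f t))\<^sup>2)" using assms by (simp add: L2_def)
  then have "integral\<^sup>L (lebesgue_on {0..}) (\<lambda>t. (norm (f t))\<^sup>2) = integral {0..} (\<lambda>t. (norm (f t))\<^sup>2)"
    by (rule lebesgue_integral_eq_integral) simp
  moreover have "0 \<le> integral\<^sup>L (lebesgue_on {0..}) (\<lambda>t. (norm (f t))\<^sup>2)" by simp
  ultimately show ?thesis by (simp add: L2_norm_def)
qed

lemma L2_norm_nonneg [simp]: "0 \<le> L2_norm f" by (simp add: L2_norm_def)

lemma truncation_sq_abs_int:
  fixes f :: "real \<Rightarrow> 'a::euclidean_space"
  shows "(\<lambda>t. (norm (truncation \<tau> f t))\<^sup>2) absolutely_integrable_on {0..} \<longleftrightarrow> (\<lambda>t. (norm (f t))\<^sup>2) absolutely_integrable_on {0..\<tau>}"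
proof -
  have "(\<lambda>t. if t \<in> {0..} then (norm (truncation \<tau> f t))\<^sup>2 else 0) = (\<lambda>t. if t \<in> {0..\<tau>} then (norm (f t))\<^sup>2 else 0)"
    by (auto simp: truncation_def fun_eq_iff)
  then show ?thesis
    using absolutely_integrable_restrict_UNIV[of "{0..}" "\<lambda>t. (norm (truncation \<tau> f t))\<^sup>2"]
      absolutely_integrable_restrict_UNIV[of "{0..\<tau>}" "\<lambda>t. (norm (f t))\<^sup>2"] by simp
qed

lemma truncation_measurable:
  fixes f :: "real \<Rightarrow> 'a::euclidean_space"
  assumes "f \<in> borel_measurable (lebesgue_on {0..})"
  shows "truncation \<tau> f \<in> borel_measurable (lebesgue_on {0..})"
proof -
  have "indicat_real {..\<tau>} \<in> borel_measurable (lebesgue_on {0..})"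
    by (intro measurable_restrict_space1 borel_measurable_indicator) simp
  then have "(\<lambda>t. indicat_real {..\<tau>} t *\<^sub>R f t) \<in> borel_measurable (lebesgue_on {0..})"
    using assms by (rule borel_measurable_scaleR)
  moreover have "(\<lambda>t. indicat_real {..\<tau>} t *\<^sub>R f t) = truncation \<tau> f"
    by (auto simp: truncation_def fun_eq_iff)
  ultimately show ?thesis by simp
qed

lemma L2e_measurable:
  fixes f :: "real \<Rightarrow> 'a::euclidean_space"
  assumes "f \<in> L2e"
  shows "f \<in> borel_measurable (lebesgue_on {0..})"
proof (rule borel_measurable_LIMSEQ_metric)
  show "truncation (real (Suc n)) f \<in> borel_measurable (lebesgue_on {0..})" for n
    using assms by (simp add: L2e_def L2_iff)
  fix x :: real
  have "\<forall>\<^sub>F n in sequentially. truncation (real (Suc n)) f x = f x"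
    by (intro eventually_sequentiallyI[of "nat \<lceil>x\<rceil>"]) (simp add: truncation_def nat_le_iff ceiling_le_iff)
  then show "(\<lambda>n. truncation (real (Suc n)) f x) \<longlonglongrightarrow> f x" by (rule tendsto_eventually)
qed

lemma L2e_iff:
  fixes f :: "real \<Rightarrow> 'a::euclidean_space"
  shows "f \<in> L2e \<longleftrightarrow> f \<in> borel_measurable (lebesgue_on {0..}) \<and> (\<forall>\<tau>. (\<lambda>t. (norm (f t))\<^sup>2) absolutely_integrable_on {0..\<tau>})"
proof
  assume f: "f \<in> L2e"
  have "(\<lambda>t. (norm (f t))\<^sup>2) absolutely_integrable_on {0..\<tau>}" for \<tau>
  proof -
    have "(\<lambda>t. (norm (f t))\<^sup>2) absolutely_integrable_on {0..max 1 \<tau>}"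
      using f by (simp add: L2e_def L2_iff flip: truncation_sq_abs_int)
    then show ?thesis by (rule abs_int_sub) auto
  qed
  then show "f \<in> borel_measurable (lebesgue_on {0..}) \<and> (\<forall>\<tau>. (\<lambda>t. (norm (f t))\<^sup>2) absolutely_integrable_on {0..\<tau>})"
    using L2e_measurable[OF f] by simp
qed (simp add: L2e_def L2_iff truncation_sq_abs_int truncation_measurable)

lemma L2_subset_L2e: "L2 \<subseteq> L2e"
proof
  fix f :: "real \<Rightarrow> 'a" assume f: "f \<in> L2"
  have "(\<lambda>t. (norm (f t))\<^sup>2) absolutely_integrable_on {0..\<tau>}" for \<tau>
    using f by (intro absolutely_integrable_on_subinterval[where S="{0..}"]) (auto simp: L2_iff)
  then show "f \<in> L2e" using f by (simp add: L2e_iff L2_iff)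
qed

lemma L2e_truncation_L2: "f \<in> L2e \<Longrightarrow> truncation \<tau> f \<in> L2"
  by (simp add: L2e_iff L2_iff truncation_sq_abs_int truncation_measurable)

lemma measurable_lebesgue_on_subset:
  fixes f :: "real \<Rightarrow> 'a::euclidean_space"
  assumes "f \<in> borel_measurable (lebesgue_on A)" "B \<subseteq> A"
  shows "f \<in> borel_measurable (lebesgue_on B)"
  using measurable_restrict_mono assms by blast

lemma L2e_abs_int_sq:
  fixes f :: "real \<Rightarrow> 'a::euclidean_space"
  assumes "f \<in> L2e" "0 \<le> a"
  shows "(\<lambda>t. (norm (f t))\<^sup>2) absolutely_integrable_on {a..b}"
  using assms abs_int_sub[where f="\<lambda>t. (norm (f t))\<^sup>2" and a=0 and b=b and c=a and d=b] by (auto simp: L2e_iff)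

lemma L2e_abs_int_prod:
  fixes f g :: "real \<Rightarrow> 'a::euclidean_space"
  assumes f: "f \<in> L2e" and g: "g \<in> L2e" and a: "0 \<le> a"
  shows "(\<lambda>t. f t \<bullet> g t) absolutely_integrable_on {a..b}"
proof (rule measurable_bounded_by_integrable_imp_absolutely_integrable)
  have "f \<in> borel_measurable (lebesgue_on {a..b})" "g \<in> borel_measurable (lebesgue_on {a..b})"
    using L2e_measurable[OF f] L2e_measurable[OF g] a by (auto intro: measurable_lebesgue_on_subset[of _ "{0..}"])
  then show "(\<lambda>t. f t \<bullet> g t) \<in> borel_measurable (lebesgue_on {a..b})" by measurable
  show "(\<lambda>t. (norm (f t))\<^sup>2 + (norm (g t))\<^sup>2) integrable_on {a..b}"
    using abs_int_imp_int[OF L2e_abs_int_sq[OF f a]] abs_int_imp_int[OF L2e_abs_int_sq[OF g a]] by (rule integrable_add)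
  fix t
  have "\<bar>f t \<bullet> g t\<bar> \<le> norm (f t) * norm (g t)" by (rule Cauchy_Schwarz_ineq2)
  moreover have "2 * norm (f t) * norm (g t) \<le> (norm (f t))\<^sup>2 + (norm (g t))\<^sup>2"
    by (rule sum_squares_bound)
  ultimately show "norm (f t \<bullet> g t) \<le> (norm (f t))\<^sup>2 + (norm (g t))\<^sup>2"
    using mult_nonneg_nonneg[OF norm_ge_zero norm_ge_zero, of "f t" "g t"]
    unfolding real_norm_def by linarith
qed auto

lemma L2e_abs_int:
  fixes f :: "real \<Rightarrow> 'a::euclidean_space"
  assumes f: "f \<in> L2e" and a: "0 \<le> a"
  shows "f absolutely_integrable_on {a..b}"
proof (rule measurable_bounded_by_integrable_imp_absolutely_integrable)
  show "f \<in> borel_measurable (lebesgue_on {a..b})"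
    using L2e_measurable[OF f] a by (auto intro: measurable_lebesgue_on_subset[of _ "{0..}"])
  show "(\<lambda>t. 1 + (norm (f t))\<^sup>2) integrable_on {a..b}"
    using abs_int_imp_int[OF L2e_abs_int_sq[OF f a]] by (intro integrable_add) auto
  fix t
  have "2 * norm (f t) * 1 \<le> (norm (f t))\<^sup>2 + 1\<^sup>2" by (rule sum_squares_bound)
  then show "norm (f t) \<le> 1 + (norm (f t))\<^sup>2" unfolding mult_1_right power_one using norm_ge_zero[of "f t"] by linarith
qed auto

lemma L2e_lin:
  fixes f g :: "real \<Rightarrow> 'a::euclidean_space"
  assumes f: "f \<in> L2e" and g: "g \<in> L2e"
  shows "(\<lambda>t. a *\<^sub>R f t + b *\<^sub>R g t) \<in> L2e"
proof -
  have "(\<lambda>t. (norm (a *\<^sub>R f t + b *\<^sub>R g t))\<^sup>2) absolutely_integrable_on {0..\<tau>}" for \<tau>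
  proof -
    have "(\<lambda>t. a\<^sup>2 * (f t \<bullet> f t) + (2 * a * b) * (f t \<bullet> g t) + b\<^sup>2 * (g t \<bullet> g t)) absolutely_integrable_on {0..\<tau>}"
      using f g by (intro set_integral_add(1) set_integrable_mult_right L2e_abs_int_prod) auto
    then show ?thesis
      by (rule back_subst[of "\<lambda>f. f absolutely_integrable_on {0..\<tau>}"])
        (simp only: fun_eq_iff power2_norm_eq_inner inner_add_left inner_add_right inner_scaleR_left inner_scaleR_right, simp add: inner_commute power2_eq_square algebra_simps)
  qed
  moreover have "(\<lambda>t. a *\<^sub>R f t + b *\<^sub>R g t) \<in> borel_measurable (lebesgue_on {0..})"
    using L2e_measurable[OF f] L2e_measurable[OF g] by measurable
  ultimately show ?thesis by (simp add: L2e_iff)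
qed

lemma L2e_add: "f \<in> L2e \<Longrightarrow> g \<in> L2e \<Longrightarrow> (\<lambda>t. f t + g t) \<in> L2e"
  and L2e_diff: "f \<in> L2e \<Longrightarrow> g \<in> L2e \<Longrightarrow> (\<lambda>t. f t - g t) \<in> L2e"
  and L2e_uminus: "f \<in> L2e \<Longrightarrow> (\<lambda>t. - f t) \<in> L2e"
  for f g :: "real \<Rightarrow> 'a::euclidean_space"
  using L2e_lin[of f g 1 1] L2e_lin[of f g 1 "-1"] L2e_lin[of f f "-1" 0] by auto

lemma L2e_zero: "(\<lambda>t. 0) \<in> L2e" by (simp add: L2e_iff)

lemma L2e_linear:
  fixes f :: "real \<Rightarrow> 'a::euclidean_space" and L :: "'a \<Rightarrow> 'b::euclidean_space"
  assumes f: "f \<in> L2e" and L: "bounded_linear L"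
  shows "(\<lambda>t. L (f t)) \<in> L2e"
proof -
  have m: "(\<lambda>t. L (f t)) \<in> borel_measurable (lebesgue_on {0..})"
    using L2e_measurable[OF f] borel_measurable_continuous_onI[OF linear_continuous_on[OF L]]
    by (rule measurable_compose)
  have "(\<lambda>t. (norm (L (f t)))\<^sup>2) absolutely_integrable_on {0..\<tau>}" for \<tau>
  proof (rule measurable_bounded_by_integrable_imp_absolutely_integrable)
    have "(\<lambda>t. L (f t)) \<in> borel_measurable (lebesgue_on {0..\<tau>})"
      using m by (rule measurable_lebesgue_on_subset) auto
    then show "(\<lambda>t. (norm (L (f t)))\<^sup>2) \<in> borel_measurable (lebesgue_on {0..\<tau>})" by measurable
    show "(\<lambda>t. (onorm L)\<^sup>2 * (norm (f t))\<^sup>2) integrable_on {0..\<tau>}"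
      using abs_int_imp_int[OF L2e_abs_int_sq[OF f order_refl]] by (rule integrable_on_mult_right)
    show "norm ((norm (L (f t)))\<^sup>2) \<le> (onorm L)\<^sup>2 * (norm (f t))\<^sup>2" for t
      using power_mono[OF onorm[OF L, of "f t"], of 2] by (simp add: power_mult_distrib)
  qed auto
  with m show ?thesis by (simp add: L2e_iff)
qed

lemma L2e_continuous:
  fixes f :: "real \<Rightarrow> 'a::euclidean_space"
  assumes "continuous_on {0..} f"
  shows "f \<in> L2e"
proof -
  have "(\<lambda>t. (norm (f t))\<^sup>2) absolutely_integrable_on {0..\<tau>}" for \<tau>
    by (intro absolutely_integrable_continuous_real continuous_intros continuous_on_subset[OF assms]) auto
  then show ?thesis using continuous_imp_measurable_on_sets_lebesgue[OF assms] by (simp add: L2e_iff)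
qed

section \<open>Energies on finite horizons\<close>

definition energy :: "(real \<Rightarrow> 'a::euclidean_space) \<Rightarrow> real \<Rightarrow> real" where
  "energy f \<tau> = integral {0..\<tau>} (\<lambda>t. (norm (f t))\<^sup>2)"

lemma energy_nonneg: "f \<in> L2e \<Longrightarrow> 0 \<le> energy f \<tau>"
  unfolding energy_def by (intro integral_nonneg abs_int_imp_int L2e_abs_int_sq) auto

lemma energy_mono: "f \<in> L2e \<Longrightarrow> \<tau> \<le> \<tau>' \<Longrightarrow> energy f \<tau> \<le> energy f \<tau>'"
  unfolding energy_def by (intro integral_subset_le abs_int_imp_int L2e_abs_int_sq) auto

lemma energy_le_L2_norm:
  assumes "f \<in> L2" shows "energy f \<tau> \<le> (L2_norm f)\<^sup>2"
  unfolding energy_def L2_norm_sq[OF assms]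
  using assms L2_subset_L2e by (intro integral_subset_le abs_int_imp_int L2e_abs_int_sq) (auto simp: L2_iff)

lemma abs_int_tendsto:
  fixes f :: "real \<Rightarrow> 'a::euclidean_space"
  assumes "f absolutely_integrable_on {0..}"
  shows "(\<lambda>n. integral {0..real n} f) \<longlonglongrightarrow> integral {0..} f"
proof -
  have "(\<lambda>n. integral {0..} (\<lambda>t. if t \<in> {0..real n} then f t else 0)) \<longlonglongrightarrow> integral {0..} f"
  proof (rule dominated_convergence(2))
    show "(\<lambda>t. norm (f t)) integrable_on {0..}" using assms by (simp add: absolutely_integrable_on_def)
    show "(\<lambda>t. if t \<in> {0..real n} then f t else 0) integrable_on {0..}" for n
      using abs_int_imp_int[OF absolutely_integrable_on_subinterval[OF assms, of 0 "real n"]]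
      by (subst integrable_restrict_Int) (auto simp: Int_absorb2 Int_absorb1)
    fix x :: real assume x: "x \<in> {0..}"
    then have "\<forall>\<^sub>F n in sequentially. (if x \<in> {0..real n} then f x else 0) = f x"
      using x by (intro eventually_sequentiallyI[of "nat \<lceil>x\<rceil>"]) (simp add: nat_le_iff ceiling_le_iff)
    then show "(\<lambda>n. if x \<in> {0..real n} then f x else 0) \<longlonglongrightarrow> f x"
      by (rule tendsto_eventually)
  qed auto
  moreover have "integral {0..} (\<lambda>t. if t \<in> {0..real n} then f t else 0) = integral {0..real n} f" for n
    by (subst integral_restrict_Int) (auto simp: Int_absorb2 Int_absorb1)
  ultimately show ?thesis by simp
qed

lemma energy_tendsto:
  assumes "f \<in> L2" shows "(\<lambda>n. energy f (real n)) \<longlonglongrightarrow> (L2_norm f)\<^sup>2"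
  unfolding energy_def L2_norm_sq[OF assms] using assms by (intro abs_int_tendsto) (simp add: L2_iff)

text \<open>Monotone convergence along the integer horizons. It turns energy bounds that are uniform
  in the horizon into membership in \<open>L2\<close>.\<close>

lemma L2_if_energy_bounded:
  fixes f :: "real \<Rightarrow> 'a::euclidean_space"
  assumes f: "f \<in> L2e" and C: "\<And>\<tau>. 0 < \<tau> \<Longrightarrow> energy f \<tau> \<le> C"
  shows "f \<in> L2" "(L2_norm f)\<^sup>2 \<le> C"
proof -
  let ?g = "\<lambda>n t. if t \<in> {0..real n} then (norm (f t))\<^sup>2 else 0"
  have ig: "integral {0..} (?g n) = energy f (real n)" for n
    unfolding energy_def by (subst integral_restrict_Int) (auto simp: Int_absorb2 Int_absorb1)
  have C0: "0 \<le> C" using C[of 1] energy_nonneg[OF f, of 1] by simp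
  have "(\<lambda>t. (norm (f t))\<^sup>2) integrable_on {0..} \<and> (\<lambda>k. integral {0..} (?g k)) \<longlonglongrightarrow> integral {0..} (\<lambda>t. (norm (f t))\<^sup>2)"
  proof (rule monotone_convergence_increasing)
    show "?g n integrable_on {0..}" for n
      using abs_int_imp_int[OF L2e_abs_int_sq[OF f, of 0 "real n"]]
      by (subst integrable_restrict_Int) (auto simp: Int_absorb2 Int_absorb1)
    fix x :: real assume x: "x \<in> {0..}"
    then have "\<forall>\<^sub>F n in sequentially. ?g n x = (norm (f x))\<^sup>2"
      using x by (intro eventually_sequentiallyI[of "nat \<lceil>x\<rceil>"]) (simp add: nat_le_iff ceiling_le_iff)
    then show "(\<lambda>n. ?g n x) \<longlonglongrightarrow> (norm (f x))\<^sup>2" by (rule tendsto_eventually)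
  next
    \<comment> \<open>The assumption speaks of positive horizons; on horizon 0 the energy is
      0.\<close>
    have "energy f (real n) \<le> C \<and> 0 \<le> energy f (real n)" for n
      using C[of "real n"] C0 energy_nonneg[OF f, of "real n"] by (cases "n = 0") (auto simp: energy_def)
    then show "bounded (range (\<lambda>k. integral {0..} (?g k)))"
      unfolding ig by (intro boundedI[of _ C]) auto
  qed auto
  then have "(\<lambda>t. (norm (f t))\<^sup>2) absolutely_integrable_on {0..}"
    by (intro nonnegative_absolutely_integrable_1) auto
  then show L2: "f \<in> L2" using L2e_measurable[OF f] by (simp add: L2_iff)
  have "energy f (real n) \<le> C" for n
      using C[of "real n"] C0 by (cases "n = 0") (auto simp: energy_def)
  then show "(L2_norm f)\<^sup>2 \<le> C"
    by (intro LIMSEQ_le_const2[OF energy_tendsto[OF L2]]) auto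
qed

lemma energy_add:
  fixes f g :: "real \<Rightarrow> 'a::euclidean_space"
  assumes f: "f \<in> L2e" and g: "g \<in> L2e"
  shows "energy (\<lambda>t. f t + g t) \<tau> \<le> 2 * energy f \<tau> + 2 * energy g \<tau>"
proof -
  have i: "(\<lambda>t. (norm (f t))\<^sup>2) integrable_on {0..\<tau>}" "(\<lambda>t. (norm (g t))\<^sup>2) integrable_on {0..\<tau>}"
    "(\<lambda>t. (norm (f t + g t))\<^sup>2) integrable_on {0..\<tau>}"
    using f g by (auto intro!: abs_int_imp_int L2e_abs_int_sq L2e_add)
  have "energy (\<lambda>t. f t + g t) \<tau> \<le> integral {0..\<tau>} (\<lambda>t. 2 * (norm (f t))\<^sup>2 + 2 * (norm (g t))\<^sup>2)"
    unfolding energy_def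
  proof (rule integral_le)
    show "(\<lambda>t. 2 * (norm (f t))\<^sup>2 + 2 * (norm (g t))\<^sup>2) integrable_on {0..\<tau>}"
      using i by (intro integrable_add integrable_on_mult_right)
    fix t
    have "norm (f t + g t) ^ 2 \<le> (norm (f t) + norm (g t))\<^sup>2" by (intro power_mono norm_triangle_ineq) auto
    also have "\<dots> \<le> 2 * (norm (f t))\<^sup>2 + 2 * (norm (g t))\<^sup>2"
      using sum_squares_bound[of "norm (f t)" "norm (g t)"] by (simp add: power2_sum)
    finally show "norm (f t + g t) ^ 2 \<le> 2 * (norm (f t))\<^sup>2 + 2 * (norm (g t))\<^sup>2" .
  qed (use i in auto)
  also have "\<dots> = 2 * energy f \<tau> + 2 * energy g \<tau>"
    using i unfolding energy_def by (simp add: HK_integral_add integrable_on_mult_right)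
  finally show ?thesis .
qed

lemma L2_add:
  fixes f g :: "real \<Rightarrow> 'a::euclidean_space"
  assumes f: "f \<in> L2" and g: "g \<in> L2"
  shows "(\<lambda>t. f t + g t) \<in> L2" "(L2_norm (\<lambda>t. f t + g t))\<^sup>2 \<le> 2 * (L2_norm f)\<^sup>2 + 2 * (L2_norm g)\<^sup>2"
proof -
  have e: "f \<in> L2e" "g \<in> L2e" using f g L2_subset_L2e by auto
  have "energy (\<lambda>t. f t + g t) \<tau> \<le> 2 * (L2_norm f)\<^sup>2 + 2 * (L2_norm g)\<^sup>2" for \<tau>
    using energy_add[OF e, of \<tau>] energy_le_L2_norm[OF f, of \<tau>] energy_le_L2_norm[OF g, of \<tau>] by simp
  then show "(\<lambda>t. f t + g t) \<in> L2" "(L2_norm (\<lambda>t. f t + g t))\<^sup>2 \<le> 2 * (L2_norm f)\<^sup>2 + 2 * (L2_norm g)\<^sup>2"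
    using L2_if_energy_bounded[OF L2e_add[OF e]] by auto
qed

lemma L2_linear:
  fixes f :: "real \<Rightarrow> 'a::euclidean_space" and L :: "'a \<Rightarrow> 'b::euclidean_space"
  assumes f: "f \<in> L2" and L: "bounded_linear L" and K: "\<And>x. norm (L x) \<le> K * norm x"
  shows "(\<lambda>t. L (f t)) \<in> L2" "(L2_norm (\<lambda>t. L (f t)))\<^sup>2 \<le> K\<^sup>2 * (L2_norm f)\<^sup>2"
proof -
  have e: "f \<in> L2e" using f L2_subset_L2e by auto
  have "energy (\<lambda>t. L (f t)) \<tau> \<le> K\<^sup>2 * (L2_norm f)\<^sup>2" for \<tau>
  proof -
    have "energy (\<lambda>t. L (f t)) \<tau> \<le> integral {0..\<tau>} (\<lambda>t. K\<^sup>2 * (norm (f t))\<^sup>2)"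
      unfolding energy_def
    proof (rule integral_le)
      show "(\<lambda>t. (norm (L (f t)))\<^sup>2) integrable_on {0..\<tau>}"
        by (intro abs_int_imp_int L2e_abs_int_sq L2e_linear[OF e L]) auto
      show "(\<lambda>t. K\<^sup>2 * (norm (f t))\<^sup>2) integrable_on {0..\<tau>}"
        by (intro integrable_on_mult_right abs_int_imp_int L2e_abs_int_sq e) auto
      show "norm (L (f t)) ^ 2 \<le> K\<^sup>2 * (norm (f t))\<^sup>2" for t
        using power_mono[OF K[of "f t"], of 2] by (simp add: power_mult_distrib)
    qed
    also have "\<dots> = K\<^sup>2 * energy f \<tau>" by (simp add: energy_def)
    also have "\<dots> \<le> K\<^sup>2 * (L2_norm f)\<^sup>2" by (intro mult_left_mono energy_le_L2_norm f) auto
    finally show ?thesis .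
  qed
  then show "(\<lambda>t. L (f t)) \<in> L2" "(L2_norm (\<lambda>t. L (f t)))\<^sup>2 \<le> K\<^sup>2 * (L2_norm f)\<^sup>2"
    using L2_if_energy_bounded[OF L2e_linear[OF e L]] by auto
qed

lemma L2_scaleR: "f \<in> L2 \<Longrightarrow> (\<lambda>t. a *\<^sub>R f t) \<in> L2" for f :: "real \<Rightarrow> 'a::euclidean_space"
  by (rule L2_linear(1)[where K = "\<bar>a\<bar>"]) (auto intro: bounded_linear_scaleR_right)

lemma L2_uminus: "f \<in> L2 \<Longrightarrow> (\<lambda>t. - f t) \<in> L2" for f :: "real \<Rightarrow> 'a::euclidean_space"
  using L2_scaleR[of f "-1"] by simp

lemma L2_diff: "f \<in> L2 \<Longrightarrow> g \<in> L2 \<Longrightarrow> (\<lambda>t. f t - g t) \<in> L2" for f :: "real \<Rightarrow> 'a::euclidean_space"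
  using L2_add(1)[of f "\<lambda>t. - g t"] L2_uminus[of g] by simp

lemma L2_zero: "(\<lambda>t. 0) \<in> L2" by (simp add: L2_iff)

lemma energy_truncation: "energy (truncation \<tau> f) \<tau>' = energy f (min \<tau> \<tau>')"
proof -
  have "energy (truncation \<tau> f) \<tau>' = integral {0..\<tau>'} (\<lambda>t. if t \<in> {..\<tau>} then (norm (f t))\<^sup>2 else 0)"
    unfolding energy_def by (rule HK_integral_cong) (auto simp: truncation_def)
  also have "\<dots> = integral ({..\<tau>} \<inter> {0..\<tau>'}) (\<lambda>t. (norm (f t))\<^sup>2)"
    by (subst integral_restrict_Int) (simp add: Int_commute)
  also have "{..\<tau>} \<inter> {0..\<tau>'} = {0..min \<tau> \<tau>'}" by auto
  finally show ?thesis by (simp add: energy_def)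
qed

lemma L2_norm_truncation:
  assumes "f \<in> L2e" "0 < \<tau>" shows "(L2_norm (truncation \<tau> f))\<^sup>2 = energy f \<tau>"
proof (rule antisym)
  have t: "truncation \<tau> f \<in> L2" by (rule L2e_truncation_L2[OF assms(1)])
  show "(L2_norm (truncation \<tau> f))\<^sup>2 \<le> energy f \<tau>"
    using t L2_subset_L2e energy_mono[OF assms(1)]
    by (intro L2_if_energy_bounded(2)) (auto simp: energy_truncation)
  show "energy f \<tau> \<le> (L2_norm (truncation \<tau> f))\<^sup>2"
    using energy_le_L2_norm[OF t, of \<tau>] by (simp add: energy_truncation)
qed

section \<open>Equality up to null sets\<close>

lemma signal_eq_negligible: "f \<simeq> g \<longleftrightarrow> negligible {t. 0 \<le> t \<and> f t \<noteq> g t}"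
proof -
  have "f \<simeq> g \<longleftrightarrow> (AE t in lebesgue. t \<in> {0..} \<longrightarrow> f t = g t)"
    unfolding signal_eq_def by (subst AE_restrict_space_iff) auto
  also have "\<dots> \<longleftrightarrow> {t. 0 \<le> t \<and> f t \<noteq> g t} \<in> null_sets lebesgue"
    by (subst completion.AE_iff_null_sets) (auto intro!: arg_cong[of _ _ "\<lambda>A. A \<in> _"])
  finally show ?thesis by (simp add: negligible_iff_null_sets)
qed

lemma signal_eq_refl [simp, intro]: "f \<simeq> f" by (simp add: signal_eq_def)

lemma signal_eq_sym: assumes "f \<simeq> g" shows "g \<simeq> f"
  using assms unfolding signal_eq_def by eventually_elim simp

lemma signal_eq_trans [trans]: assumes "f \<simeq> g" "g \<simeq> h" shows "f \<simeq> h"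
  using assms unfolding signal_eq_def by eventually_elim simp

lemma signal_eqI: "(\<And>t. 0 \<le> t \<Longrightarrow> f t = g t) \<Longrightarrow> f \<simeq> g"
  by (auto simp: signal_eq_negligible intro: negligible_subset[OF negligible_empty])

lemma signal_eq_comp: assumes "f \<simeq> g" shows "(\<lambda>t. h t (f t)) \<simeq> (\<lambda>t. h t (g t))"
  using assms unfolding signal_eq_def by eventually_elim simp

lemma signal_eq_truncation: "f \<simeq> g \<Longrightarrow> truncation \<tau> f \<simeq> truncation \<tau> g"
  unfolding truncation_def by (rule signal_eq_comp)

lemma truncation_truncation: "truncation \<tau> (truncation \<tau>' f) = truncation (min \<tau> \<tau>') f"
  by (auto simp: truncation_def fun_eq_iff)

text \<open>Integer horizons suffice, so only countably many null sets are united.\<close>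

lemma signal_eq_if_truncations:
  assumes "\<And>\<tau>. 0 < \<tau> \<Longrightarrow> truncation \<tau> f \<simeq> truncation \<tau> g" shows "f \<simeq> g"
proof -
  have "AE t in lebesgue_on {0..}. \<forall>n. truncation (real (Suc n)) f t = truncation (real (Suc n)) g t"
    using assms by (subst AE_all_countable) (simp add: signal_eq_def)
  then show ?thesis unfolding signal_eq_def
  proof eventually_elim
    case (elim t)
    have "t \<le> real (Suc (nat \<lceil>t\<rceil>))" by linarith
    then show ?case using elim[rule_format, of "nat \<lceil>t\<rceil>"] by (simp add: truncation_def)
  qed
qed

lemma signal_eq_integral:
  assumes "truncation b f \<simeq> truncation b g" "0 \<le> a"
  shows "integral {a..b} (\<lambda>t. h t (f t)) = integral {a..b} (\<lambda>t. h t (g t))"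
proof (rule integral_spike)
  show "negligible {t. 0 \<le> t \<and> truncation b f t \<noteq> truncation b g t}" using assms(1) by (simp add: signal_eq_negligible)
qed (use assms(2) in \<open>auto simp: truncation_def\<close>)

lemma signal_eq_measurable:
  fixes f g :: "real \<Rightarrow> 'a::euclidean_space"
  assumes "f \<simeq> g" "f \<in> borel_measurable (lebesgue_on {0..})"
  shows "g \<in> borel_measurable (lebesgue_on {0..})"
proof -
  have "f measurable_on {0..}" using assms(2) by (simp add: measurable_on_iff_borel_measurable)
  then have "g measurable_on {0..}"
    by (rule measurable_on_spike) (use assms(1) in \<open>auto simp: signal_eq_negligible\<close>)
  then show ?thesis by (simp add: measurable_on_iff_borel_measurable)
qed

lemma signal_eq_L2e:
  fixes f g :: "real \<Rightarrow> 'a::euclidean_space"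
  assumes eq: "f \<simeq> g" and f: "f \<in> L2e" shows "g \<in> L2e"
proof -
  have "(\<lambda>t. (norm (g t))\<^sup>2) absolutely_integrable_on {0..\<tau>}" for \<tau>
    by (rule absolutely_integrable_spike[OF L2e_abs_int_sq[OF f order_refl]])
      (use eq in \<open>auto simp: signal_eq_negligible\<close>)
  then show ?thesis using signal_eq_measurable[OF eq L2e_measurable[OF f]] by (simp add: L2e_iff)
qed

lemma signal_eq_energy: "truncation \<tau> f \<simeq> truncation \<tau> g \<Longrightarrow> energy f \<tau> = energy g \<tau>"
  unfolding energy_def using signal_eq_integral[of \<tau> f g 0 "\<lambda>_ x. (norm x)\<^sup>2"] by simp

lemma signal_eq_L2:
  fixes f g :: "real \<Rightarrow> 'a::euclidean_space"
  assumes eq: "f \<simeq> g" and f: "f \<in> L2" shows "g \<in> L2" "L2_norm g = L2_norm f"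
proof -
  have ge: "g \<in> L2e" using signal_eq_L2e[OF eq] f L2_subset_L2e by auto
  have en: "energy g \<tau> = energy f \<tau>" for \<tau> using signal_eq_energy[OF signal_eq_truncation[OF eq]] by simp
  show g: "g \<in> L2" by (rule L2_if_energy_bounded(1)[OF ge, of "(L2_norm f)\<^sup>2"]) (simp add: en energy_le_L2_norm[OF f])
  have "(L2_norm g)\<^sup>2 = (L2_norm f)\<^sup>2"
    using LIMSEQ_unique[OF energy_tendsto[OF g]] energy_tendsto[OF f] by (simp add: en)
  then show "L2_norm g = L2_norm f" by (simp add: power2_eq_iff_nonneg)
qed

section \<open>Pairs of scalar signals\<close>

lemma L2e_pair:
  fixes x :: "real \<Rightarrow> real \<times> real"
  shows "x \<in> L2e \<longleftrightarrow> (fst \<circ> x) \<in> L2e \<and> (snd \<circ> x) \<in> L2e"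
proof
  assume "x \<in> L2e"
  then show "(fst \<circ> x) \<in> L2e \<and> (snd \<circ> x) \<in> L2e"
    using L2e_linear[of x fst] L2e_linear[of x snd] bounded_linear_fst bounded_linear_snd by (auto simp: o_def)
next
  assume a: "(fst \<circ> x) \<in> L2e \<and> (snd \<circ> x) \<in> L2e"
  have "(\<lambda>t. (fst (x t), 0) + (0, snd (x t))) \<in> L2e"
    using a L2e_linear[of "fst \<circ> x" "\<lambda>r. (r, 0::real)", OF _ bounded_linear_Pair[OF bounded_linear_ident bounded_linear_zero]]
      L2e_linear[of "snd \<circ> x" "\<lambda>r. (0::real, r)", OF _ bounded_linear_Pair[OF bounded_linear_zero bounded_linear_ident]]
    by (intro L2e_add) (auto simp: o_def)
  then show "x \<in> L2e" by simp
qed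

lemma energy_pair:
  fixes x :: "real \<Rightarrow> real \<times> real"
  assumes "x \<in> L2e"
  shows "energy x \<tau> = energy (fst \<circ> x) \<tau> + energy (snd \<circ> x) \<tau>"
proof -
  have "(\<lambda>t. (norm (x t))\<^sup>2) = (\<lambda>t. (norm ((fst \<circ> x) t))\<^sup>2 + (norm ((snd \<circ> x) t))\<^sup>2)"
    by (auto simp: fun_eq_iff norm_prod_def)
  moreover have "(\<lambda>t. (norm ((fst \<circ> x) t))\<^sup>2) integrable_on {0..\<tau>}" "(\<lambda>t. (norm ((snd \<circ> x) t))\<^sup>2) integrable_on {0..\<tau>}"
    using assms unfolding L2e_pair by (blast intro: abs_int_imp_int L2e_abs_int_sq)+
  ultimately show ?thesis
    unfolding energy_def by (simp add: HK_integral_add)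
qed

lemma L2_pair:
  fixes x :: "real \<Rightarrow> real \<times> real"
  shows "x \<in> L2 \<longleftrightarrow> (fst \<circ> x) \<in> L2 \<and> (snd \<circ> x) \<in> L2"
    "x \<in> L2 \<Longrightarrow> (L2_norm x)\<^sup>2 = (L2_norm (fst \<circ> x))\<^sup>2 + (L2_norm (snd \<circ> x))\<^sup>2"
proof -
  show *: "x \<in> L2 \<longleftrightarrow> (fst \<circ> x) \<in> L2 \<and> (snd \<circ> x) \<in> L2"
  proof
    assume x: "x \<in> L2"
    then have e: "x \<in> L2e" using L2_subset_L2e by auto
    have "energy (fst \<circ> x) \<tau> \<le> (L2_norm x)\<^sup>2 \<and> energy (snd \<circ> x) \<tau> \<le> (L2_norm x)\<^sup>2" for \<tau>
      using energy_le_L2_norm[OF x, of \<tau>] energy_pair[OF e, of \<tau>] e energy_nonneg[of "fst \<circ> x" \<tau>] energy_nonneg[of "snd \<circ> x" \<tau>]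
      by (auto simp: L2e_pair)
    then show "(fst \<circ> x) \<in> L2 \<and> (snd \<circ> x) \<in> L2" using e L2_if_energy_bounded(1) unfolding L2e_pair by metis
  next
    assume a: "(fst \<circ> x) \<in> L2 \<and> (snd \<circ> x) \<in> L2"
    then have e: "x \<in> L2e" using L2_subset_L2e by (auto simp: L2e_pair)
    show "x \<in> L2"
      by (rule L2_if_energy_bounded(1)[OF e, of "(L2_norm (fst \<circ> x))\<^sup>2 + (L2_norm (snd \<circ> x))\<^sup>2"])
        (use a energy_pair[OF e] in \<open>auto intro!: add_mono energy_le_L2_norm\<close>)
  qed
  assume x: "x \<in> L2"
  then have e: "x \<in> L2e" using L2_subset_L2e by auto
  have "(\<lambda>n. energy x (real n)) \<longlonglongrightarrow> (L2_norm (fst \<circ> x))\<^sup>2 + (L2_norm (snd \<circ> x))\<^sup>2"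
    unfolding energy_pair[OF e] using x * by (intro tendsto_add energy_tendsto) auto
  then show "(L2_norm x)\<^sup>2 = (L2_norm (fst \<circ> x))\<^sup>2 + (L2_norm (snd \<circ> x))\<^sup>2"
    using LIMSEQ_unique[OF energy_tendsto[OF x]] by simp
qed

section \<open>Operators of finite induced norm\<close>

lemma bounded_operatorI:
  assumes "\<And>u. u \<in> L2 \<Longrightarrow> M u \<in> L2" "\<And>u. u \<in> L2 \<Longrightarrow> (L2_norm (M u))\<^sup>2 \<le> C\<^sup>2 * (L2_norm u)\<^sup>2" "0 \<le> C"
  shows "bounded_operator M" "induced_norm M \<le> ennreal C"
proof -
  have le: "L2_norm (M u) \<le> C * L2_norm u" if "u \<in> L2" for u
    by (rule power2_le_imp_le) (use assms(2)[OF that] assms(3) in \<open>auto simp: power_mult_distrib\<close>)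
  have "ennreal (L2_norm (M u)) / ennreal (L2_norm u) \<le> ennreal C" if "u \<in> L2" for u
  proof (cases "L2_norm u = 0")
    \<comment> \<open>Here \<open>L2_norm (M u)\<close> is 0 as well, and the quotient
      \<open>0 / 0\<close> is 0 in \<open>ennreal\<close>.\<close>
    case True
    then show ?thesis using le[OF that] by (simp add: ennreal_neg)
  next
    case False
    then have "L2_norm u > 0" using L2_norm_nonneg[of u] by linarith
    then have "L2_norm (M u) / L2_norm u \<le> C" using le[OF that] by (simp add: divide_le_eq)
    then show ?thesis using \<open>L2_norm u > 0\<close> by (simp add: divide_ennreal ennreal_leI)
  qed
  then show i: "induced_norm M \<le> ennreal C" unfolding induced_norm_def by (intro SUP_least)
  then show "bounded_operator M" unfolding bounded_operator_def using assms(1)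
    by (auto simp: le_less_trans[OF _ ennreal_less_top])
qed

lemma bounded_operatorE:
  assumes "bounded_operator M"
  obtains C where "0 \<le> C" "\<And>u. u \<in> L2 \<Longrightarrow> M u \<in> L2" "\<And>u. u \<in> L2 \<Longrightarrow> (L2_norm (M u))\<^sup>2 \<le> C * (L2_norm u)\<^sup>2"
proof -
  define C where "C = enn2real (induced_norm M)"
  have C: "induced_norm M = ennreal C" using assms by (simp add: bounded_operator_def C_def)
  have "L2_norm (M u) \<le> C * L2_norm u" if u: "u \<in> L2" for u
  proof -
    have le: "ennreal (L2_norm (M u)) / ennreal (L2_norm u) \<le> ennreal C"
      using u C unfolding induced_norm_def by (metis SUP_upper)
    show ?thesis
    proof (cases "L2_norm u = 0")
      case True
      have "ennreal (L2_norm (M u)) = 0"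
      proof (rule ccontr)
        assume "ennreal (L2_norm (M u)) \<noteq> 0"
        then have "ennreal (L2_norm (M u)) / ennreal (L2_norm u) = \<infinity>" using True by (simp add: ennreal_divide_zero)
        then show False using le by (simp add: top_unique)
      qed
      then show ?thesis using True by (simp add: ennreal_eq_0_iff)
    next
      case False
      then have "L2_norm u > 0" using L2_norm_nonneg[of u] by linarith
      then show ?thesis using le by (simp add: divide_ennreal divide_le_eq C_def)
    qed
  qed
  then have "(L2_norm (M u))\<^sup>2 \<le> C\<^sup>2 * (L2_norm u)\<^sup>2" if "u \<in> L2" for u
    using power_mono[of "L2_norm (M u)" "C * L2_norm u" 2] that by (simp add: power_mult_distrib)
  then show ?thesis using assms by (intro that[of "C\<^sup>2"]) (auto simp: bounded_operator_def)
qed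

section \<open>Laplace transforms on the real axis\<close>

definition lap_at :: "(real \<Rightarrow> 'a::euclidean_space) \<Rightarrow> real \<Rightarrow> bool" where
  "lap_at f s \<longleftrightarrow> (\<lambda>t. exp (- (s * t)) *\<^sub>R f t) absolutely_integrable_on {0..}"

definition rlap :: "(real \<Rightarrow> 'a::euclidean_space) \<Rightarrow> real \<Rightarrow> 'a" where
  "rlap f s = integral {0..} (\<lambda>t. exp (- (s * t)) *\<^sub>R f t)"

text \<open>Only the germ of the transform at infinity is recorded. Finitely many such facts can be
  combined without tracking abscissas of convergence or poles, and by \<open>laplace_unique\<close>
  the germ still determines a real signal up to null sets.\<close>

definition has_laplace :: "(real \<Rightarrow> 'a::euclidean_space) \<Rightarrow> (real \<Rightarrow> 'a) \<Rightarrow> bool" where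
  "has_laplace f g \<longleftrightarrow> (\<forall>\<^sub>F s in at_top. lap_at f s \<and> rlap f s = g s)"

lemma abs_int_scaleR_bounded:
  fixes f :: "real \<Rightarrow> 'a::euclidean_space"
  assumes "f absolutely_integrable_on S" "S \<in> sets lebesgue" "continuous_on S c" "bounded (c ` S)"
  shows "(\<lambda>t. c t *\<^sub>R f t) absolutely_integrable_on S"
proof -
  have "bilinear (scaleR :: real \<Rightarrow> 'a \<Rightarrow> 'a)" by (simp add: bilinear_conv_bounded_bilinear bounded_bilinear_scaleR)
  then show ?thesis
    by (rule absolutely_integrable_bounded_measurable_product)
      (use assms continuous_imp_measurable_on_sets_lebesgue[of S c] in auto)
qed

lemma exp_decay_bounded: "0 \<le> c \<Longrightarrow> bounded ((\<lambda>t::real. exp (- (c * t))) ` {0..})"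
  by (rule boundedI[of _ 1]) auto

lemma lap_at_mono:
  assumes f: "lap_at f s" and le: "s \<le> s'" shows "lap_at f s'"
proof -
  have "(\<lambda>t. exp (- ((s' - s) * t)) *\<^sub>R exp (- (s * t)) *\<^sub>R f t) absolutely_integrable_on {0..}"
    by (rule abs_int_scaleR_bounded[OF f[unfolded lap_at_def]]) (use le in \<open>auto intro!: continuous_intros exp_decay_bounded\<close>)
  moreover have "(\<lambda>t. exp (- ((s' - s) * t)) *\<^sub>R exp (- (s * t)) *\<^sub>R f t) = (\<lambda>t. exp (- (s' * t)) *\<^sub>R f t)"
    by (simp add: fun_eq_iff mult_exp_exp) (simp add: algebra_simps)
  ultimately show ?thesis by (simp only: lap_at_def)
qed

lemma has_laplaceE:
  assumes "has_laplace f g"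
  obtains s0 where "s0 > 0" "\<And>s. s \<ge> s0 \<Longrightarrow> lap_at f s" "\<And>s. s \<ge> s0 \<Longrightarrow> rlap f s = g s"
proof -
  obtain N where "\<And>s. s \<ge> N \<Longrightarrow> lap_at f s \<and> rlap f s = g s"
    using assms by (auto simp: has_laplace_def eventually_at_top_linorder)
  then show ?thesis by (intro that[of "max 1 N"]) auto
qed

lemma has_laplaceI:
  assumes "\<And>s. s > s0 \<Longrightarrow> lap_at f s" "\<And>s. s > s0 \<Longrightarrow> rlap f s = g s"
  shows "has_laplace f g"
  unfolding has_laplace_def using assms by (auto intro!: eventually_mono[OF eventually_gt_at_top[of s0]])

lemma has_laplace_cong:
  assumes "has_laplace f g" "\<forall>\<^sub>F s in at_top. g s = g' s" shows "has_laplace f g'"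
  using assms unfolding has_laplace_def by eventually_elim auto

lemma has_laplace_unique_ev:
  assumes "has_laplace f g" "has_laplace f g'" shows "\<forall>\<^sub>F s in at_top. g s = g' s"
  using assms unfolding has_laplace_def by eventually_elim auto

lemma has_laplace_add:
  assumes "has_laplace f g" "has_laplace f' g'"
  shows "has_laplace (\<lambda>t. f t + f' t) (\<lambda>s. g s + g' s)"
  using assms unfolding has_laplace_def
proof eventually_elim
  case (elim s)
  then show ?case unfolding lap_at_def rlap_def scaleR_add_right
    using set_integral_add(1)[of lebesgue "{0..}"] by (auto simp: HK_integral_add abs_int_imp_int)
qed

lemma has_laplace_linear:
  fixes L :: "'a::euclidean_space \<Rightarrow> 'b::euclidean_space"
  assumes "has_laplace f g" "bounded_linear L"
  shows "has_laplace (\<lambda>t. L (f t)) (\<lambda>s. L (g s))"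
  using assms(1) unfolding has_laplace_def
proof eventually_elim
  case (elim s)
  have eq: "(\<lambda>t. exp (- (s * t)) *\<^sub>R L (f t)) = L \<circ> (\<lambda>t. exp (- (s * t)) *\<^sub>R f t)"
    by (simp add: fun_eq_iff linear_scale[OF bounded_linear.linear[OF assms(2)]])
  show ?case
    using elim absolutely_integrable_linear[OF _ assms(2)] integral_linear[OF abs_int_imp_int assms(2)]
    unfolding lap_at_def rlap_def eq by auto
qed

lemma has_laplace_diff:
  assumes "has_laplace f g" "has_laplace f' g'"
  shows "has_laplace (\<lambda>t. f t - f' t) (\<lambda>s. g s - g' s)"
  using has_laplace_add[OF assms(1) has_laplace_linear[OF assms(2) bounded_linear_minus[OF bounded_linear_ident]]] by simp

lemma lap_at_signal_eq:
  assumes "f \<simeq> f'" shows "lap_at f s \<Longrightarrow> lap_at f' s" "rlap f s = rlap f' s"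
proof -
  have n: "negligible {t. 0 \<le> t \<and> f t \<noteq> f' t}" using assms by (simp add: signal_eq_negligible)
  show "rlap f s = rlap f' s" unfolding rlap_def by (rule integral_spike[OF n]) auto
  assume "lap_at f s"
  then show "lap_at f' s" unfolding lap_at_def by (rule absolutely_integrable_spike[OF _ n]) auto
qed

lemma has_laplace_signal_eq:
  assumes "has_laplace f g" "f \<simeq> f'" shows "has_laplace f' g"
  using assms(1) unfolding has_laplace_def by eventually_elim (use lap_at_signal_eq[OF assms(2)] in auto)

lemma L2_lap_at:
  assumes f: "f \<in> L2" and s: "s > 0" shows "lap_at f s"
  unfolding lap_at_def
proof (rule measurable_bounded_by_integrable_imp_absolutely_integrable)
  have "(\<lambda>t. exp (- (s * t))) \<in> borel_measurable (lebesgue_on {0..})"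
    by (intro continuous_imp_measurable_on_sets_lebesgue continuous_intros) auto
  then show "(\<lambda>t. exp (- (s * t)) *\<^sub>R f t) \<in> borel_measurable (lebesgue_on {0..})"
    using f by (intro borel_measurable_scaleR) (auto simp: L2_iff)
  show "(\<lambda>t. exp (- (2 * s) * t) + (norm (f t))\<^sup>2) integrable_on {0..}"
    using f s by (intro integrable_add integrable_on_exp_minus_to_infinity abs_int_imp_int) (auto simp: L2_iff)
  fix t
  have "2 * exp (- (s * t)) * norm (f t) \<le> (exp (- (s * t)))\<^sup>2 + (norm (f t))\<^sup>2" by (rule sum_squares_bound)
  moreover have "(exp (- (s * t)))\<^sup>2 = exp (- (2 * s) * t)" by (simp add: power2_eq_square mult_exp_exp algebra_simps)
  moreover have "0 \<le> exp (- (s * t)) * norm (f t)" by simp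
  ultimately show "norm (exp (- (s * t)) *\<^sub>R f t) \<le> exp (- (2 * s) * t) + (norm (f t))\<^sup>2"
    by (simp only: norm_scaleR abs_exp_cancel)
qed auto

lemma L2_has_laplace: "f \<in> L2 \<Longrightarrow> has_laplace f (rlap f)"
  by (rule has_laplaceI[of 0]) (auto intro: L2_lap_at)

lemma lap_at_abs_int:
  assumes "lap_at f s" "0 \<le> a" shows "f absolutely_integrable_on {a..b}"
proof -
  have "(\<lambda>t. exp (- (s * t)) *\<^sub>R f t) absolutely_integrable_on {a..b}"
    by (rule absolutely_integrable_on_subinterval[OF assms(1)[unfolded lap_at_def]]) (use assms(2) in auto)
  then have "(\<lambda>t. exp (s * t) *\<^sub>R exp (- (s * t)) *\<^sub>R f t) absolutely_integrable_on {a..b}"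
    by (rule abs_int_scaleR_bounded) (auto intro!: continuous_intros compact_imp_bounded compact_continuous_image)
  then show ?thesis by (simp add: mult_exp_exp)
qed

lemma lap_at_exp_bounded:
  fixes x :: "real \<Rightarrow> 'a::euclidean_space"
  assumes c: "continuous_on {0..} x" and b: "\<And>t. 0 \<le> t \<Longrightarrow> norm (x t) \<le> C * exp (s0 * t)" and s: "s > s0"
  shows "lap_at x s"
  unfolding lap_at_def
proof (rule measurable_bounded_by_integrable_imp_absolutely_integrable)
  show "(\<lambda>t. exp (- (s * t)) *\<^sub>R x t) \<in> borel_measurable (lebesgue_on {0..})"
    by (intro continuous_imp_measurable_on_sets_lebesgue continuous_intros c) auto
  show "(\<lambda>t. C * exp (- (s - s0) * t)) integrable_on {0..}"
    using s by (intro integrable_on_mult_right integrable_on_exp_minus_to_infinity) auto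
  fix t :: real assume "t \<in> {0..}"
  then have "exp (- (s * t)) * norm (x t) \<le> exp (- (s * t)) * (C * exp (s0 * t))" by (intro mult_left_mono b) auto
  also have "\<dots> = C * exp (- (s - s0) * t)" by (simp add: mult_exp_exp algebra_simps)
  finally show "norm (exp (- (s * t)) *\<^sub>R x t) \<le> C * exp (- (s - s0) * t)" by simp
qed auto

lemma continuous_on_halfline:
  fixes f :: "real \<Rightarrow> 'a::topological_space"
  assumes "\<And>t. 0 < t \<Longrightarrow> continuous_on {0..t} f"
  shows "continuous_on {0..} f"
  unfolding continuous_on_def
proof
  fix x :: real assume x: "x \<in> {0..}"
  have "at x within {0..} = at x within {0..x + 1}"
    by (rule at_within_nhd[of x "{..<x + 1}"]) auto
  then show "(f \<longlongrightarrow> f x) (at x within {0..})"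
    using assms[of "x + 1"] x by (auto simp: continuous_on_def)
qed

text \<open>Integration by parts on \<open>{0..T}\<close>. The boundary term vanishes for large
  \<open>T\<close> because the indefinite integral grows at most like \<open>exp (s0 * t)\<close>,
  and \<open>s\<close> is strictly larger than \<open>s0\<close>.\<close>

lemma lap_at_integral:
  fixes f :: "real \<Rightarrow> 'a::euclidean_space"
  assumes f: "lap_at f s0" and s0: "0 < s0" and s: "s0 < s"
  shows "lap_at (\<lambda>t. integral {0..t} f) s" "rlap (\<lambda>t. integral {0..t} f) s = rlap f s /\<^sub>R s"
proof -
  define F where "F t = integral {0..t} f" for t
  define C where "C = integral {0..} (\<lambda>t. exp (- (s0 * t)) * norm (f t))"
  have ai: "f absolutely_integrable_on {0..t}" for t by (rule lap_at_abs_int[OF f]) simp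
  have Ci: "(\<lambda>t. exp (- (s0 * t)) * norm (f t)) absolutely_integrable_on {0..}"
    using absolutely_integrable_norm[OF f[unfolded lap_at_def]] by (simp add: o_def)
  have Fb: "norm (F t) \<le> C * exp (s0 * t)" if t: "0 \<le> t" for t
  proof -
    have "norm (F t) \<le> integral {0..t} (\<lambda>r. exp (s0 * t) * (exp (- (s0 * r)) * norm (f r)))"
      unfolding F_def
    proof (rule integral_norm_bound_integral)
      show "(\<lambda>r. exp (s0 * t) * (exp (- (s0 * r)) * norm (f r))) integrable_on {0..t}"
        by (intro integrable_on_mult_right abs_int_imp_int absolutely_integrable_on_subinterval[OF Ci]) auto
      fix r assume "r \<in> {0..t}"
      then have "1 \<le> exp (s0 * t) * exp (- (s0 * r))" using s0 by (simp add: mult_exp_exp)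
      then have "1 * norm (f r) \<le> (exp (s0 * t) * exp (- (s0 * r))) * norm (f r)" by (intro mult_right_mono) auto
      then show "norm (f r) \<le> exp (s0 * t) * (exp (- (s0 * r)) * norm (f r))" by (simp add: mult.assoc)
    qed (use ai abs_int_imp_int in blast)
    also have "\<dots> = exp (s0 * t) * integral {0..t} (\<lambda>r. exp (- (s0 * r)) * norm (f r))" by simp
    also have "\<dots> \<le> exp (s0 * t) * C"
      unfolding C_def by (intro mult_left_mono integral_subset_le abs_int_imp_int[OF Ci] abs_int_imp_int[OF absolutely_integrable_on_subinterval[OF Ci]]) auto
    finally show ?thesis by (simp add: mult.commute)
  qed
  have Fc: "continuous_on {0..t} F" for t unfolding F_def by (rule continuous_on_indefinite[OF ai])
  have Fc': "continuous_on {0..} F" by (rule continuous_on_halfline[OF Fc])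
  have F: "lap_at F s" by (rule lap_at_exp_bounded[OF Fc' Fb s])
  then show "lap_at (\<lambda>t. integral {0..t} f) s" by (simp add: F_def[abs_def])
  have fs: "lap_at f s" using lap_at_mono[OF f] s by simp
  \<comment> \<open>The product rule is about inner products, hence the passage to
    coordinates.\<close>
  have "rlap F s \<bullet> b = (rlap f s /\<^sub>R s) \<bullet> b" if b: "b \<in> Basis" for b
  proof -
    have parts: "exp (- (s * T)) * (F T \<bullet> b) = integral {0..T} (\<lambda>t. exp (- (s * t)) *\<^sub>R f t) \<bullet> b - s * (integral {0..T} (\<lambda>t. exp (- (s * t)) *\<^sub>R F t) \<bullet> b)"
      if T: "0 \<le> T" for T
    proof -
      define g where "g t = (- s * exp (- (s * t))) *\<^sub>R b" for t
      have gc: "continuous_on A g" for A by (auto simp: g_def intro!: continuous_intros)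
      have gi: "integral {0..t} g = (exp (- (s * t)) - 1) *\<^sub>R b" if "0 \<le> t" for t
      proof -
        have "((\<lambda>t. - s * exp (- (s * t))) has_integral (exp (- (s * t)) - exp (- (s * 0)))) {0..t}"
          using that by (intro fundamental_theorem_of_calculus)
            (auto intro!: derivative_eq_intros simp flip: has_real_derivative_iff_has_vector_derivative)
        then have "(g has_integral (exp (- (s * t)) - exp (- (s * 0))) *\<^sub>R b) {0..t}"
          unfolding g_def by (rule has_integral_scaleR_left)
        then show ?thesis by auto
      qed
      have i0: "(\<lambda>t. exp (- (s * t)) *\<^sub>R f t) integrable_on {0..T}"
        by (intro abs_int_imp_int absolutely_integrable_on_subinterval[OF fs[unfolded lap_at_def]]) auto
      have i1: "(\<lambda>t. exp (- (s * t)) *\<^sub>R F t) integrable_on {0..T}"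
        by (intro abs_int_imp_int absolutely_integrable_on_subinterval[OF F[unfolded lap_at_def]]) auto
      have i2: "f integrable_on {0..T}" by (rule abs_int_imp_int[OF ai])
      have "F T \<bullet> ((exp (- (s * T)) - 1) *\<^sub>R b) = integral {0..T} (\<lambda>t. f t \<bullet> integral {0..t} g + F t \<bullet> g t)"
        using integral_inner_by_parts(2)[OF T ai absolutely_integrable_continuous_real[OF gc]] gi[OF T] by (simp add: F_def)
      also have "\<dots> = integral {0..T} (\<lambda>t. (exp (- (s * t)) *\<^sub>R f t) \<bullet> b - f t \<bullet> b - s * ((exp (- (s * t)) *\<^sub>R F t) \<bullet> b))"
        by (rule HK_integral_cong) (auto simp: gi g_def algebra_simps)
      also have "\<dots> = integral {0..T} (\<lambda>t. (exp (- (s * t)) *\<^sub>R f t) \<bullet> b) - integral {0..T} (\<lambda>t. f t \<bullet> b) - integral {0..T} (\<lambda>t. s * ((exp (- (s * t)) *\<^sub>R F t) \<bullet> b))"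
        using integrable_component[OF i0, of b] integrable_component[OF i2, of b] integrable_on_mult_right[OF integrable_component[OF i1, of b], of s]
        by (simp only: HK_integral_diff integrable_diff)
      also have "\<dots> = integral {0..T} (\<lambda>t. exp (- (s * t)) *\<^sub>R f t) \<bullet> b - F T \<bullet> b - s * (integral {0..T} (\<lambda>t. exp (- (s * t)) *\<^sub>R F t) \<bullet> b)"
        by (simp only: integral_mult_right integral_component_eq[OF i0] integral_component_eq[OF i1] integral_component_eq[OF i2] F_def[of T])
      finally show ?thesis by (simp add: algebra_simps)
    qed
    have "(\<lambda>n. exp (- (s * real n)) * (F (real n) \<bullet> b)) \<longlonglongrightarrow> 0"
    proof (rule Lim_null_comparison)
      show "\<forall>\<^sub>F n in sequentially. norm (exp (- (s * real n)) * (F (real n) \<bullet> b)) \<le> C * exp (- (s - s0) * real n)"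
      proof (rule always_eventually, rule allI)
        fix n
        have "norm (exp (- (s * real n)) * (F (real n) \<bullet> b)) \<le> exp (- (s * real n)) * (C * exp (s0 * real n))"
          using Fb[of "real n"] Basis_le_norm[OF b, of "F (real n)"] by (simp add: abs_mult)
        also have "\<dots> = C * exp (- (s - s0) * real n)" by (simp add: mult_exp_exp algebra_simps)
        finally show "norm (exp (- (s * real n)) * (F (real n) \<bullet> b)) \<le> C * exp (- (s - s0) * real n)" .
      qed
      have "(\<lambda>n. exp (- (s - s0)) ^ n) \<longlonglongrightarrow> 0" using s by (intro LIMSEQ_realpow_zero) auto
      then have "(\<lambda>n. C * exp (- (s - s0)) ^ n) \<longlonglongrightarrow> C * 0" by (rule tendsto_mult_left)
      then show "(\<lambda>n. C * exp (- (s - s0) * real n)) \<longlonglongrightarrow> 0" by (simp add: exp_of_nat_mult[symmetric] mult.commute)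
    qed
    moreover have "(\<lambda>n. exp (- (s * real n)) * (F (real n) \<bullet> b)) \<longlonglongrightarrow> rlap f s \<bullet> b - s * (rlap F s \<bullet> b)"
    proof -
      have "(\<lambda>n. integral {0..real n} (\<lambda>t. exp (- (s * t)) *\<^sub>R f t) \<bullet> b - s * (integral {0..real n} (\<lambda>t. exp (- (s * t)) *\<^sub>R F t) \<bullet> b))
        \<longlonglongrightarrow> rlap f s \<bullet> b - s * (rlap F s \<bullet> b)"
        unfolding rlap_def by (intro tendsto_intros abs_int_tendsto fs[unfolded lap_at_def] F[unfolded lap_at_def])
      then show ?thesis by (simp add: parts)
    qed
    ultimately have "rlap f s \<bullet> b - s * (rlap F s \<bullet> b) = 0" by (rule LIMSEQ_unique[symmetric])
    then show ?thesis using s s0 by (simp add: field_simps)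
  qed
  then show "rlap (\<lambda>t. integral {0..t} f) s = rlap f s /\<^sub>R s"
    unfolding F_def[symmetric] by (auto intro: euclidean_eqI)
qed

lemma has_laplace_integral:
  assumes "has_laplace f g" shows "has_laplace (\<lambda>t. integral {0..t} f) (\<lambda>s. g s /\<^sub>R s)"
proof -
  obtain s0 where s0: "s0 > 0" "\<And>s. s \<ge> s0 \<Longrightarrow> lap_at f s" "\<And>s. s \<ge> s0 \<Longrightarrow> rlap f s = g s"
    using has_laplaceE[OF assms] by blast
  then show ?thesis using lap_at_integral[OF s0(2)[OF order_refl] s0(1)]
    by (intro has_laplaceI[of s0]) auto
qed

text \<open>Substituting \<open>x = exp (-t)\<close> turns the transform at the integers into moments on \<open>{0..1}\<close>.\<close>
lemma laplace_zero:
  fixes f :: "real \<Rightarrow> real"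
  assumes "has_laplace f (\<lambda>s. 0)" shows "f \<simeq> (\<lambda>t. 0)"
proof -
  obtain s0 where s0: "s0 > 0" "\<And>s. s \<ge> s0 \<Longrightarrow> lap_at f s" "\<And>s. s \<ge> s0 \<Longrightarrow> rlap f s = 0"
    using has_laplaceE[OF assms] by blast
  \<comment> \<open>Damping at \<open>s0\<close> makes \<open>g\<close> absolutely integrable; the
    transform of \<open>f\<close> at \<open>s0 + n\<close> becomes the moment of \<open>g\<close>
    with \<open>exp (- t) ^ n\<close>.\<close>
  define g where "g t = exp (- (s0 * t)) * f t" for t
  have g: "g absolutely_integrable_on {0..}" using s0(2)[OF order_refl] by (simp add: lap_at_def g_def[abs_def])
  have ce: "continuous_on {0..} (\<lambda>t. \<phi> (exp (- t)))" and be: "bounded ((\<lambda>t. \<phi> (exp (- t))) ` {0..})"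
    if "continuous_on {0..1} \<phi>" for \<phi> :: "real \<Rightarrow> real"
  proof -
    show "continuous_on {0..} (\<lambda>t. \<phi> (exp (- t)))"
      by (rule continuous_on_compose2[OF that]) (auto intro!: continuous_intros)
    have "bounded (\<phi> ` {0..1})" by (intro compact_imp_bounded compact_continuous_image that) auto
    then show "bounded ((\<lambda>t. \<phi> (exp (- t))) ` {0..})" by (rule bounded_subset) auto
  qed
  have ai: "(\<lambda>t. \<phi> (exp (- t)) * g t) absolutely_integrable_on {0..}" if "continuous_on {0..1} \<phi>" for \<phi>
    using abs_int_scaleR_bounded[OF g _ ce[OF that] be[OF that]] by simp
  have mono: "integral {0..} (\<lambda>t. exp (- t) ^ n * g t) = 0" for n :: nat
  proof -
    have "integral {0..} (\<lambda>t. exp (- t) ^ n * g t) = rlap f (s0 + real n)"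
      unfolding rlap_def g_def
      by (rule HK_integral_cong) (simp add: exp_of_nat_mult[symmetric] mult_exp_exp algebra_simps)
    then show ?thesis using s0(3)[of "s0 + real n"] by simp
  qed
  have poly: "integral {0..} (\<lambda>t. p (exp (- t)) * g t) = 0" if p: "real_polynomial_function p" for p :: "real \<Rightarrow> real"
  proof -
    obtain a n where pa: "p = (\<lambda>x. \<Sum>i\<le>n. a i * x ^ i)" using p by (auto simp: real_polynomial_function_iff_sum)
    have "integral {0..} (\<lambda>t. p (exp (- t)) * g t) = integral {0..} (\<lambda>t. \<Sum>i\<le>n. a i * (exp (- t) ^ i * g t))"
      by (simp add: pa sum_distrib_right mult.assoc)
    also have "\<dots> = (\<Sum>i\<le>n. integral {0..} (\<lambda>t. a i * (exp (- t) ^ i * g t)))"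
      by (intro integral_sum integrable_on_mult_right abs_int_imp_int ai[of "\<lambda>x. x ^ i" for i]) (auto intro!: continuous_intros)
    also have "\<dots> = 0" by (simp only: integral_mult_right mono) simp
    finally show ?thesis .
  qed
  have cont: "integral {0..} (\<lambda>t. \<phi> (exp (- t)) * g t) = 0" if c: "continuous_on {0..1} \<phi>" for \<phi> :: "real \<Rightarrow> real"
  proof -
    define I where "I = integral {0..} (\<lambda>t. \<bar>g t\<bar>)"
    have gi: "(\<lambda>t. \<bar>g t\<bar>) integrable_on {0..}" using g by (simp add: absolutely_integrable_on_def)
    have I0: "0 \<le> I" unfolding I_def by (rule integral_nonneg[OF gi]) auto
    have "\<bar>integral {0..} (\<lambda>t. \<phi> (exp (- t)) * g t)\<bar> \<le> e" if e: "e > 0" for e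
    proof -
      obtain p where p: "real_polynomial_function p" "\<And>x. x \<in> {0..1} \<Longrightarrow> \<bar>\<phi> x - p x\<bar> < e / (I + 1)"
        using Stone_Weierstrass_real_polynomial_function[OF _ c, of "e / (I + 1)"] e I0 by auto
      have cp: "continuous_on {0..1} p" using p(1) unfolding real_polynomial_function_iff_sum by (auto intro!: continuous_intros) 
      have "integral {0..} (\<lambda>t. \<phi> (exp (- t)) * g t) = integral {0..} (\<lambda>t. (\<phi> (exp (- t)) - p (exp (- t))) * g t)"
        using poly[OF p(1)] abs_int_imp_int[OF ai[OF c]] abs_int_imp_int[OF ai[OF cp]]
        by (simp add: left_diff_distrib HK_integral_diff)
      also have "norm \<dots> \<le> integral {0..} (\<lambda>t. e / (I + 1) * \<bar>g t\<bar>)"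
      proof (rule integral_norm_bound_integral)
        show "(\<lambda>t. (\<phi> (exp (- t)) - p (exp (- t))) * g t) integrable_on {0..}"
          by (intro abs_int_imp_int ai continuous_intros c cp)
        show "(\<lambda>t. e / (I + 1) * \<bar>g t\<bar>) integrable_on {0..}" using gi by (rule integrable_on_mult_right)
        fix t :: real assume "t \<in> {0..}"
        then have "exp (- t) \<in> {0..1}" by simp
        then show "norm ((\<phi> (exp (- t)) - p (exp (- t))) * g t) \<le> e / (I + 1) * \<bar>g t\<bar>"
          using p(2)[of "exp (- t)"] by (simp only: abs_mult real_norm_def) (intro mult_right_mono, auto)
      qed
      also have "\<dots> = e / (I + 1) * I" by (simp add: I_def)
      also have "\<dots> \<le> e" using e I0 by (simp add: field_simps)
      finally show ?thesis by simp
    qed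
    then have "\<bar>integral {0..} (\<lambda>t. \<phi> (exp (- t)) * g t)\<bar> \<le> 0" by (rule field_le_epsilon) simp
    then show ?thesis by simp
  qed
  \<comment> \<open>The additional factor \<open>exp (- t)\<close> admits every bounded continuous
    \<phi> as a test function: after the substitution, \<open>\<phi> (- ln x) * x\<close> extends
    continuously by 0 to \<open>x = 0\<close>, which stands for infinite time.\<close>
  define k where "k t = exp (- t) * g t" for t
  have k: "k absolutely_integrable_on {0..}" unfolding k_def using ai[of "\<lambda>x. x"] by (simp add: continuous_on_id)
  have bc: "(\<lambda>t. \<phi> t * k t) integrable_on {0..}" "integral {0..} (\<lambda>t. \<phi> t * k t) = 0"
    if c: "continuous_on UNIV \<phi>" and b: "\<And>t. \<bar>\<phi> t\<bar> \<le> 1" for \<phi> :: "real \<Rightarrow> real"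
  proof -
    define \<Phi> where "\<Phi> x = (if x \<le> 0 then 0 else \<phi> (- ln x) * x)" for x
    have "continuous_on {0..1} \<Phi>"
      unfolding continuous_on_def
    proof
      fix x :: real assume x: "x \<in> {0..1}"
      show "(\<Phi> \<longlongrightarrow> \<Phi> x) (at x within {0..1})"
      proof (cases "x = 0")
        case True
        have "(\<Phi> \<longlongrightarrow> 0) (at 0 within {0..1})"
        proof (rule Lim_null_comparison[of _ "\<lambda>x. x"])
          have "norm (\<Phi> y) \<le> y" if "y \<in> {0..1}" for y
            using that mult_right_mono[OF b, of y "- ln y"] by (auto simp: \<Phi>_def abs_mult)
          then show "\<forall>\<^sub>F y in at 0 within {0..1}. norm (\<Phi> y) \<le> y"
            by (auto simp: eventually_at_filter)
        qed (rule tendsto_ident_at)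
        then show ?thesis using True by (simp add: \<Phi>_def)
      next
        case False
        then have x0: "x > 0" using x by simp
        have "continuous (at x) (\<lambda>x. \<phi> (- ln x) * x)"
          using x0 c by (intro continuous_intros continuous_at_compose[of x "\<lambda>x. - ln x" \<phi>, unfolded o_def])
            (auto simp: continuous_on_eq_continuous_at)
        moreover have "\<forall>\<^sub>F y in nhds x. \<phi> (- ln y) * y = \<Phi> y"
          using eventually_nhds_in_open[of "{0<..}" x] x0 by (auto simp: \<Phi>_def elim!: eventually_mono)
        ultimately have "continuous (at x) \<Phi>" using isCont_cong[of "\<lambda>x. \<phi> (- ln x) * x" \<Phi> x] by simp
        then show ?thesis by (simp add: isCont_def Lim_at_imp_Lim_at_within)
      qed
    qed
    from ai[OF this] cont[OF this] show "(\<lambda>t. \<phi> t * k t) integrable_on {0..}" "integral {0..} (\<lambda>t. \<phi> t * k t) = 0"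
      by (auto simp: \<Phi>_def k_def mult.assoc dest: abs_int_imp_int)
  qed
  have km: "k \<in> borel_measurable (lebesgue_on {0..})" using absolutely_integrable_imp_borel_measurable[OF k] by simp
  then have "(\<lambda>t. sgn (k t)) \<in> borel_measurable (lebesgue_on {0..})" by measurable
  then have "(\<lambda>t. sgn (k t)) measurable_on {0..}" by (simp add: measurable_on_iff_borel_measurable)
  \<comment> \<open>Continuous functions converge to \<open>sgn (k t)\<close> off the null set
    \<open>N\<close>. Clipped to \<open>[-1, 1]\<close> they are admissible test functions, and
    dominated convergence leaves the integral of \<open>\<bar>k t\<bar>\<close> as limit of
    zeros.\<close>
  then obtain N \<psi> where N: "negligible N" and \<psi>: "\<And>n. continuous_on UNIV (\<psi> n)"
    "\<And>x. x \<notin> N \<Longrightarrow> (\<lambda>n. \<psi> n x) \<longlonglongrightarrow> (if x \<in> {0..} then sgn (k x) else 0)"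
    unfolding measurable_on_def by blast
  define \<phi> where "\<phi> n x = max (- 1) (min 1 (\<psi> n x))" for n :: nat and x
  have \<phi>c: "continuous_on UNIV (\<phi> n)" for n unfolding \<phi>_def by (intro continuous_intros \<psi>)
  have \<phi>b: "\<bar>\<phi> n x\<bar> \<le> 1" for n x by (auto simp: \<phi>_def)
  have kn: "(\<lambda>t. \<bar>k t\<bar>) integrable_on {0..}" using k by (simp add: absolutely_integrable_on_def)
  have S: "negligible ({0..} - ({0..} - N))" "negligible (({0..} - N - {0..}) \<union> ({0..} - ({0..} - N)))"
    by (auto intro: negligible_subset[OF N])
  have "(\<lambda>n. integral ({0..} - N) (\<lambda>t. \<phi> n t * k t)) \<longlonglongrightarrow> integral ({0..} - N) (\<lambda>t. \<bar>k t\<bar>)"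
  proof (rule dominated_convergence(2))
    show "(\<lambda>t. \<phi> n t * k t) integrable_on {0..} - N" for n
      using bc(1)[OF \<phi>c[of n] \<phi>b] integrable_spike_set_eq[OF S(2)] by blast
    show "(\<lambda>t. \<bar>k t\<bar>) integrable_on {0..} - N" using kn integrable_spike_set_eq[OF S(2)] by blast
    show "norm (\<phi> n x * k x) \<le> \<bar>k x\<bar>" for n x using mult_right_mono[OF \<phi>b[of n x], of "\<bar>k x\<bar>"] by (simp add: abs_mult)
    fix x assume x: "x \<in> {0..} - N"
    have "(\<lambda>n. \<phi> n x) \<longlonglongrightarrow> max (- 1) (min 1 (sgn (k x)))" unfolding \<phi>_def
      using \<psi>(2)[of x] x by (intro tendsto_intros) auto
    then have "(\<lambda>n. \<phi> n x * k x) \<longlonglongrightarrow> max (- 1) (min 1 (sgn (k x))) * k x" by (intro tendsto_intros)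
    moreover have "max (- 1) (min 1 (sgn (k x))) * k x = \<bar>k x\<bar>" by (simp add: sgn_real_def)
    ultimately show "(\<lambda>n. \<phi> n x * k x) \<longlonglongrightarrow> \<bar>k x\<bar>" by simp
  qed
  moreover have "integral ({0..} - N) (\<lambda>t. \<phi> n t * k t) = 0" for n
    using integral_subset_negligible[OF _ S(1), of "\<lambda>t. \<phi> n t * k t"] bc(2)[OF \<phi>c[of n] \<phi>b] by auto
  moreover have "integral ({0..} - N) (\<lambda>t. \<bar>k t\<bar>) = integral {0..} (\<lambda>t. \<bar>k t\<bar>)"
    by (rule integral_subset_negligible[OF _ S(1)]) auto
  ultimately have "integral {0..} (\<lambda>t. \<bar>k t\<bar>) = 0" by (simp add: LIMSEQ_const_iff)
  moreover have ki: "integrable (lebesgue_on {0..}) (\<lambda>t. \<bar>k t\<bar>)"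
    using absolutely_integrable_measurable_real[of "{0..}" k] k by simp
  ultimately have "integral\<^sup>L (lebesgue_on {0..}) (\<lambda>t. \<bar>k t\<bar>) = 0"
    using lebesgue_integral_eq_integral[OF ki] by simp
  then have "AE t in lebesgue_on {0..}. \<bar>k t\<bar> = 0" using integral_nonneg_eq_0_iff_AE[OF ki] by simp
  then show ?thesis unfolding signal_eq_def by eventually_elim (simp add: k_def g_def)
qed

lemma laplace_unique:
  fixes f f' :: "real \<Rightarrow> real"
  assumes "has_laplace f g" "has_laplace f' g" shows "f \<simeq> f'"
proof -
  have "(\<lambda>t. f t - f' t) \<simeq> (\<lambda>t. 0)" using laplace_zero[of "\<lambda>t. f t - f' t"] has_laplace_diff[OF assms] by simp
  then show ?thesis unfolding signal_eq_def by eventually_elim simp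
qed

lemma laplace_of_real:
  "integrable (lebesgue_on {0..}) (laplace_integrand u (of_real s)) \<longleftrightarrow> lap_at u s"
  "lap_at u s \<Longrightarrow> laplace u (of_real s) = of_real (rlap u s)"
proof -
  have eq: "laplace_integrand u (of_real s) = (\<lambda>t. complex_of_real (exp (- (s * t)) * u t))"
    by (auto simp: laplace_integrand_def fun_eq_iff exp_of_real simp flip: of_real_mult of_real_minus)
  have i: "integrable (lebesgue_on {0..}) (\<lambda>t. exp (- (s * t)) * u t) \<longleftrightarrow> lap_at u s"
    unfolding lap_at_def by (simp add: set_integrable_def integrable_restrict_space)
  show "integrable (lebesgue_on {0..}) (laplace_integrand u (of_real s)) \<longleftrightarrow> lap_at u s"
    unfolding eq complex_of_real_integrable_eq i ..
  assume "lap_at u s"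
  then have "integrable (lebesgue_on {0..}) (\<lambda>t. exp (- (s * t)) * u t)" using i by simp
  then show "laplace u (of_real s) = of_real (rlap u s)"
    unfolding laplace_def eq integral_complex_of_real rlap_def by (simp add: lebesgue_integral_eq_integral)
qed

lemma transfer_function_has_laplace:
  assumes "has_transfer_function M H" "u \<in> L2"
  shows "has_laplace (M u) (\<lambda>s. Re (H (of_real s)) * rlap u s)"
proof -
  obtain \<sigma> where \<sigma>: "\<sigma> \<ge> 0" "\<And>s. Re s > \<sigma> \<Longrightarrow> integrable (lebesgue_on {0..}) (laplace_integrand (M u) s)"
      "\<And>s. Re s > \<sigma> \<Longrightarrow> laplace (M u) s = H s * laplace u s"
    using assms unfolding has_transfer_function_def by blast
  show ?thesis
  proof (rule has_laplaceI[of \<sigma>])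
    fix s assume s: "s > \<sigma>"
    show l: "lap_at (M u) s" using \<sigma>(2)[of "of_real s"] s by (simp add: laplace_of_real(1))
    have lu: "lap_at u s" using L2_lap_at[OF assms(2)] s \<sigma>(1) by simp
    have "complex_of_real (rlap (M u) s) = H (of_real s) * of_real (rlap u s)"
      using \<sigma>(3)[of "of_real s"] s by (simp add: laplace_of_real(2)[OF l] laplace_of_real(2)[OF lu])
    then have "Re (complex_of_real (rlap (M u) s)) = Re (H (of_real s) * of_real (rlap u s))" by simp
    then show "rlap (M u) s = Re (H (of_real s)) * rlap u s" by simp
  qed
qed

section \<open>Linear differential equations and stable filters\<close>

text \<open>Right-continuous functions that differ at \<open>t\<close> differ on an interval to its
  right, which is not negligible. This turns equality almost everywhere into equality at sampling
  instants.\<close>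

lemma right_continuous_eq:
  fixes f g :: "real \<Rightarrow> real"
  assumes eq: "truncation \<tau> f \<simeq> truncation \<tau> g" and t: "0 \<le> t" "t < \<tau>"
    and f: "continuous (at_right t) f" and g: "continuous (at_right t) g"
  shows "f t = g t"
proof (rule ccontr)
  assume ne: "f t \<noteq> g t"
  have "((\<lambda>s. f s - g s) \<longlongrightarrow> f t - g t) (at_right t)"
    using f g unfolding continuous_within by (intro tendsto_intros)
  then have "\<forall>\<^sub>F s in at_right t. f s - g s \<noteq> 0" by (rule tendsto_imp_eventually_ne) (use ne in auto)
  then obtain b where b: "b > t" "\<And>s. t < s \<Longrightarrow> s < b \<Longrightarrow> f s \<noteq> g s"
    by (auto simp: eventually_at_right_field)
  have "negligible {s. 0 \<le> s \<and> truncation \<tau> f s \<noteq> truncation \<tau> g s}" using eq by (simp add: signal_eq_negligible)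
  then have "negligible {t<..<min b \<tau>}"
    by (rule negligible_subset) (use b t in \<open>auto simp: truncation_def\<close>)
  then show False using b(1) t negligible_interval(2)[of t "min b \<tau>"] by (auto simp: box_real)
qed

lemma continuous_on_halfline_at_right:
  fixes f :: "real \<Rightarrow> 'a::topological_space"
  assumes "continuous_on {0..} f" "0 \<le> t" shows "continuous (at_right t) f"
  using assms by (auto simp: continuous_on_eq_continuous_within intro: continuous_within_subset)

lemma continuous_on_L2e_integral:
  fixes f :: "real \<Rightarrow> 'a::euclidean_space"
  assumes "f \<in> L2e" shows "continuous_on {0..} (\<lambda>t. integral {0..t} f)"
  by (intro continuous_on_halfline continuous_on_indefinite L2e_abs_int assms) auto

text \<open>Banach's fixed point theorem for \<open>t \<mapsto> exp (- \<mu> t) x t\<close>; the weight also yields exponential boundedness.\<close>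
lemma linear_ode_exists:
  fixes A :: "'a::euclidean_space \<Rightarrow> 'a" and f :: "real \<Rightarrow> 'a"
  assumes A: "bounded_linear A" and f: "f \<in> L2"
  obtains x where "continuous_on {0..} x" "\<And>t. 0 \<le> t \<Longrightarrow> x t = integral {0..t} (\<lambda>s. A (x s) + f s)"
    "\<exists>s0. \<forall>s>s0. lap_at x s"
proof -
  define a where "a = onorm A"
  \<comment> \<open>More than twice the operator norm, so that the contraction factor
    \<open>a / \<mu>\<close> is at most 1/2; the summand 1 gives \<open>\<mu> \<ge> 1\<close>, used
    to bound \<open>exp (- (\<mu> * t)) * t\<close>.\<close>
  define \<mu> where "\<mu> = 2 * a + 1"
  have a0: "0 \<le> a" unfolding a_def by (rule onorm_pos_le[OF A])
  have \<mu>: "\<mu> \<ge> 1" using a0 by (simp add: \<mu>_def)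
  have fe: "f \<in> L2e" using f L2_subset_L2e by auto
  have Ab: "norm (A x) \<le> a * norm x" for x unfolding a_def by (rule onorm[OF A])
  have Ac: "continuous_on S (\<lambda>s. A (h s))" if "continuous_on S h" for S h
    using continuous_on_compose2[OF linear_continuous_on[OF A, of UNIV] that] by auto
  define g where "g t = integral {0..t} f" for t
  have gc: "continuous_on {0..} g" unfolding g_def by (rule continuous_on_L2e_integral[OF fe])
  define c where "c = (L2_norm f)\<^sup>2"
  have gb: "exp (- (\<mu> * t)) * norm (g t) \<le> 1 + c" if t: "0 \<le> t" for t
  proof -
    have "norm (g t) \<le> integral {0..t} (\<lambda>s. 1 + (norm (f s))\<^sup>2)"
      unfolding g_def
    proof (rule integral_norm_bound_integral)
      show "f integrable_on {0..t}" by (intro abs_int_imp_int L2e_abs_int fe) auto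
      show "(\<lambda>s. 1 + (norm (f s))\<^sup>2) integrable_on {0..t}" by (intro integrable_add abs_int_imp_int[OF L2e_abs_int_sq[OF fe]]) auto
      show "norm (f s) \<le> 1 + (norm (f s))\<^sup>2" for s
        using sum_squares_bound[of "norm (f s)" 1] norm_ge_zero[of "f s"] unfolding mult_1_right power_one by linarith
    qed
    also have "\<dots> = t + energy f t" unfolding energy_def using t
      by (subst HK_integral_add) (auto intro!: abs_int_imp_int[OF L2e_abs_int_sq[OF fe]])
    also have "\<dots> \<le> t + c" using energy_le_L2_norm[OF f, of t] by (simp add: c_def)
    finally have "exp (- (\<mu> * t)) * norm (g t) \<le> exp (- (\<mu> * t)) * t + exp (- (\<mu> * t)) * c"
      by (simp flip: distrib_left)
    moreover have "exp (- (\<mu> * t)) * c \<le> 1 * c" using t \<mu> by (intro mult_right_mono) (auto simp: c_def)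
    moreover have "exp (- (\<mu> * t)) * t \<le> 1"
    proof -
      have "t \<le> \<mu> * t" using t \<mu> by (simp add: mult_le_cancel_right1)
      also have "\<dots> \<le> exp (\<mu> * t)" using exp_ge_add_one_self[of "\<mu> * t"] by linarith
      finally show ?thesis by (simp add: exp_minus field_simps)
    qed
    ultimately show ?thesis by simp
  qed
  define h where "h z s = A (exp (\<mu> * s) *\<^sub>R apply_bcontfun z s)" for z :: "real \<Rightarrow>\<^sub>C 'a" and s
  \<comment> \<open>\<open>max 0 t\<close> extends the map constantly to negative times, because the
    complete space of bounded continuous functions is taken on the whole line.\<close>
  define \<Psi> where "\<Psi> z t = exp (- (\<mu> * max 0 t)) *\<^sub>R (g (max 0 t) + integral {0..max 0 t} (h z))" for z t
  have hc: "continuous_on S (h z)" for S z unfolding h_def by (intro Ac continuous_intros continuous_on_apply_bcontfun)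
  have hi: "h z integrable_on {0..t}" for z t by (intro integrable_continuous_real hc)
  have exp_int: "integral {0..t} (\<lambda>s. exp (\<mu> * s)) \<le> exp (\<mu> * t) / \<mu>" if "0 \<le> t" for t
  proof -
    have "((\<lambda>s. exp (\<mu> * s)) has_integral (exp (\<mu> * t) / \<mu> - exp (\<mu> * 0) / \<mu>)) {0..t}"
      using that \<mu> by (intro fundamental_theorem_of_calculus)
        (auto intro!: derivative_eq_intros simp flip: has_real_derivative_iff_has_vector_derivative)
    then show ?thesis using \<mu> by (auto dest!: integral_unique)
  qed
  have key: "exp (- (\<mu> * t)) * norm (integral {0..t} k) \<le> a * M / \<mu>"
    if t: "0 \<le> t" and k: "continuous_on {0..t} k" "\<And>s. 0 \<le> s \<Longrightarrow> norm (k s) \<le> a * M * exp (\<mu> * s)" and M: "0 \<le> M" for t M and k :: "real \<Rightarrow> 'a"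
  proof -
    have "norm (integral {0..t} k) \<le> integral {0..t} (\<lambda>s. (a * M) * exp (\<mu> * s))"
      by (rule integral_norm_bound_integral) (use k in \<open>auto intro!: integrable_continuous_real continuous_intros\<close>)
    also have "\<dots> = a * M * integral {0..t} (\<lambda>s. exp (\<mu> * s))" by simp
    also have "\<dots> \<le> a * M * (exp (\<mu> * t) / \<mu>)" using a0 M by (intro mult_left_mono exp_int t) auto
    finally have "exp (- (\<mu> * t)) * norm (integral {0..t} k) \<le> exp (- (\<mu> * t)) * (a * M * (exp (\<mu> * t) / \<mu>))"
      by (intro mult_left_mono) auto
    then show ?thesis by (simp add: exp_minus field_simps)
  qed
  have bc: "\<Psi> z \<in> bcontfun" for z
  proof -
    obtain M where M: "\<And>s. norm (apply_bcontfun z s) \<le> M" "0 \<le> M"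
      using bounded_apply_bcontfun[of z] unfolding bounded_pos by (auto intro: less_imp_le)
    show ?thesis
    proof (rule bcontfun_normI[where b = "(1 + c) + a * M / \<mu>"])
      have c1: "continuous_on {0..} (\<lambda>t. exp (- (\<mu> * t)) *\<^sub>R (g t + integral {0..t} (h z)))"
        by (intro continuous_intros gc continuous_on_halfline indefinite_integral_continuous_1 hi)
      have "continuous_on UNIV (\<lambda>t::real. max 0 t)" by (intro continuous_intros)
      from continuous_on_compose2[OF c1 this] show "continuous_on UNIV (\<Psi> z)"
        unfolding \<Psi>_def by (simp add: image_subset_iff)
      have hb: "norm (h z s) \<le> a * M * exp (\<mu> * s)" for s
      proof -
        have "norm (h z s) \<le> a * (exp (\<mu> * s) * norm (apply_bcontfun z s))"
          unfolding h_def using Ab[of "exp (\<mu> * s) *\<^sub>R apply_bcontfun z s"] by simp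
        also have "\<dots> \<le> a * (exp (\<mu> * s) * M)" using a0 M(1)[of s] by (intro mult_left_mono) auto
        finally show ?thesis by (simp add: ac_simps)
      qed
      fix t
      show "norm (\<Psi> z t) \<le> (1 + c) + a * M / \<mu>"
      proof -
        let ?t = "max 0 t"
        have "norm (\<Psi> z t) \<le> exp (- (\<mu> * ?t)) * (norm (g ?t) + norm (integral {0..?t} (h z)))"
          unfolding \<Psi>_def by (simp add: norm_triangle_ineq)
        also have "\<dots> \<le> (1 + c) + a * M / \<mu>"
          unfolding distrib_left by (intro add_mono gb key hc hb M) auto
        finally show ?thesis .
      qed
    qed
  qed
  define \<Phi> where "\<Phi> z = Bcontfun (\<Psi> z)" for z
  have \<Phi>: "apply_bcontfun (\<Phi> z) = \<Psi> z" for z unfolding \<Phi>_def using bc by (rule Bcontfun_inverse)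
  have "\<exists>!z. \<Phi> z = z"
  proof (rule banach_fix_type[of "1/2"], simp, simp, intro allI)
    fix z z'
    show "dist (\<Phi> z) (\<Phi> z') \<le> 1/2 * dist z z'"
    proof (rule dist_bound)
      fix t :: real
      let ?t = "max 0 t"
      have "dist (\<Psi> z t) (\<Psi> z' t) = exp (- (\<mu> * ?t)) * norm (integral {0..?t} (h z) - integral {0..?t} (h z'))"
        unfolding \<Psi>_def dist_norm by (simp flip: scaleR_diff_right)
      also have "\<dots> = exp (- (\<mu> * ?t)) * norm (integral {0..?t} (\<lambda>s. h z s - h z' s))"
        by (simp add: HK_integral_diff hi)
      also have "\<dots> \<le> a * dist z z' / \<mu>"
      proof (rule key)
        fix s :: real
        have "h z s - h z' s = A (exp (\<mu> * s) *\<^sub>R (apply_bcontfun z s - apply_bcontfun z' s))"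
          unfolding h_def by (simp add: scaleR_diff_right linear_diff[OF bounded_linear.linear[OF A]])
        also have "norm \<dots> \<le> a * (exp (\<mu> * s) * dist z z')"
        proof -
          have "norm (A (exp (\<mu> * s) *\<^sub>R (apply_bcontfun z s - apply_bcontfun z' s))) \<le> a * (exp (\<mu> * s) * norm (apply_bcontfun z s - apply_bcontfun z' s))"
            using Ab[of "exp (\<mu> * s) *\<^sub>R (apply_bcontfun z s - apply_bcontfun z' s)"] by simp
          also have "\<dots> \<le> a * (exp (\<mu> * s) * dist z z')"
            using a0 dist_bounded[of z s z'] by (intro mult_left_mono) (auto simp: dist_norm)
          finally show ?thesis .
        qed
        finally show "norm (h z s - h z' s) \<le> a * dist z z' * exp (\<mu> * s)" by (simp add: ac_simps)
      qed (auto intro!: continuous_intros hc)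
      also have "\<dots> \<le> 1/2 * dist z z'"
      proof -
        have "a / \<mu> \<le> 1/2" using a0 by (simp add: \<mu>_def field_simps)
        from mult_right_mono[OF this, of "dist z z'"] show ?thesis by simp
      qed
      finally show "dist (apply_bcontfun (\<Phi> z) t) (apply_bcontfun (\<Phi> z') t) \<le> 1/2 * dist z z'" unfolding \<Phi> .
    qed
  qed
  then obtain z where z: "\<Phi> z = z" by blast
  define x where "x t = exp (\<mu> * t) *\<^sub>R apply_bcontfun z t" for t
  have xc: "continuous_on S x" for S unfolding x_def by (intro continuous_intros continuous_on_apply_bcontfun)
  have "x t = integral {0..t} (\<lambda>s. A (x s) + f s)" if t: "0 \<le> t" for t
  proof -
    have "apply_bcontfun z t = \<Psi> z t" using \<Phi>[of z] z by simp
    then have "x t = exp (\<mu> * t) *\<^sub>R exp (- (\<mu> * t)) *\<^sub>R (g t + integral {0..t} (h z))"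
      using t by (simp only: x_def \<Psi>_def) (simp add: max_def)
    also have "\<dots> = g t + integral {0..t} (\<lambda>s. A (x s))" by (simp add: mult_exp_exp h_def[abs_def] x_def)
    also have "\<dots> = integral {0..t} (\<lambda>s. A (x s) + f s)"
      unfolding g_def by (subst HK_integral_add)
        (auto intro!: integrable_continuous_real Ac xc abs_int_imp_int[OF L2e_abs_int[OF fe]])
    finally show ?thesis .
  qed
  moreover have "\<exists>s0. \<forall>s>s0. lap_at x s"
  proof -
    obtain M where M: "\<And>s. norm (apply_bcontfun z s) \<le> M"
      using bounded_apply_bcontfun[of z] unfolding bounded_iff by auto
    have "norm (x t) \<le> M * exp (\<mu> * t)" for t unfolding x_def using M[of t] by (simp add: mult.commute)
    then show ?thesis using lap_at_exp_bounded[OF xc[of "{0..}"], of M \<mu>] by blast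
  qed
  ultimately show ?thesis using that xc by blast
qed

lemma linear_ode_laplace:
  fixes A :: "'a::euclidean_space \<Rightarrow> 'a" and f :: "real \<Rightarrow> 'a"
  assumes A: "bounded_linear A" and f: "f \<in> L2"
    and x: "\<And>t. 0 \<le> t \<Longrightarrow> x t = integral {0..t} (\<lambda>s. A (x s) + f s)" and lx: "\<exists>s0. \<forall>s>s0. lap_at x s"
  shows "has_laplace x (rlap x)" "\<forall>\<^sub>F s in at_top. s *\<^sub>R rlap x s = A (rlap x s) + rlap f s"
proof -
  show hx: "has_laplace x (rlap x)" using lx has_laplaceI by blast
  have "has_laplace (\<lambda>t. integral {0..t} (\<lambda>s. A (x s) + f s)) (\<lambda>s. (A (rlap x s) + rlap f s) /\<^sub>R s)"
    by (intro has_laplace_integral has_laplace_add has_laplace_linear[OF hx A] L2_has_laplace f)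
  then have "has_laplace x (\<lambda>s. (A (rlap x s) + rlap f s) /\<^sub>R s)"
    by (rule has_laplace_signal_eq) (auto intro!: signal_eqI simp: x[symmetric])
  from has_laplace_unique_ev[OF hx this] eventually_gt_at_top[of 0]
  show "\<forall>\<^sub>F s in at_top. s *\<^sub>R rlap x s = A (rlap x s) + rlap f s"
  proof eventually_elim
    case (elim s)
    have "s *\<^sub>R rlap x s = s *\<^sub>R ((A (rlap x s) + rlap f s) /\<^sub>R s)" using elim(1) by (rule arg_cong)
    then show ?case using elim(2) by simp
  qed
qed

text \<open>Integrated form of the derivative of \<open>x \<bullet> L x\<close>, by parts from
  \<open>g\<close> and its image under \<open>L\<close>. It is applied with the identity to a
  first-order lag and with \<open>Q\<close> to the state of the realization.\<close>

lemma quadratic_storage: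
  fixes g :: "real \<Rightarrow> 'a::euclidean_space" and L :: "'a \<Rightarrow> 'a"
  assumes T: "0 \<le> T" and g: "g absolutely_integrable_on {0..T}" and L: "bounded_linear L"
    and x: "\<And>t. 0 \<le> t \<Longrightarrow> x t = integral {0..t} g"
  shows "(\<lambda>t. g t \<bullet> L (x t) + x t \<bullet> L (g t)) integrable_on {0..T}"
    "x T \<bullet> L (x T) = integral {0..T} (\<lambda>t. g t \<bullet> L (x t) + x t \<bullet> L (g t))"
proof -
  have Lg: "(\<lambda>t. L (g t)) absolutely_integrable_on {0..T}" using absolutely_integrable_linear[OF g L] by (simp add: o_def)
  have LI: "integral {0..t} (\<lambda>t. L (g t)) = L (x t)" if "t \<in> {0..T}" for t
    using integral_linear[OF abs_int_imp_int[OF abs_int_sub[OF g, of 0 t]] L] that x[of t] by (simp add: o_def)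
  have c: "g t \<bullet> integral {0..t} (\<lambda>t. L (g t)) + integral {0..t} g \<bullet> L (g t) = g t \<bullet> L (x t) + x t \<bullet> L (g t)"
    if "t \<in> {0..T}" for t using LI[OF that] x[of t] that by simp
  show "(\<lambda>t. g t \<bullet> L (x t) + x t \<bullet> L (g t)) integrable_on {0..T}"
    by (rule integrable_eq[OF abs_int_imp_int[OF integral_inner_by_parts(1)[OF T g Lg]]]) (rule c)
  show "x T \<bullet> L (x T) = integral {0..T} (\<lambda>t. g t \<bullet> L (x t) + x t \<bullet> L (g t))"
    using integral_inner_by_parts(2)[OF T g Lg] HK_integral_cong[OF c, of "{0..T}"] LI[of T] x[of T] T by simp
qed

text \<open>The transfer function, on the real axis, of a map on \<open>L2\<close> with finite gain.
  Signals are complex because the factors \<open>1 / (s - l)\<close> of a rational function may have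
  complex poles. Asking only for an output to each input makes closure under sums and products
  immediate.\<close>

definition realizable :: "(real \<Rightarrow> complex) \<Rightarrow> bool" where
  "realizable H \<longleftrightarrow> (\<exists>C\<ge>0. \<forall>y\<in>L2. \<exists>z\<in>L2. (L2_norm z)\<^sup>2 \<le> C * (L2_norm y)\<^sup>2 \<and> has_laplace z (\<lambda>s. H s * rlap y s))"

lemma realizableI:
  assumes "0 \<le> C" "\<And>y. y \<in> L2 \<Longrightarrow> \<exists>z\<in>L2. (L2_norm z)\<^sup>2 \<le> C * (L2_norm y)\<^sup>2 \<and> has_laplace z (\<lambda>s. H s * rlap y s)"
  shows "realizable H"
  using assms unfolding realizable_def by blast

lemma realizable_cong:
  assumes "realizable H" "\<forall>\<^sub>F s in at_top. H s = H' s" shows "realizable H'"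
proof -
  have "has_laplace z (\<lambda>s. H' s * rlap y s)" if "has_laplace z (\<lambda>s. H s * rlap y s)" for y z
    by (rule has_laplace_cong[OF that]) (use assms(2) in \<open>auto elim!: eventually_mono\<close>)
  then show ?thesis using assms(1) unfolding realizable_def by metis
qed

lemma realizable_const: "realizable (\<lambda>s. c)"
proof (rule realizableI[of "(norm c)\<^sup>2"])
  fix y :: "real \<Rightarrow> complex" assume y: "y \<in> L2"
  have bl: "bounded_linear (\<lambda>z. c * z)" by (rule bounded_linear_mult_right)
  show "\<exists>z\<in>L2. (L2_norm z)\<^sup>2 \<le> (norm c)\<^sup>2 * (L2_norm y)\<^sup>2 \<and> has_laplace z (\<lambda>s. c * rlap y s)"
    using L2_linear[OF y bl, of "norm c"] has_laplace_linear[OF L2_has_laplace[OF y] bl]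
    by (auto simp: norm_mult)
qed simp

lemma realizable_add:
  assumes "realizable H" "realizable H'" shows "realizable (\<lambda>s. H s + H' s)"
proof -
  obtain C C' where C: "0 \<le> C" "\<And>y. y \<in> L2 \<Longrightarrow> \<exists>z\<in>L2. (L2_norm z)\<^sup>2 \<le> C * (L2_norm y)\<^sup>2 \<and> has_laplace z (\<lambda>s. H s * rlap y s)"
    and C': "0 \<le> C'" "\<And>y. y \<in> L2 \<Longrightarrow> \<exists>z\<in>L2. (L2_norm z)\<^sup>2 \<le> C' * (L2_norm y)\<^sup>2 \<and> has_laplace z (\<lambda>s. H' s * rlap y s)"
    using assms unfolding realizable_def by blast
  show ?thesis
  proof (rule realizableI[of "2 * C + 2 * C'"])
    fix y :: "real \<Rightarrow> complex" assume y: "y \<in> L2"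
    obtain z z' where z: "z \<in> L2" "(L2_norm z)\<^sup>2 \<le> C * (L2_norm y)\<^sup>2" "has_laplace z (\<lambda>s. H s * rlap y s)"
      and z': "z' \<in> L2" "(L2_norm z')\<^sup>2 \<le> C' * (L2_norm y)\<^sup>2" "has_laplace z' (\<lambda>s. H' s * rlap y s)"
      using C(2)[OF y] C'(2)[OF y] by blast
    show "\<exists>z\<in>L2. (L2_norm z)\<^sup>2 \<le> (2 * C + 2 * C') * (L2_norm y)\<^sup>2 \<and> has_laplace z (\<lambda>s. (H s + H' s) * rlap y s)"
    proof (intro bexI conjI)
      show "(L2_norm (\<lambda>t. z t + z' t))\<^sup>2 \<le> (2 * C + 2 * C') * (L2_norm y)\<^sup>2"
        using L2_add(2)[OF z(1) z'(1)] z(2) z'(2) by (simp add: algebra_simps)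
      show "has_laplace (\<lambda>t. z t + z' t) (\<lambda>s. (H s + H' s) * rlap y s)"
        using has_laplace_add[OF z(3) z'(3)] by (simp add: distrib_right)
    qed (rule L2_add(1)[OF z(1) z'(1)])
  qed (use C C' in auto)
qed

lemma realizable_mult:
  assumes "realizable H" "realizable H'" shows "realizable (\<lambda>s. H s * H' s)"
proof -
  obtain C C' where C: "0 \<le> C" "\<And>y. y \<in> L2 \<Longrightarrow> \<exists>z\<in>L2. (L2_norm z)\<^sup>2 \<le> C * (L2_norm y)\<^sup>2 \<and> has_laplace z (\<lambda>s. H s * rlap y s)"
    and C': "0 \<le> C'" "\<And>y. y \<in> L2 \<Longrightarrow> \<exists>z\<in>L2. (L2_norm z)\<^sup>2 \<le> C' * (L2_norm y)\<^sup>2 \<and> has_laplace z (\<lambda>s. H' s * rlap y s)"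
    using assms unfolding realizable_def by blast
  show ?thesis
  proof (rule realizableI[of "C * C'"])
    fix y :: "real \<Rightarrow> complex" assume y: "y \<in> L2"
    obtain z' where z': "z' \<in> L2" "(L2_norm z')\<^sup>2 \<le> C' * (L2_norm y)\<^sup>2" "has_laplace z' (\<lambda>s. H' s * rlap y s)"
      using C'(2)[OF y] by blast
    obtain z where z: "z \<in> L2" "(L2_norm z)\<^sup>2 \<le> C * (L2_norm z')\<^sup>2" "has_laplace z (\<lambda>s. H s * rlap z' s)"
      using C(2)[OF z'(1)] by blast
    have "(L2_norm z)\<^sup>2 \<le> C * C' * (L2_norm y)\<^sup>2"
      using order_trans[OF z(2) mult_left_mono[OF z'(2) C(1)]] by (simp add: mult.assoc)
    moreover have "has_laplace z (\<lambda>s. H s * H' s * rlap y s)"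
      by (rule has_laplace_cong[OF z(3)])
        (use has_laplace_unique_ev[OF L2_has_laplace[OF z'(1)] z'(3)] in \<open>auto elim!: eventually_mono\<close>)
    ultimately show "\<exists>z\<in>L2. (L2_norm z)\<^sup>2 \<le> C * C' * (L2_norm y)\<^sup>2 \<and> has_laplace z (\<lambda>s. H s * H' s * rlap y s)"
      using z(1) by blast
  qed (use C C' in auto)
qed

text \<open>With \<open>a = - Re l\<close>, the storage function \<open>(norm (z t))\<^sup>2\<close>
  has derivative at most \<open>(norm (y t))\<^sup>2 / a - a * (norm (z t))\<^sup>2\<close>.
  Integration from the zero state gives the gain \<open>1 / a\<close>.\<close>

lemma first_order_lag:
  fixes y :: "real \<Rightarrow> complex"
  assumes l: "Re l < 0" and y: "y \<in> L2"
  obtains z where "z \<in> L2" "(L2_norm z)\<^sup>2 \<le> (1 / (Re l)\<^sup>2) * (L2_norm y)\<^sup>2" "continuous_on {0..} z"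
    "\<And>t. 0 \<le> t \<Longrightarrow> z t = integral {0..t} (\<lambda>s. l * z s + y s)"
    "has_laplace z (\<lambda>s. 1 / (of_real s - l) * rlap y s)"
proof -
  have bl: "bounded_linear (\<lambda>z. l * z)" by (rule bounded_linear_mult_right)
  obtain z where z: "continuous_on {0..} z" "\<And>t. 0 \<le> t \<Longrightarrow> z t = integral {0..t} (\<lambda>s. l * z s + y s)" "\<exists>s0. \<forall>s>s0. lap_at z s"
    using linear_ode_exists[OF bl y] by blast
  define a where "a = - Re l"
  have a: "a > 0" using l by (simp add: a_def)
  have ye: "y \<in> L2e" and ze: "z \<in> L2e" using y L2_subset_L2e L2e_continuous[OF z(1)] by auto
  have en: "energy z T \<le> (1 / (Re l)\<^sup>2) * (L2_norm y)\<^sup>2" if T: "0 < T" for T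
  proof -
    define g where "g s = l * z s + y s" for s
    have ge: "g \<in> L2e" unfolding g_def using L2e_linear[OF ze bl] ye by (rule L2e_add)
    have st: "(\<lambda>t. g t \<bullet> z t + z t \<bullet> g t) integrable_on {0..T}" "z T \<bullet> z T = integral {0..T} (\<lambda>t. g t \<bullet> z t + z t \<bullet> g t)"
      using quadratic_storage[OF _ L2e_abs_int[OF ge order_refl] bounded_linear_ident, of T z] T z(2)[folded g_def] by auto
    have i: "(\<lambda>t. (norm (z t))\<^sup>2) integrable_on {0..T}" "(\<lambda>t. (norm (y t))\<^sup>2) integrable_on {0..T}"
      using ze ye by (auto intro!: abs_int_imp_int L2e_abs_int_sq)
    have "0 \<le> z T \<bullet> z T" by simp
    also have "\<dots> \<le> integral {0..T} (\<lambda>t. (1 / a) * (norm (y t))\<^sup>2 - a * (norm (z t))\<^sup>2)"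
      unfolding st(2)
    proof (rule integral_le[OF st(1)])
      show "(\<lambda>t. (1 / a) * (norm (y t))\<^sup>2 - a * (norm (z t))\<^sup>2) integrable_on {0..T}"
        using i by (intro integrable_diff integrable_on_mult_right)
      fix t
      have "(l * z t) \<bullet> z t = - a * (norm (z t))\<^sup>2"
        unfolding cmod_power2 by (simp add: a_def inner_complex_def algebra_simps power2_eq_square)
      moreover have "2 * (y t \<bullet> z t) \<le> (1 / a) * (norm (y t))\<^sup>2 + a * (norm (z t))\<^sup>2"
      proof -
        have "0 \<le> a * (norm ((1 / a) *\<^sub>R y t - z t))\<^sup>2" using a by simp
        also have "\<dots> = (1 / a) * (norm (y t))\<^sup>2 - 2 * (y t \<bullet> z t) + a * (norm (z t))\<^sup>2"
          using a unfolding power2_norm_eq_inner by (simp add: inner_diff_left inner_diff_right inner_commute field_simps)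
        finally show ?thesis by simp
      qed
      ultimately show "g t \<bullet> z t + z t \<bullet> g t \<le> (1 / a) * (norm (y t))\<^sup>2 - a * (norm (z t))\<^sup>2"
        by (simp add: g_def inner_add_left inner_commute[of "z t"])
    qed
    also have "\<dots> = (1 / a) * energy y T - a * energy z T"
      unfolding energy_def using integrable_on_mult_right[OF i(1), of a] integrable_on_mult_right[OF i(2), of "1 / a"]
      by (simp only: HK_integral_diff integral_mult_right)
    finally have "energy z T \<le> (1 / (Re l)\<^sup>2) * energy y T"
    proof -
      assume "0 \<le> 1 / a * energy y T - a * energy z T"
      then have "a * (a * energy z T) \<le> a * (1 / a * energy y T)" using a by (intro mult_left_mono) auto
      then have "a\<^sup>2 * energy z T \<le> energy y T" using a by (simp add: power2_eq_square mult.assoc)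
      then show ?thesis using a by (simp add: a_def field_simps)
    qed
    also have "\<dots> \<le> (1 / (Re l)\<^sup>2) * (L2_norm y)\<^sup>2" by (intro mult_left_mono energy_le_L2_norm y) auto
    finally show ?thesis .
  qed
  have lap: "has_laplace z (rlap z)" "\<forall>\<^sub>F s in at_top. s *\<^sub>R rlap z s = l * rlap z s + rlap y s"
    using linear_ode_laplace[OF bl y z(2) z(3)] by auto
  have "has_laplace z (\<lambda>s. 1 / (of_real s - l) * rlap y s)"
  proof (rule has_laplace_cong[OF lap(1)])
    show "\<forall>\<^sub>F s in at_top. rlap z s = 1 / (of_real s - l) * rlap y s"
      using lap(2) eventually_gt_at_top[of 0]
    proof eventually_elim
      case (elim s)
      have "of_real s - l \<noteq> 0" using elim(2) l by (auto simp: complex_eq_iff)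
      then show ?case using elim(1) by (simp add: scaleR_conv_of_real field_simps)
    qed
  qed
  then show ?thesis using that L2_if_energy_bounded[OF ze en] z by blast
qed

lemma realizable_lag: "Re l < 0 \<Longrightarrow> realizable (\<lambda>s. 1 / (of_real s - l))"
  by (rule realizableI[of "1 / (Re l)\<^sup>2"]) (simp, metis first_order_lag)

text \<open>Induction on the degree by \<open>p / q = c + 1 / (s - l) * (p' / q')\<close> for a root \<open>l\<close> of \<open>q\<close>.\<close>
lemma realizable_proper_rational:
  fixes p q :: "complex poly"
  assumes "degree p \<le> degree q" "q \<noteq> 0" "\<And>s. 0 \<le> Re s \<Longrightarrow> poly q s \<noteq> 0"
  shows "realizable (\<lambda>s. poly p (of_real s) / poly q (of_real s))"
  using assms
proof (induction "degree q" arbitrary: p q)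
  case 0
  then obtain a b where "p = [:a:]" "q = [:b:]" by (metis degree_eq_zeroE le_zero_eq)
  then show ?case using realizable_const[of "a / b"] by simp
next
  case (Suc n)
  have "\<not> constant (poly q)" using Suc(2) by (simp add: constant_degree)
  then obtain l where l: "poly q l = 0" using fundamental_theorem_of_algebra by blast
  then obtain q' where q': "q = [:- l, 1:] * q'" by (auto simp: poly_eq_0_iff_dvd elim: dvdE)
  have q'0: "q' \<noteq> 0" using q' Suc(4) by auto
  have Rel: "Re l < 0" using Suc(5)[of l] l by force
  have "degree q = degree [:- l, 1:] + degree q'" unfolding q' by (rule degree_mult_eq) (use q'0 in auto)
  then have dq': "degree q' = n" using Suc(2) by simp
  \<comment> \<open>Subtracting \<open>c\<close> times \<open>q\<close> cancels the coefficient of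
    degree \<open>Suc n\<close>, so the remainder has degree at most \<open>n\<close> and the
    induction hypothesis applies to it with the denominator \<open>q'\<close>.\<close>
  define c where "c = coeff p (Suc n) / coeff q (Suc n)"
  define p' where "p' = p - smult c q"
  have cq: "coeff q (Suc n) \<noteq> 0" using Suc(2,4) by (metis leading_coeff_0_iff)
  have "degree p' \<le> n"
  proof (rule degree_le, intro allI impI)
    fix i assume i: "n < i"
    show "coeff p' i = 0"
    proof (cases "i = Suc n")
      case True
      then show ?thesis using cq by (simp add: p'_def c_def)
    next
      case False
      then have "degree q < i" "degree p < i" using i Suc(2,3) by auto
      then show ?thesis by (simp add: p'_def coeff_eq_0)
    qed
  qed
  then have r: "realizable (\<lambda>s. poly p' (of_real s) / poly q' (of_real s))"
    using Suc(1)[of q' p'] dq' q'0 Suc(5) q' by auto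
  have "realizable (\<lambda>s. c + 1 / (of_real s - l) * (poly p' (of_real s) / poly q' (of_real s)))"
    by (intro realizable_add realizable_mult realizable_const realizable_lag Rel r)
  then show ?case
  proof (rule realizable_cong)
    show "\<forall>\<^sub>F s in at_top. c + 1 / (of_real s - l) * (poly p' (of_real s) / poly q' (of_real s)) = poly p (of_real s) / poly q (of_real s)"
      using eventually_gt_at_top[of 0]
    proof eventually_elim
      case (elim s)
      have "poly q (of_real s) \<noteq> 0" using Suc(5)[of "of_real s"] elim by simp
      moreover have "poly q (of_real s) = (of_real s - l) * poly q' (of_real s)" by (simp add: q' algebra_simps)
      moreover have "poly p (of_real s) = poly p' (of_real s) + c * poly q (of_real s)" by (simp add: p'_def)
      ultimately show ?case by (simp add: add_divide_distrib)
    qed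
  qed
qed

text \<open>Since \<open>H\<close> is strictly proper, \<open>s * H s\<close> is proper with the
  same denominator and yields a bounded map \<open>K\<close>; integration divides its transform by
  \<open>s\<close> again. Right continuity of \<open>F y\<close> makes the identity hold at every
  instant, so differences of samples are integrals of a signal in \<open>L2\<close>.\<close>

lemma low_pass_output_integral:
  assumes F: "stable_low_pass F H"
  obtains K C where "0 \<le> C" "\<And>y. y \<in> L2 \<Longrightarrow> K y \<in> L2" "\<And>y. y \<in> L2 \<Longrightarrow> (L2_norm (K y))\<^sup>2 \<le> C * (L2_norm y)\<^sup>2"
    "\<And>y t. y \<in> L2 \<Longrightarrow> 0 \<le> t \<Longrightarrow> F y t = integral {0..t} (K y)"
proof -
  obtain p q :: "real poly" where deg: "degree p < degree q"
    and q: "\<And>s::complex. Re s \<ge> 0 \<Longrightarrow> poly (map_poly of_real q) s \<noteq> 0"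
    and H: "\<And>s. H s = poly (map_poly of_real p) s / poly (map_poly of_real q) s"
    using F unfolding stable_low_pass_def by blast
  have tf: "has_transfer_function F H" and rc: "\<And>y t. y \<in> L2e \<Longrightarrow> 0 \<le> t \<Longrightarrow> continuous (at_right t) (F y)"
    using F unfolding stable_low_pass_def lti_system_def by auto
  define p1 :: "complex poly" where "p1 = pCons 0 (map_poly of_real p)"
  define q1 :: "complex poly" where "q1 = map_poly of_real q"
  have "degree p1 \<le> degree q1"
  proof -
    have "degree p1 \<le> Suc (degree p)" unfolding p1_def by (rule order_trans[OF degree_pCons_le]) (simp add: degree_map_poly)
    then show ?thesis using deg by (simp add: q1_def degree_map_poly)
  qed
  moreover have "q1 \<noteq> 0" using q[of 0] by (auto simp: q1_def)
  ultimately have "realizable (\<lambda>s. poly p1 (of_real s) / poly q1 (of_real s))"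
    by (rule realizable_proper_rational) (simp add: q1_def q)
  then obtain C where C: "0 \<le> C" "\<And>y. y \<in> L2 \<Longrightarrow> \<exists>z\<in>L2. (L2_norm z)\<^sup>2 \<le> C * (L2_norm y)\<^sup>2 \<and> has_laplace z (\<lambda>s. poly p1 (of_real s) / poly q1 (of_real s) * rlap y s)"
    unfolding realizable_def by blast
  have "\<exists>k\<in>L2. (L2_norm k)\<^sup>2 \<le> C * (L2_norm y)\<^sup>2 \<and> (\<forall>t\<ge>0. F y t = integral {0..t} k)" if y: "y \<in> L2" for y
  proof -
    have yc: "(\<lambda>t. complex_of_real (y t)) \<in> L2" "(L2_norm (\<lambda>t. complex_of_real (y t)))\<^sup>2 \<le> 1\<^sup>2 * (L2_norm y)\<^sup>2"
      using L2_linear[OF y bounded_linear_of_real[where 'a=complex], of 1] by simp_all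
    obtain z where z: "z \<in> L2" "(L2_norm z)\<^sup>2 \<le> C * (L2_norm (\<lambda>t. complex_of_real (y t)))\<^sup>2"
        "has_laplace z (\<lambda>s. poly p1 (of_real s) / poly q1 (of_real s) * rlap (\<lambda>t. complex_of_real (y t)) s)"
      using C(2)[OF yc(1)] by blast
    define k where "k t = Re (z t)" for t
    have k: "k \<in> L2" "(L2_norm k)\<^sup>2 \<le> 1\<^sup>2 * (L2_norm z)\<^sup>2"
      using L2_linear[OF z(1) bounded_linear_Re, of 1] by (auto simp: k_def[abs_def] abs_Re_le_cmod)
    have "(L2_norm k)\<^sup>2 \<le> C * (L2_norm y)\<^sup>2"
      using k(2) z(2) mult_left_mono[OF yc(2) C(1)] unfolding power_one mult_1 by linarith
    have "has_laplace k (\<lambda>s. s * Re (H (of_real s)) * rlap y s)"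
    proof (rule has_laplace_cong[OF has_laplace_linear[OF z(3) bounded_linear_Re, folded k_def]])
      have "\<forall>\<^sub>F s in at_top. rlap (\<lambda>t. complex_of_real (y t)) s = of_real (rlap y s)"
        by (rule has_laplace_unique_ev[OF L2_has_laplace[OF yc(1)] has_laplace_linear[OF L2_has_laplace[OF y] bounded_linear_of_real]])
      then show "\<forall>\<^sub>F s in at_top. Re (poly p1 (of_real s) / poly q1 (of_real s) * rlap (\<lambda>t. complex_of_real (y t)) s)
        = s * Re (H (of_real s)) * rlap y s"
        by eventually_elim (simp add: H p1_def q1_def flip: times_divide_eq_right)
    qed
    from has_laplace_integral[OF this]
    have "has_laplace (\<lambda>t. integral {0..t} k) (\<lambda>s. Re (H (of_real s)) * rlap y s)"
      by (rule has_laplace_cong) (auto intro!: eventually_mono[OF eventually_gt_at_top[of 0]])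
    then have eq: "F y \<simeq> (\<lambda>t. integral {0..t} k)"
      by (rule laplace_unique[OF transfer_function_has_laplace[OF tf y]])
    have e: "y \<in> L2e" "k \<in> L2e" using y k L2_subset_L2e by auto
    have "F y t = integral {0..t} k" if t: "t \<ge> 0" for t
      using t rc[OF e(1)] continuous_on_halfline_at_right[OF continuous_on_L2e_integral[OF e(2)]]
      by (intro right_continuous_eq[OF signal_eq_truncation[OF eq, of "t + 1"]]) auto
    then show ?thesis using k(1) \<open>(L2_norm k)\<^sup>2 \<le> C * (L2_norm y)\<^sup>2\<close> by blast
  qed
  then obtain K where "\<And>y. y \<in> L2 \<Longrightarrow> K y \<in> L2 \<and> (L2_norm (K y))\<^sup>2 \<le> C * (L2_norm y)\<^sup>2 \<and> (\<forall>t\<ge>0. F y t = integral {0..t} (K y))"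
    by metis
  then show ?thesis using that[of C K] C(1) by blast
qed

section \<open>Sampling and hold\<close>

definition event_index :: "(nat \<Rightarrow> real) \<Rightarrow> real \<Rightarrow> nat" where
  "event_index T t = (THE k. T k \<le> t \<and> t < T (Suc k))"

lemma admissible_strict_mono: "admissible T \<Longrightarrow> strict_mono T"
  unfolding admissible_def by (intro strict_mono_Suc_iff[THEN iffD2]) auto

lemma admissible_ex_index:
  assumes T: "admissible T" and t: "0 \<le> t"
  shows "\<exists>!k. T k \<le> t \<and> t < T (Suc k)"
proof -
  have sm: "strict_mono T" by (rule admissible_strict_mono[OF T])
  have "\<forall>\<^sub>F k in sequentially. t < T k"
    using T unfolding admissible_def filterlim_at_top_dense by blast
  then have ex: "\<exists>k. t < T k" by (rule eventually_happens'[OF sequentially_bot])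
  define n where "n = (LEAST k. t < T k)"
  have n: "t < T n" unfolding n_def by (rule LeastI_ex[OF ex])
  have n0: "n \<noteq> 0" using n t T by (auto simp: admissible_def intro: ccontr)
  then have "\<not> t < T (n - 1)" unfolding n_def by (metis not_less_Least diff_less less_one n_def neq0_conv)
  then have "T (n - 1) \<le> t \<and> t < T (Suc (n - 1))" using n n0 by simp
  moreover have "j = k" if "T j \<le> t \<and> t < T (Suc j)" "T k \<le> t \<and> t < T (Suc k)" for j k
  proof -
    have "j < Suc k" "k < Suc j" using that by (auto simp flip: strict_mono_less[OF sm])
    then show ?thesis by simp
  qed
  ultimately show ?thesis by blast
qed

lemma event_index:
  assumes "admissible T" "0 \<le> t"
  shows "T (event_index T t) \<le> t" "t < T (Suc (event_index T t))"
  using theI'[OF admissible_ex_index[OF assms]] by (auto simp: event_index_def)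

lemma event_index_eq:
  assumes "admissible T" "T k \<le> t" "t < T (Suc k)" shows "event_index T t = k"
proof -
  have "T 0 \<le> T k" using admissible_strict_mono[OF assms(1)] by (simp add: strict_mono_less_eq)
  then have "0 \<le> t" using assms by (simp add: admissible_def)
  then show ?thesis using admissible_ex_index[OF assms(1)] event_index[OF assms(1)] assms by blast
qed

lemma hold_eq: "admissible T \<Longrightarrow> T k \<le> t \<Longrightarrow> t < T (Suc k) \<Longrightarrow> hold T c t = c k"
  using event_index_eq[of T k t] by (simp add: hold_def event_index_def)

lemma admissible_nonneg: "admissible T \<Longrightarrow> 0 \<le> T k"
  using admissible_strict_mono[of T] strict_mono_less_eq[of T 0 k] by (simp add: admissible_def)

lemma admissible_unbounded: assumes "admissible T" obtains n where "\<tau> < T n"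
proof -
  have "\<forall>\<^sub>F k in sequentially. \<tau> < T k"
    using assms unfolding admissible_def filterlim_at_top_dense by blast
  then show ?thesis using that eventually_happens'[OF sequentially_bot] by blast
qed

lemma hold_L2e:
  assumes T: "admissible T" shows "hold T c \<in> L2e"
proof -
  define f where "f n t = (\<Sum>k<n. c k * indicator {T k..<T (Suc k)} t)" for n t
  have fh: "f n t = hold T c t" if t: "0 \<le> t" "t < T n" for n t
  proof -
    obtain j where j: "T j \<le> t" "t < T (Suc j)" using event_index[OF T t(1)] by blast
    have "T j < T n" using j t by simp
    then have jn: "j < n" using admissible_strict_mono[OF T] by (simp add: strict_mono_less)
    have "(t \<in> {T k..<T (Suc k)}) = (k = j)" for k
      using event_index_eq[OF T j] event_index_eq[OF T, of k t] j by auto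
    then have "f n t = (\<Sum>k<n. if k = j then c k else 0)"
      unfolding f_def by (intro sum.cong) (simp_all add: indicator_def)
    then show ?thesis using jn hold_eq[OF T j] by simp
  qed
  have fm: "f n \<in> borel_measurable (lebesgue_on {0..})" for n
  proof (rule measurable_restrict_space1)
    have "f n \<in> borel_measurable borel" unfolding f_def by measurable
    then show "f n \<in> borel_measurable lebesgue" by (simp add: measurable_completion)
  qed
  have hm: "hold T c \<in> borel_measurable (lebesgue_on {0..})"
  proof (rule borel_measurable_LIMSEQ_metric[OF fm])
    fix t :: real assume "t \<in> space (lebesgue_on {0..})"
    then have t: "0 \<le> t" by (simp add: space_restrict_space)
    have "\<forall>\<^sub>F k in sequentially. t < T k"
      using T unfolding admissible_def filterlim_at_top_dense by blast
    then have "\<forall>\<^sub>F k in sequentially. f k t = hold T c t" by eventually_elim (rule fh[OF t])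
    then show "(\<lambda>i. f i t) \<longlonglongrightarrow> hold T c t" by (rule tendsto_eventually)
  qed
  have "(\<lambda>t. (norm (hold T c t))\<^sup>2) absolutely_integrable_on {0..\<tau>}" for \<tau>
  proof -
    obtain n where n: "\<tau> < T n" using admissible_unbounded[OF T] .
    show ?thesis
    proof (rule measurable_bounded_by_integrable_imp_absolutely_integrable)
      have "hold T c \<in> borel_measurable (lebesgue_on {0..\<tau>})" using hm by (rule measurable_lebesgue_on_subset) auto
      then show "(\<lambda>t. (norm (hold T c t))\<^sup>2) \<in> borel_measurable (lebesgue_on {0..\<tau>})" by measurable
      show "(\<lambda>t. (\<Sum>k<n. \<bar>c k\<bar>)\<^sup>2) integrable_on {0..\<tau>}" by (rule integrable_const_ivl)
      fix t assume t: "t \<in> {0..\<tau>}"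
      have "\<bar>hold T c t\<bar> = \<bar>f n t\<bar>" using fh[of t n] t n by simp
      also have "\<dots> \<le> (\<Sum>k<n. \<bar>c k * indicator {T k..<T (Suc k)} t\<bar>)" unfolding f_def by (rule sum_abs)
      also have "\<dots> \<le> (\<Sum>k<n. \<bar>c k\<bar>)" by (rule sum_mono) (auto simp: indicator_def)
      finally show "norm ((norm (hold T c t))\<^sup>2) \<le> (\<Sum>k<n. \<bar>c k\<bar>)\<^sup>2"
        using power_mono[of "\<bar>hold T c t\<bar>" "\<Sum>k<n. \<bar>c k\<bar>" 2] by simp
    qed auto
  qed
  with hm show ?thesis by (simp add: L2e_iff)
qed

lemma next_event:
  assumes T: "admissible T"
  obtains j where "next_event T x = T j" "x \<le> T j"
proof -
  obtain n where "x < T n" using admissible_unbounded[OF T] .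
  then have ex: "\<exists>k. x \<le> T k" by (auto intro: less_imp_le)
  define j where "j = (LEAST k. x \<le> T k)"
  have j: "x \<le> T j" unfolding j_def by (rule LeastI_ex[OF ex])
  have "next_event T x = T j" unfolding next_event_def
  proof (rule Least_equality)
    fix y assume "y \<in> range T \<inter> {x..}"
    then obtain i where i: "y = T i" "x \<le> T i" by auto
    then have "j \<le> i" unfolding j_def by (intro Least_le)
    then show "T j \<le> y" using i admissible_strict_mono[OF T] by (simp add: strict_mono_less_eq)
  qed (use j in auto)
  then show ?thesis using that j by blast
qed

text \<open>The instant at which the value held on \<open>[Ts k, Ts (Suc k))\<close> was sampled.
  Through it the cascade of two samplers and holds becomes one hold with shifted samples.\<close>

definition sample_time :: "(nat \<Rightarrow> real) \<Rightarrow> (nat \<Rightarrow> real) \<Rightarrow> nat \<Rightarrow> real" where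
  "sample_time T' Ts k = T' (event_index T' (Ts k))"

lemma sampled_feedback_hold:
  assumes T': "admissible T'" and Ts: "admissible Ts"
  shows "sampled_feedback T' Ts F y = hold Ts (\<lambda>k. F y (sample_time T' Ts k))"
  by (simp add: sampled_feedback_def sample_def hold_def sample_time_def event_index_def)

text \<open>If the sample in use changes at \<open>Ts (Suc k)\<close>, the new one was taken after
  \<open>Ts k\<close>, so \<open>Ts (Suc k)\<close> is the first event of \<open>Ts\<close> after it
  and the bound \<open>e\<close> applies. For the last claim, the next event of \<open>T'\<close>
  after a sample comes within \<open>h\<close> and is followed within \<open>d\<close> by an event
  of \<open>Ts\<close>.\<close>

lemma sample_time_props:
  assumes T': "admissible T'" and Ts: "admissible Ts"
    and eb: "event_bounds T' Ts h L d e" and L: "L = h + d" 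
  shows "0 \<le> sample_time T' Ts k" "sample_time T' Ts k \<le> Ts k"
    "sample_time T' Ts (Suc k) = sample_time T' Ts k \<or>
      Ts k < sample_time T' Ts (Suc k) \<and> Ts (Suc k) - sample_time T' Ts (Suc k) \<le> e"
    "Ts (Suc k) \<le> sample_time T' Ts k + L"
proof -
  let ?s = "sample_time T' Ts"
  have sT': "strict_mono T'" and sTs: "strict_mono Ts" using T' Ts by (auto intro: admissible_strict_mono)
  have n: "0 \<le> Ts k" for k by (rule admissible_nonneg[OF Ts])
  define m where "m k = event_index T' (Ts k)" for k
  have m: "T' (m k) \<le> Ts k" "Ts k < T' (Suc (m k))" "?s k = T' (m k)" for k
    using event_index[OF T' n[of k]] by (auto simp: m_def sample_time_def)
  show "0 \<le> ?s k" using m admissible_nonneg[OF T'] by simp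
  show "?s k \<le> Ts k" using m by simp
  have bnd: "T' (Suc k) - T' k \<le> h" "next_event Ts (T' k) - T' k \<le> d"
    "next_event Ts (T' k) - last_event T' (next_event Ts (T' k)) \<le> e" for k
    using eb unfolding event_bounds_def by auto
  have TsS: "Ts k < Ts (Suc k)" using sTs by (simp add: strict_mono_less)
  show "?s (Suc k) = ?s k \<or> Ts k < ?s (Suc k) \<and> Ts (Suc k) - ?s (Suc k) \<le> e"
  proof (cases "?s (Suc k) = ?s k")
    case False
    have "T' (m k) < T' (Suc (m (Suc k)))" using m(1)[of k] m(2)[of "Suc k"] TsS by simp
    then have "m k < Suc (m (Suc k))" using sT' by (simp add: strict_mono_less)
    then have "Suc (m k) \<le> m (Suc k)" using False m(3) by (metis le_less less_Suc_eq_le Suc_leI)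
    then have "T' (Suc (m k)) \<le> T' (m (Suc k))" using sT' by (simp add: strict_mono_less_eq)
    then have gt: "Ts k < ?s (Suc k)" using m(2)[of k] m(3) by simp
    have ne: "next_event Ts (?s (Suc k)) = Ts (Suc k)" unfolding next_event_def
    proof (rule Least_equality)
      show "Ts (Suc k) \<in> range Ts \<inter> {?s (Suc k)..}" using m[of "Suc k"] by auto
      fix y assume "y \<in> range Ts \<inter> {?s (Suc k)..}"
      then obtain i where i: "y = Ts i" "?s (Suc k) \<le> Ts i" by auto
      then have "Ts k < Ts i" using gt by simp
      then show "Ts (Suc k) \<le> y" using i(1) sTs by (simp add: strict_mono_less strict_mono_less_eq)
    qed
    have "last_event T' (Ts (Suc k)) = ?s (Suc k)" unfolding last_event_def
    proof (rule Greatest_equality)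
      show "?s (Suc k) \<in> range T' \<inter> {0..Ts (Suc k)}" using m[of "Suc k"] admissible_nonneg[OF T'] by auto
      fix y assume "y \<in> range T' \<inter> {0..Ts (Suc k)}"
      then obtain i where i: "y = T' i" "T' i \<le> Ts (Suc k)" by auto
      then have "T' i < T' (Suc (m (Suc k)))" using m(2)[of "Suc k"] by simp
      then have "i \<le> m (Suc k)" using sT' by (simp add: strict_mono_less)
      then show "y \<le> ?s (Suc k)" using i(1) sT' m(3) by (simp add: strict_mono_less_eq)
    qed
    then have "Ts (Suc k) - ?s (Suc k) \<le> e" using bnd(3)[of "m (Suc k)"] ne m(3)[of "Suc k"] by simp
    then show ?thesis using gt by simp
  qed simp
  obtain j where j: "next_event Ts (T' (Suc (m k))) = Ts j" "T' (Suc (m k)) \<le> Ts j" using next_event[OF Ts] .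
  have "Ts k < Ts j" using j(2) m(2)[of k] by simp
  then have "Ts (Suc k) \<le> Ts j" using sTs by (simp add: strict_mono_less strict_mono_less_eq)
  also have "\<dots> \<le> T' (Suc (m k)) + d" using bnd(2)[of "Suc (m k)"] j(1) by simp
  also have "\<dots> \<le> ?s k + L" using bnd(1)[of "m k"] m(3)[of k] L by simp
  finally show "Ts (Suc k) \<le> ?s k + L" .
qed

text \<open>The optimal \<theta> is \<open>sqrt b / sqrt a\<close>. For \<open>b = 0\<close> it is
  not positive, and the bound is reached by letting \<theta> tend to 0.\<close>

lemma sum_sq_bound_sqrt:
  fixes S a b e :: real
  assumes S: "\<And>\<theta>. \<theta> > 0 \<Longrightarrow> S \<le> (1 + \<theta>) * (a * e) + (1 + 1 / \<theta>) * (b * e)" and a: "0 < a" and b: "0 \<le> b" and e: "0 \<le> e"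
  shows "S \<le> (sqrt a + sqrt b)\<^sup>2 * e"
proof (cases "b = 0")
  case True
  have "S \<le> a * e"
  proof (rule field_le_epsilon)
    fix d :: real assume d: "0 < d"
    define \<theta> where "\<theta> = d / (a * e + 1)"
    have ae: "0 \<le> a * e" using a e by simp
    have "\<theta> > 0" using d ae by (simp add: \<theta>_def)
    then have "S \<le> a * e + \<theta> * (a * e)" using S[of \<theta>] True by (simp add: algebra_simps)
    also have "\<theta> * (a * e) \<le> d" using d ae by (simp add: \<theta>_def field_simps)
    finally show "S \<le> a * e + d" by simp
  qed
  then show ?thesis using True a by simp
next
  case False
  define \<alpha> where "\<alpha> = sqrt a"
  define \<rho> where "\<rho> = sqrt b"
  have p: "\<alpha> > 0" "\<rho> > 0" using a b False by (auto simp: \<alpha>_def \<rho>_def)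
  have sq: "a = \<alpha>\<^sup>2" "b = \<rho>\<^sup>2" using a b by (auto simp: \<alpha>_def \<rho>_def)
  have "S \<le> (1 + \<rho> / \<alpha>) * (\<alpha>\<^sup>2 * e) + (1 + 1 / (\<rho> / \<alpha>)) * (\<rho>\<^sup>2 * e)"
    using S[of "\<rho> / \<alpha>"] p by (simp add: sq)
  also have "\<dots> = (\<alpha> + \<rho>)\<^sup>2 * e" using p by (simp add: field_simps power2_eq_square)
  finally show ?thesis by (simp add: \<alpha>_def \<rho>_def)
qed

text \<open>
  In the proof, \<open>c k\<close> is the latest event at which the held value changed. The intervals
  \<open>[s k, c k]\<close> of different updates do not overlap, so the energy of \<open>v\<close> on them is counted once.
\<close>
lemma sample_hold_iqc:
  fixes v :: "real \<Rightarrow> real"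
  assumes Ts: "admissible Ts" and v: "v \<in> L2e" and L: "0 < L" and e: "0 \<le> e"
    and s: "\<And>k. 0 \<le> s k" "\<And>k. s k \<le> Ts k"
      "\<And>k. s (Suc k) = s k \<or> Ts k < s (Suc k) \<and> Ts (Suc k) - s (Suc k) \<le> e"
      "\<And>k. Ts (Suc k) \<le> s k + L"
    and w_def: "w = (\<lambda>t. integral {0..t} v - hold Ts (\<lambda>k. integral {0..s k} v) t)"
    and \<tau>: "0 \<le> \<tau>"
  shows "w \<in> L2e"
    "integral {0..\<tau>} (\<lambda>t. (w t)\<^sup>2) \<le> (2 * L / pi + sqrt (L * e))\<^sup>2 * integral {0..\<tau>} (\<lambda>t. (v t)\<^sup>2)"
    "0 \<le> integral {0..\<tau>} (\<lambda>t. 2 * (v t * w t) + e * (v t)\<^sup>2)"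
proof -
  define V where "V t = integral {0..t} v" for t
  define E where "E t = integral {0..t} (\<lambda>t. (v t)\<^sup>2)" for t
  have sm: "Ts k < Ts (Suc k)" for k using Ts by (simp add: admissible_def)
  have Ts0: "Ts 0 = 0" using Ts by (simp add: admissible_def)
  have s0: "s 0 = 0" using s(1)[of 0] s(2)[of 0] Ts0 by simp
  have Tsn: "0 \<le> Ts k" for k by (rule admissible_nonneg[OF Ts])
  have Vc: "continuous_on {0..} V" unfolding V_def by (rule continuous_on_L2e_integral[OF v])
  have vai: "v absolutely_integrable_on {a..b}" if "0 \<le> a" for a b by (rule L2e_abs_int[OF v that])
  have v2ai: "(\<lambda>t. (v t)\<^sup>2) absolutely_integrable_on {a..b}" if "0 \<le> a" for a b
    using L2e_abs_int_sq[OF v that] by simp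
  have Vd: "V b - V a = integral {a..b} v" if "0 \<le> a" "a \<le> b" for a b
    using indefinite_diff[OF vai[OF order_refl, of b] that order_refl] by (simp add: V_def)
  have Ed: "E b - E a = integral {a..b} (\<lambda>t. (v t)\<^sup>2)" if "0 \<le> a" "a \<le> b" for a b
    using indefinite_diff[OF v2ai[OF order_refl, of b] that order_refl] by (simp add: E_def)
  have Emono: "E a \<le> E b" if "0 \<le> a" "a \<le> b" for a b
    using Ed[OF that] integral_nonneg[OF abs_int_imp_int[OF v2ai[OF that(1), of b]]] by simp
  have E0: "E 0 = 0" by (simp add: E_def)
  have VE: "(V b - V a)\<^sup>2 \<le> (b - a) * (E b - E a)" if "0 \<le> a" "a \<le> b" for a b
    using integral_Cauchy_Schwarz_interval[OF that(2) abs_int_imp_int[OF vai] abs_int_imp_int[OF v2ai]] that by (simp add: Vd Ed)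
  have w_eq: "w t = V t - V (s k)" if "Ts k \<le> t" "t < Ts (Suc k)" for t k
    using hold_eq[OF Ts that] by (simp add: w_def V_def)
  have VL: "V \<in> L2e" by (rule L2e_continuous[OF Vc])
  show wL: "w \<in> L2e" unfolding w_def using L2e_diff[OF VL hold_L2e[OF Ts]] by (simp add: V_def[abs_def])
  have vw: "(\<lambda>t. v t * w t) absolutely_integrable_on {a..b}" if "0 \<le> a" for a b
    using L2e_abs_int_prod[OF v wL that] by simp
  obtain kt where kt: "Ts kt \<le> \<tau>" "\<tau> < Ts (Suc kt)" using event_index[OF Ts \<tau>] by blast
  define J where "J t = integral {0..t} (\<lambda>t. v t * w t)" for t
  \<comment> \<open>Between events \<open>w\<close> is \<open>V\<close> minus a constant, so
    \<open>2 * (v t * w t)\<close> integrates to the increment of the square of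
    \<open>w\<close>.\<close>
  have Jstep: "2 * J t = 2 * J (Ts k) + ((V t - V (s k))\<^sup>2 - (V (Ts k) - V (s k))\<^sup>2)" if t: "Ts k \<le> t" "t \<le> Ts (Suc k)" for t k
  proof -
    let ?a = "Ts k"
    have "J t - J ?a = integral {?a..t} (\<lambda>r. v r * w r)"
      using indefinite_diff[OF vw[OF order_refl, of t] Tsn[of k] t(1)] by (simp add: J_def)
    also have "\<dots> = integral {?a..t} (\<lambda>r. v r * (V r - V (s k)))"
      by (rule integral_spike[of "{t}"]) (use t in \<open>auto simp: w_eq\<close>)
    finally have Je: "J t - J ?a = integral {?a..t} (\<lambda>r. v r * (V r - V (s k)))" .
    have "2 * integral {?a..t} (\<lambda>r. v r * (V r - V (s k))) = integral {?a..t} (\<lambda>r. (v r \<bullet> integral {?a..r} v + integral {?a..r} v \<bullet> v r) + 2 * (V ?a - V (s k)) * v r)"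
      unfolding integral_mult_right[symmetric]
      by (rule HK_integral_cong) (auto simp: Vd[symmetric] Tsn algebra_simps)
    also have "\<dots> = integral {?a..t} v \<bullet> integral {?a..t} v + 2 * (V ?a - V (s k)) * integral {?a..t} v"
      unfolding integral_inner_by_parts(2)[OF t(1) vai[OF Tsn] vai[OF Tsn]]
      using abs_int_imp_int[OF integral_inner_by_parts(1)[OF t(1) vai[OF Tsn] vai[OF Tsn]]] abs_int_imp_int[OF vai[OF Tsn]]
      by (simp add: HK_integral_add integrable_on_mult_right)
    also have "\<dots> = (V t - V (s k))\<^sup>2 - (V ?a - V (s k))\<^sup>2"
      using Vd[OF Tsn t(1)] by (simp add: power2_eq_square algebra_simps)
    finally show ?thesis using Je by simp
  qed
  \<comment> \<open>A change of sample at \<open>Ts (Suc k)\<close> replaces the square of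
    \<open>w\<close> by at most \<open>e\<close> times the energy of \<open>v\<close> since the new
    sample. That sample was taken after \<open>Ts k\<close>, so this energy has not been charged
    before; the old square is simply dropped.\<close>
  have Jk: "(V (Ts k) - V (s k))\<^sup>2 - e * E (Ts k) \<le> 2 * J (Ts k)" for k
  proof (induction k)
    case 0
    then show ?case by (simp add: Ts0 s0 J_def E0)
  next
    case (Suc k)
    let ?T = "Ts (Suc k)"
    have *: "(V ?T - V (s k))\<^sup>2 - e * E (Ts k) \<le> 2 * J ?T"
      using Jstep[of k ?T] Suc sm[of k] by simp
    have Em: "e * E (Ts k) \<le> e * E ?T" using e Emono[OF Tsn, of k ?T] sm[of k] by (intro mult_left_mono) auto
    show ?case
    proof (cases "s (Suc k) = s k")
      case True
      then show ?thesis using * Em by simp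
    next
      case False
      then have su: "Ts k < s (Suc k)" "?T - s (Suc k) \<le> e" using s(3)[of k] by auto
      have "(V ?T - V (s (Suc k)))\<^sup>2 \<le> (?T - s (Suc k)) * (E ?T - E (s (Suc k)))"
        by (rule VE[OF s(1,2)])
      also have "\<dots> \<le> e * (E ?T - E (s (Suc k)))"
        using su Emono[OF s(1,2), of "Suc k"] by (intro mult_right_mono) auto
      also have "\<dots> \<le> e * (E ?T - E (Ts k))"
        using e Emono[OF Tsn, of k "s (Suc k)"] su by (intro mult_left_mono) auto
      finally have "(V ?T - V (s (Suc k)))\<^sup>2 - e * E ?T \<le> - e * E (Ts k)" by (simp add: algebra_simps)
      also have "\<dots> \<le> 2 * J ?T" using * zero_le_power2[of "V ?T - V (s k)"] by linarith
      finally show ?thesis .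
    qed
  qed
  have "- e * E \<tau> \<le> 2 * J \<tau>"
  proof -
    have "e * E (Ts kt) \<le> e * E \<tau>" using e Emono[OF Tsn kt(1)] by (intro mult_left_mono) auto
    then show ?thesis using Jstep[of kt \<tau>] Jk[of kt] kt zero_le_power2[of "V \<tau> - V (s kt)"] by linarith
  qed
  moreover have "integral {0..\<tau>} (\<lambda>t. 2 * (v t * w t) + e * (v t)\<^sup>2) = 2 * J \<tau> + e * E \<tau>"
    unfolding J_def E_def using abs_int_imp_int[OF vw[of 0 \<tau>]] abs_int_imp_int[OF v2ai[of 0 \<tau>]]
    by (simp add: HK_integral_add integrable_on_mult_right)
  ultimately show "0 \<le> integral {0..\<tau>} (\<lambda>t. 2 * (v t * w t) + e * (v t)\<^sup>2)" by simp
  define c where "c = rec_nat 0 (\<lambda>k ck. if s (Suc k) = s k then ck else Ts (Suc k))"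
  have c0: "c 0 = 0" and cS: "c (Suc k) = (if s (Suc k) = s k then c k else Ts (Suc k))" for k by (auto simp: c_def)
  have cb: "s k \<le> c k \<and> c k \<le> Ts k \<and> c k - s k \<le> e" for k
  proof (induction k)
    case 0
    then show ?case using c0 s0 Ts0 e by simp
  next
    case (Suc k)
    then show ?case using s(3)[of k] s(2)[of "Suc k"] sm[of k] by (auto simp: cS)
  qed
  have cn: "0 \<le> c k" for k using cb[of k] s(1)[of k] by simp
  \<comment> \<open>Events in between leave \<open>c\<close> and \<open>s\<close> unchanged, which
    gives \<open>w1\<close> and \<open>w2\<close> a single formula on all of
    \<open>[c k, Ts (Suc k))\<close>.\<close>
  have cidx: "\<exists>j. Ts j \<le> t \<and> t < Ts (Suc j) \<and> c j = c k \<and> s j = s k" if "c k \<le> t" "t < Ts (Suc k)" for k t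
    using that
  proof (induction k)
    case 0
    then show ?case using c0 Ts0 by (intro exI[of _ 0]) auto
  next
    case (Suc k)
    show ?case
    proof (cases "t < Ts (Suc k)")
      case True
      then have "s (Suc k) = s k" using Suc(2) by (auto simp: cS split: if_splits)
      moreover then have "c (Suc k) = c k" by (simp add: cS)
      ultimately show ?thesis using Suc True by auto
    next
      case False
      then show ?thesis using Suc by (intro exI[of _ "Suc k"]) auto
    qed
  qed
  \<comment> \<open>\<open>w1\<close> is the drift since the last change of the held value,
    \<open>w2\<close> the constant offset accumulated between sampling and that change.\<close>
  define w1 where "w1 t = V t - hold Ts (\<lambda>k. V (c k)) t" for t
  define w2 where "w2 = hold Ts (\<lambda>k. V (c k) - V (s k))"
  have w1_eq: "w1 t = V t - V (c k)" and w2_eq: "w2 t = V (c k) - V (s k)" if ct: "c k \<le> t" "t < Ts (Suc k)" for k t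
  proof -
    obtain j where j: "Ts j \<le> t" "t < Ts (Suc j)" "c j = c k" "s j = s k" using cidx[OF ct] by blast
    show "w1 t = V t - V (c k)" "w2 t = V (c k) - V (s k)"
      using hold_eq[OF Ts j(1,2)] j(3,4) by (auto simp: w1_def w2_def)
  qed
  have w12: "w t = w1 t + w2 t" if "0 \<le> t" for t
  proof -
    let ?k = "event_index Ts t"
    have k: "Ts ?k \<le> t" "t < Ts (Suc ?k)" using event_index[OF Ts that] by auto
    then have "c ?k \<le> t" using cb[of ?k] by simp
    then show ?thesis using w_eq[OF k] w1_eq[of ?k t] w2_eq[of ?k t] k by simp
  qed
  have w1L: "w1 \<in> L2e" unfolding w1_def by (intro L2e_diff VL hold_L2e[OF Ts])
  have w2L: "w2 \<in> L2e" unfolding w2_def by (rule hold_L2e[OF Ts])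
  have ai1: "(\<lambda>t. (w1 t)\<^sup>2) absolutely_integrable_on {a..b}" and ai2: "(\<lambda>t. (w2 t)\<^sup>2) absolutely_integrable_on {a..b}"
    if "0 \<le> a" for a b using L2e_abs_int_sq[OF w1L that] L2e_abs_int_sq[OF w2L that] by auto
  define I1 where "I1 t = integral {0..t} (\<lambda>t. (w1 t)\<^sup>2)" for t
  define I2 where "I2 t = integral {0..t} (\<lambda>t. (w2 t)\<^sup>2)" for t
  define \<kappa> where "\<kappa> = (2 * L / pi)\<^sup>2"
  \<comment> \<open>\<open>w1\<close> vanishes at \<open>c k\<close> and is the integral of
    \<open>v\<close> from there; \<open>t - c k \<le> L\<close> because
    \<open>s k \<le> c k\<close>.\<close>
  have step1: "I1 t \<le> I1 (c k) + \<kappa> * (E t - E (c k))" if t: "c k \<le> t" "t \<le> Ts (Suc k)" for t k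
  proof -
    have "I1 t - I1 (c k) = integral {c k..t} (\<lambda>r. (w1 r)\<^sup>2)"
      using indefinite_diff[OF ai1[of 0 t] _ t(1)] cn[of k] by (simp add: I1_def)
    also have "\<dots> = integral {c k..t} (\<lambda>r. (integral {c k..r} v)\<^sup>2)"
      by (rule integral_spike[of "{t}"]) (use t cn[of k] in \<open>auto simp: w1_eq Vd\<close>)
    also have "\<dots> \<le> (2 * (t - c k) / pi)\<^sup>2 * integral {c k..t} (\<lambda>r. (v r)\<^sup>2)"
      by (rule Wirtinger_one_sided[OF t(1) vai[OF cn] v2ai[OF cn]])
    also have "\<dots> = (2 * (t - c k) / pi)\<^sup>2 * (E t - E (c k))" using Ed[OF cn t(1)] by simp
    also have "\<dots> \<le> \<kappa> * (E t - E (c k))"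
    proof (rule mult_right_mono)
      show "(2 * (t - c k) / pi)\<^sup>2 \<le> \<kappa>" unfolding \<kappa>_def
        using t s(4)[of k] cb[of k] by (intro power_mono divide_right_mono) auto
    qed (use Emono[OF cn t(1)] in simp)
    finally show ?thesis by simp
  qed
  have step2: "I2 t \<le> I2 (c k) + (L * e) * (E (c k) - E (s k))" if t: "c k \<le> t" "t \<le> Ts (Suc k)" for t k
  proof -
    have "I2 t - I2 (c k) = integral {c k..t} (\<lambda>r. (w2 r)\<^sup>2)"
      using indefinite_diff[OF ai2[of 0 t] _ t(1)] cn[of k] by (simp add: I2_def)
    also have "\<dots> = integral {c k..t} (\<lambda>r. (V (c k) - V (s k))\<^sup>2)"
      by (rule integral_spike[of "{t}"]) (use t in \<open>auto simp: w2_eq\<close>)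
    also have "\<dots> = (t - c k) * (V (c k) - V (s k))\<^sup>2" using t by simp
    also have "\<dots> \<le> L * (e * (E (c k) - E (s k)))"
    proof (rule mult_mono)
      have "(V (c k) - V (s k))\<^sup>2 \<le> (c k - s k) * (E (c k) - E (s k))" using VE[OF s(1), of k "c k"] cb[of k] by simp
      also have "\<dots> \<le> e * (E (c k) - E (s k))" using cb[of k] Emono[OF s(1), of k "c k"] by (intro mult_right_mono) auto
      finally show "(V (c k) - V (s k))\<^sup>2 \<le> e * (E (c k) - E (s k))" .
    qed (use t s(4)[of k] cb[of k] L in auto)
    finally show ?thesis by simp
  qed
  \<comment> \<open>\<open>I2\<close> is charged only up to \<open>s k\<close>: the energy on
    \<open>[s k, c k]\<close> pays for the offset that acts after \<open>c k\<close>. At a change of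
    sample \<open>c k\<close> lies before \<open>s (Suc k)\<close>, so the charges stay
    disjoint.\<close>
  have Q: "I1 (c k) \<le> \<kappa> * E (c k) \<and> I2 (c k) \<le> (L * e) * E (s k)" for k
  proof (induction k)
    case 0
    then show ?case by (simp add: c0 s0 I1_def I2_def E0)
  next
    case (Suc k)
    show ?case
    proof (cases "s (Suc k) = s k")
      case True
      then show ?thesis using Suc by (simp add: cS)
    next
      case False
      then have su: "Ts k < s (Suc k)" using s(3)[of k] by auto
      have ck: "c (Suc k) = Ts (Suc k)" using False by (simp add: cS)
      have le: "c k \<le> Ts (Suc k)" using cb[of k] sm[of k] by simp
      have "I1 (Ts (Suc k)) \<le> \<kappa> * E (Ts (Suc k))"
        using step1[OF le order_refl] Suc by (simp add: algebra_simps)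
      moreover have "I2 (Ts (Suc k)) \<le> (L * e) * E (c k)"
        using step2[OF le order_refl] Suc by (simp add: algebra_simps)
      moreover have "(L * e) * E (c k) \<le> (L * e) * E (s (Suc k))"
        using L e Emono[OF cn, of k "s (Suc k)"] su cb[of k] by (intro mult_left_mono) auto
      ultimately show ?thesis by (simp add: ck)
    qed
  qed
  have ct: "c kt \<le> \<tau>" "\<tau> \<le> Ts (Suc kt)" using cb[of kt] kt by auto
  have f1: "I1 \<tau> \<le> \<kappa> * E \<tau>" using step1[OF ct] Q[of kt] by (simp add: algebra_simps)
  have f2: "I2 \<tau> \<le> (L * e) * E \<tau>"
  proof -
    have "I2 \<tau> \<le> (L * e) * E (c kt)" using step2[OF ct] Q[of kt] by (simp add: algebra_simps)
    also have "\<dots> \<le> (L * e) * E \<tau>" using L e Emono[OF cn ct(1)] by (intro mult_left_mono) auto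
    finally show ?thesis .
  qed
  have "integral {0..\<tau>} (\<lambda>t. (w t)\<^sup>2) \<le> (sqrt \<kappa> + sqrt (L * e))\<^sup>2 * E \<tau>"
  proof (rule sum_sq_bound_sqrt)
    fix \<theta> :: real assume \<theta>: "\<theta> > 0"
    have i: "(\<lambda>t. (w1 t)\<^sup>2) integrable_on {0..\<tau>}" "(\<lambda>t. (w2 t)\<^sup>2) integrable_on {0..\<tau>}"
      using abs_int_imp_int[OF ai1] abs_int_imp_int[OF ai2] by auto
    have "integral {0..\<tau>} (\<lambda>t. (w t)\<^sup>2) \<le> integral {0..\<tau>} (\<lambda>t. (1 + \<theta>) * (w1 t)\<^sup>2 + (1 + 1 / \<theta>) * (w2 t)\<^sup>2)"
    proof (rule integral_le)
      show "(\<lambda>t. (w t)\<^sup>2) integrable_on {0..\<tau>}" using abs_int_imp_int[OF L2e_abs_int_sq[OF wL order_refl]] by simp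
      show "(\<lambda>t. (1 + \<theta>) * (w1 t)\<^sup>2 + (1 + 1 / \<theta>) * (w2 t)\<^sup>2) integrable_on {0..\<tau>}"
        using i by (intro integrable_add integrable_on_mult_right)
      fix t assume "t \<in> {0..\<tau>}"
      then have wt: "w t = w1 t + w2 t" by (intro w12) auto
      have "0 \<le> (\<theta> * w1 t - w2 t)\<^sup>2 / \<theta>" using \<theta> by simp
      also have "\<dots> = \<theta> * (w1 t)\<^sup>2 - 2 * (w1 t * w2 t) + (1 / \<theta>) * (w2 t)\<^sup>2"
        using \<theta> by (simp add: field_simps power2_eq_square)
      finally show "(w t)\<^sup>2 \<le> (1 + \<theta>) * (w1 t)\<^sup>2 + (1 + 1 / \<theta>) * (w2 t)\<^sup>2"
        unfolding wt by (simp add: power2_sum algebra_simps)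
    qed
    also have "\<dots> = (1 + \<theta>) * I1 \<tau> + (1 + 1 / \<theta>) * I2 \<tau>"
      unfolding I1_def I2_def using integrable_on_mult_right[OF i(1), of "1 + \<theta>"] integrable_on_mult_right[OF i(2), of "1 + 1 / \<theta>"]
      by (simp only: HK_integral_add integral_mult_right)
    also have "\<dots> \<le> (1 + \<theta>) * (\<kappa> * E \<tau>) + (1 + 1 / \<theta>) * (L * e * E \<tau>)"
      using f1 f2 \<theta> by (intro add_mono mult_left_mono) auto
    finally show "integral {0..\<tau>} (\<lambda>t. (w t)\<^sup>2) \<le> (1 + \<theta>) * (\<kappa> * E \<tau>) + (1 + 1 / \<theta>) * (L * e * E \<tau>)" .
  qed (use L e Emono[OF order_refl \<tau>] E0 in \<open>auto simp: \<kappa>_def\<close>)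
  then show "integral {0..\<tau>} (\<lambda>t. (w t)\<^sup>2) \<le> (2 * L / pi + sqrt (L * e))\<^sup>2 * integral {0..\<tau>} (\<lambda>t. (v t)\<^sup>2)"
    using L by (simp add: \<kappa>_def E_def)
qed

section \<open>Lyapunov inequality and linear matrix inequality\<close>

lemma contraction_seq_tendsto_0:
  fixes a e :: "nat \<Rightarrow> real"
  assumes q: "0 \<le> q" "q < 1" and a: "\<And>k. 0 \<le> a k" "\<And>k. a (Suc k) \<le> q * a k + e k" and e: "e \<longlonglongrightarrow> 0"
  shows "a \<longlonglongrightarrow> 0"
proof (rule LIMSEQ_I)
  fix r :: real assume r: "0 < r"
  \<comment> \<open>\<open>r / 2\<close> is the fixed point of the recursion
    \<open>a = q * a + (1 - q) * (r / 2)\<close>.\<close>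
  obtain N where N: "\<And>k. k \<ge> N \<Longrightarrow> \<bar>e k\<bar> < (1 - q) * (r / 2)"
    using LIMSEQ_D[OF e, of "(1 - q) * (r / 2)"] q r by auto
  have b: "a (N + j) \<le> q ^ j * a N + r / 2" for j
  proof (induction j)
    case 0
    then show ?case using r by simp
  next
    case (Suc j)
    have "a (N + Suc j) \<le> q * a (N + j) + e (N + j)" using a(2)[of "N + j"] by simp
    also have "\<dots> \<le> q * (q ^ j * a N + r / 2) + (1 - q) * (r / 2)"
      using Suc q(1) N[of "N + j"] by (intro add_mono mult_left_mono) auto
    also have "\<dots> = q ^ Suc j * a N + r / 2" by (simp add: algebra_simps diff_divide_distrib)
    finally show ?case .
  qed
  have "(\<lambda>j. q ^ j * a N) \<longlonglongrightarrow> 0 * a N" using q by (intro tendsto_mult_right LIMSEQ_realpow_zero) auto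
  then obtain M where M: "\<And>j. j \<ge> M \<Longrightarrow> \<bar>q ^ j * a N\<bar> < r / 2"
    using LIMSEQ_D[of "\<lambda>j. q ^ j * a N" 0 "r / 2"] r by auto
  have "norm (a k - 0) < r" if k: "k \<ge> N + M" for k
  proof -
    have "q ^ (k - N) * a N < r / 2" using M[of "k - N"] k by linarith
    then show ?thesis using b[of "k - N"] k a(1)[of k] by simp
  qed
  then show "\<exists>no. \<forall>k\<ge>no. norm (a k - 0) < r" by blast
qed

text \<open>
  Split off a root \<open>\<mu>\<close> of an annihilating polynomial of the orbit: either \<open>T - \<mu>\<close> is injective and
  can be cancelled, or \<open>\<mu>\<close> is an eigenvalue and the iterates satisfy a contracting recursion.
\<close>
lemma power_iterates_tendsto_0_poly:
  fixes T :: "complex ^ 'n \<Rightarrow> complex ^ 'n"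
  assumes T: "linear T" "\<And>c x. T (c *s x) = c *s T x"
    and eig: "\<And>\<mu> v. v \<noteq> 0 \<Longrightarrow> T v = \<mu> *s v \<Longrightarrow> norm \<mu> < 1"
  shows "p \<noteq> 0 \<Longrightarrow> degree p \<le> n \<Longrightarrow> (\<Sum>i\<le>n. coeff p i *s (T ^^ i) x) = 0 \<Longrightarrow> (\<lambda>k. (T ^^ k) x) \<longlonglongrightarrow> 0"
proof (induction n arbitrary: p x)
  case 0
  then have "coeff p 0 \<noteq> 0" by (metis le_zero_eq leading_coeff_0_iff)
  then have "x = 0" using 0 by simp
  moreover have "(T ^^ k) 0 = 0" for k by (induction k) (auto simp: linear_0[OF T(1)])
  ultimately show ?case by simp
next
  case (Suc n)
  have Tk: "linear (T ^^ k)" for k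
  proof (induction k)
    case (Suc k)
    then show ?case using linear_compose[OF Suc T(1)] by (simp add: comp_def)
  qed (simp add: linear_id[unfolded id_def])
  have Tks: "(T ^^ k) (c *s y) = c *s (T ^^ k) y" for k c y by (induction k) (auto simp: T(2))
  show ?case
  proof (cases "constant (poly p)")
    case True
    then have d: "degree p = 0" by (simp add: constant_degree)
    then have "coeff p 0 \<noteq> 0" using Suc(2) by (metis leading_coeff_0_iff)
    moreover have "(\<Sum>i\<le>Suc n. coeff p i *s (T ^^ i) x) = (\<Sum>i\<in>{0}. coeff p i *s (T ^^ i) x)"
      using d by (intro sum.mono_neutral_right) (auto simp: coeff_eq_0)
    ultimately have "x = 0" using Suc(4) by simp
    moreover have "(T ^^ k) 0 = 0" for k using linear_0[OF Tk] .
    ultimately show ?thesis by simp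
  next
    case False
    then obtain \<mu> where \<mu>: "poly p \<mu> = 0" using fundamental_theorem_of_algebra by blast
    then obtain q where q: "p = [:- \<mu>, 1:] * q" by (auto simp: poly_eq_0_iff_dvd elim: dvdE)
    have q0: "q \<noteq> 0" using q Suc(2) by auto
    have "degree p = degree [:- \<mu>, 1:] + degree q" unfolding q by (rule degree_mult_eq) (use q0 in auto)
    then have dq: "degree q \<le> n" using Suc(3) by simp
    define y where "y = T x - \<mu> *s x"
    have Tky: "(T ^^ k) y = (T ^^ Suc k) x - \<mu> *s (T ^^ k) x" for k
      by (simp add: y_def linear_diff[OF Tk] Tks funpow_swap1)
    have c0: "coeff p 0 = - \<mu> * coeff q 0" and cS: "coeff p (Suc i) = coeff q i - \<mu> * coeff q (Suc i)" for i
      by (auto simp: q)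
    \<comment> \<open>Coefficient form of the identity \<open>q(T) (T - \<mu>) x = p(T) x\<close>:
      the vector \<open>y\<close> is annihilated by \<open>q\<close>, whose degree is
      smaller.\<close>
    have "(\<Sum>i\<le>n. coeff q i *s (T ^^ i) y) = (\<Sum>i\<le>n. coeff q i *s (T ^^ Suc i) x) - (\<Sum>i\<le>n. (\<mu> * coeff q i) *s (T ^^ i) x)"
      unfolding Tky by (simp add: vec.scale_right_diff_distrib sum_subtractf mult.commute)
    also have "(\<Sum>i\<le>n. (\<mu> * coeff q i) *s (T ^^ i) x) = (\<Sum>i\<le>Suc n. (\<mu> * coeff q i) *s (T ^^ i) x)"
      using dq by (simp add: coeff_eq_0)
    also have "\<dots> = (\<mu> * coeff q 0) *s x + (\<Sum>i\<le>n. (\<mu> * coeff q (Suc i)) *s (T ^^ Suc i) x)"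
      by (subst sum.atMost_Suc_shift) simp
    also have "(\<Sum>i\<le>n. coeff q i *s (T ^^ Suc i) x) - \<dots> = coeff p 0 *s x + (\<Sum>i\<le>n. coeff p (Suc i) *s (T ^^ Suc i) x)"
      unfolding c0 cS by (simp add: vec.scale_left_diff_distrib sum_subtractf)
    also have "\<dots> = (\<Sum>i\<le>Suc n. coeff p i *s (T ^^ i) x)" by (subst sum.atMost_Suc_shift) simp
    finally have "(\<Sum>i\<le>n. coeff q i *s (T ^^ i) y) = 0" using Suc(4) by simp
    then have y: "(\<lambda>k. (T ^^ k) y) \<longlonglongrightarrow> 0" by (rule Suc(1)[OF q0 dq])
    show ?thesis
    proof (cases "inj (\<lambda>v. T v - \<mu> *s v)")
      case True
      have l: "linear (\<lambda>v. T v - \<mu> *s v)"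
        by (rule linear_compose_sub[OF T(1)]) (auto intro!: linearI simp: vec.scale_right_distrib vec_eq_iff)
      obtain g where g: "linear g" "g \<circ> (\<lambda>v. T v - \<mu> *s v) = id"
        using linear_injective_left_inverse[OF l True] by blast
      have "(T ^^ k) x = g ((T ^^ k) y)" for k
        using fun_cong[OF g(2), of "(T ^^ k) x"] by (simp add: Tky)
      moreover have "(\<lambda>k. g ((T ^^ k) y)) \<longlonglongrightarrow> g 0"
        using linear_continuous_at[OF linear_conv_bounded_linear[THEN iffD1, OF g(1)]] y by (rule isCont_tendsto_compose)
      ultimately show ?thesis using linear_0[OF g(1)] by simp
    next
      case False
      then obtain a b where ab: "a \<noteq> b" "T a - \<mu> *s a = T b - \<mu> *s b" by (auto simp: inj_def)
      have "T (a - b) = \<mu> *s (a - b)"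
        using ab(2) by (simp add: linear_diff[OF T(1)] vec.scale_right_diff_distrib algebra_simps)
      then have \<mu>1: "norm \<mu> < 1" using eig[of "a - b" \<mu>] ab(1) by simp
      have "(\<lambda>k. norm ((T ^^ k) x)) \<longlonglongrightarrow> 0"
      proof (rule contraction_seq_tendsto_0[of "norm \<mu>" _ "\<lambda>k. norm ((T ^^ k) y)"])
        fix k
        have "(T ^^ Suc k) x = \<mu> *s (T ^^ k) x + (T ^^ k) y" using Tky[of k] by simp
        then have "norm ((T ^^ Suc k) x) \<le> norm (\<mu> *s (T ^^ k) x) + norm ((T ^^ k) y)" by (simp add: norm_triangle_ineq)
        also have "norm (\<mu> *s (T ^^ k) x) = norm \<mu> * norm ((T ^^ k) x)"
          by (simp add: norm_vec_def L2_set_def norm_mult power_mult_distrib sum_distrib_left[symmetric] real_sqrt_mult)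
        finally show "norm ((T ^^ Suc k) x) \<le> norm \<mu> * norm ((T ^^ k) x) + norm ((T ^^ k) y)" .
      qed (use \<mu>1 tendsto_norm_zero[OF y] in auto)
      then show ?thesis by (rule tendsto_norm_zero_cancel)
    qed
  qed
qed

text \<open>With \<open>N\<close> the real dimension, the first \<open>N + 1\<close> iterates are
  linearly dependent over the reals; the coefficients form an annihilating polynomial of the
  orbit.\<close>

lemma power_iterates_tendsto_0:
  fixes T :: "complex ^ 'n \<Rightarrow> complex ^ 'n"
  assumes T: "linear T" "\<And>c x. T (c *s x) = c *s T x"
    and eig: "\<And>\<mu> v. v \<noteq> 0 \<Longrightarrow> T v = \<mu> *s v \<Longrightarrow> norm \<mu> < 1"
  shows "(\<lambda>k. (T ^^ k) x) \<longlonglongrightarrow> 0"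
proof -
  define N where "N = DIM(complex ^ 'n)"
  define f where "f i = (T ^^ i) x" for i
  obtain a :: "nat \<Rightarrow> real" where a: "(\<Sum>i\<le>N. a i *\<^sub>R f i) = 0" "\<exists>i\<le>N. a i \<noteq> 0"
  proof (cases "inj_on f {..N}")
    \<comment> \<open>Two equal iterates already give a relation. The case is separate because
      \<open>dependent\<close> speaks of the set of iterates, in which repetitions are lost.\<close>
    case False
    then obtain i j where ij: "i \<le> N" "j \<le> N" "i \<noteq> j" "f i = f j" by (auto simp: inj_on_def)
    have "(\<Sum>k\<le>N. (if k = i then 1 else if k = j then - 1 else 0 :: real) *\<^sub>R f k)
      = (\<Sum>k\<le>N. (if k = i then f i else 0) + (if k = j then - f j else 0))"
      by (rule sum.cong) (use ij in auto)
    also have "\<dots> = 0" using ij by (simp add: sum.distrib)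
    finally show ?thesis using ij by (intro that[of "\<lambda>k. if k = i then 1 else if k = j then - 1 else 0"]) (auto intro!: exI[of _ i])
  next
    case True
    then have "card (f ` {..N}) = Suc N" by (simp add: card_image)
    then have "dependent (f ` {..N})" using independent_bound[of "f ` {..N}"] by (auto simp: N_def)
    then obtain u where u: "(\<Sum>v\<in>f ` {..N}. u v *\<^sub>R v) = 0" "\<exists>v\<in>f ` {..N}. u v \<noteq> 0"
      by (auto simp: dependent_finite)
    have "(\<Sum>i\<le>N. u (f i) *\<^sub>R f i) = 0" using u(1) by (simp add: sum.reindex[OF True])
    then show ?thesis using that[of "\<lambda>i. u (f i)"] u(2) by auto
  qed
  define p where "p = (\<Sum>i\<le>N. monom (complex_of_real (a i)) i)"
  have cp: "coeff p i = (if i \<le> N then of_real (a i) else 0)" for i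
    by (simp add: p_def coeff_sum coeff_monom)
  have "p \<noteq> 0" using a(2) cp by (metis coeff_0 of_real_eq_0_iff)
  moreover have "degree p \<le> N" by (rule degree_le) (simp add: cp)
  moreover have "(\<Sum>i\<le>N. coeff p i *s (T ^^ i) x) = (\<Sum>i\<le>N. a i *\<^sub>R f i)"
    by (rule sum.cong) (auto simp: cp f_def vec_eq_iff vector_scaleR_component scaleR_conv_of_real[where 'a = complex])
  ultimately show ?thesis using power_iterates_tendsto_0_poly[of T p N x] T eig a(1) by simp
qed

section \<open>Hurwitz matrices\<close>

definition cvec :: "real ^ 'n \<Rightarrow> complex ^ 'n" where "cvec x = (\<chi> i. of_real (x $ i))"

lemma cvec_nth [simp]: "cvec x $ i = of_real (x $ i)" by (simp add: cvec_def)

lemma complex_matrix_cvec: "complex_matrix M *v cvec x = cvec (M *v x)"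
  by (simp add: vec_eq_iff matrix_vector_mult_def complex_matrix_def)

lemma mat_mult_vec: "mat c *v x = c *s x" for x :: "'a::comm_semiring_1 ^ 'n"
proof -
  have "(\<Sum>j\<in>UNIV. (if i = j then c else 0) * x $ j) = (\<Sum>j\<in>UNIV. if i = j then c * x $ j else 0)" for i
    by (rule sum.cong) auto
  then show ?thesis by (simp add: vec_eq_iff matrix_vector_mult_def mat_def)
qed

lemma hurwitz_resolvent_invertible:
  assumes A: "hurwitz A" and s: "0 \<le> Re s"
  shows "invertible (mat s - complex_matrix A)"
proof -
  have "v = 0" if "(mat s - complex_matrix A) *v v = 0" for v
  proof (rule ccontr)
    assume "v \<noteq> 0"
    moreover have "complex_matrix A *v v = s *s v"
      using that by (simp add: matrix_vector_mult_diff_rdistrib mat_mult_vec)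
    ultimately show False using A s unfolding hurwitz_def by force
  qed
  then show ?thesis unfolding invertible_left_inverse matrix_left_invertible_ker by blast
qed

lemma invertible_matrix_inv:
  assumes "invertible N" shows "N ** matrix_inv N = mat 1" "matrix_inv N ** N = mat 1"
  using someI_ex[OF assms[unfolded invertible_def]] by (simp_all add: matrix_inv_def)

text \<open>
  The backward Euler map \<open>(1 - \<epsilon> A)\<^sup>-\<^sup>1\<close> does not increase the quadratic form, and its
  iterates tend to zero because its eigenvalues lie inside the unit disc.
\<close>
lemma hurwitz_lyapunov_nonneg:
  fixes A Q :: "real ^ 'n ^ 'n"
  assumes A: "hurwitz A" and Q: "transpose Q = Q" and r: "0 < r"
    and lyap: "\<And>x. 2 * ((A *v x) \<bullet> (Q *v x)) \<le> - r * (x \<bullet> x)"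
  shows "0 \<le> x \<bullet> (Q *v x)"
proof -
  define V where "V x = x \<bullet> (Q *v x)" for x
  have Qs: "a \<bullet> (Q *v b) = b \<bullet> (Q *v a)" for a b
    using dot_lmul_matrix[of a Q b] Q by (simp add: inner_commute flip: transpose_matrix_vector)
  have bl: "bounded_linear (\<lambda>y. Q *v y)" "bounded_linear (\<lambda>y. A *v y)" by auto
  obtain kQ where kQ: "kQ > 0" "\<And>y. norm (Q *v y) \<le> norm y * kQ" using bounded_linear.pos_bounded[OF bl(1)] by blast
  obtain kA where kA: "kA > 0" "\<And>y. norm (A *v y) \<le> norm y * kA" using bounded_linear.pos_bounded[OF bl(2)] by blast
  define K where "K = kA\<^sup>2 * kQ"
  have K: "K > 0" using kA kQ by (simp add: K_def)
  have VA: "- K * (y \<bullet> y) \<le> V (A *v y)" for y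
  proof -
    have "\<bar>V (A *v y)\<bar> \<le> norm (A *v y) * norm (Q *v (A *v y))" unfolding V_def by (rule Cauchy_Schwarz_ineq2)
    also have "\<dots> \<le> norm (A *v y) * (norm (A *v y) * kQ)" by (intro mult_left_mono kQ) auto
    also have "\<dots> = (norm (A *v y))\<^sup>2 * kQ" by (simp add: power2_eq_square)
    also have "\<dots> \<le> (norm y * kA)\<^sup>2 * kQ" using kA kQ(1) by (intro mult_right_mono power_mono) auto
    also have "\<dots> = K * (y \<bullet> y)" by (simp add: K_def power_mult_distrib power2_norm_eq_inner)
    finally show ?thesis by simp
  qed
  \<comment> \<open>With this step the worst case
    \<open>- \<epsilon>\<^sup>2 * K * (y \<bullet> y)\<close> of the second-order term exactly
    cancels the first-order gain \<open>\<epsilon> * r * (y \<bullet> y)\<close>.\<close>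
  define \<epsilon> where "\<epsilon> = r / K"
  have \<epsilon>: "\<epsilon> > 0" using r K by (simp add: \<epsilon>_def)
  have dec: "V y \<le> V (y - \<epsilon> *\<^sub>R (A *v y))" for y
  proof -
    have "V (y - \<epsilon> *\<^sub>R (A *v y)) = V y - \<epsilon> * (2 * ((A *v y) \<bullet> (Q *v y))) + \<epsilon>\<^sup>2 * V (A *v y)"
      unfolding V_def using Qs[of y "A *v y"]
      by (simp add: matrix_vector_mult_diff_distrib matrix_vector_mult_scaleR inner_diff_left inner_diff_right power2_eq_square algebra_simps)
    moreover have "\<epsilon> * (2 * ((A *v y) \<bullet> (Q *v y))) \<le> \<epsilon> * (- r * (y \<bullet> y))" using \<epsilon> lyap[of y] by (intro mult_left_mono) auto
    moreover have "\<epsilon>\<^sup>2 * (- K * (y \<bullet> y)) \<le> \<epsilon>\<^sup>2 * V (A *v y)" by (intro mult_left_mono VA) auto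
    moreover have "\<epsilon>\<^sup>2 * (- K * (y \<bullet> y)) = \<epsilon> * (- r * (y \<bullet> y))"
      using K by (simp add: \<epsilon>_def power2_eq_square)
    ultimately show ?thesis by linarith
  qed
  \<comment> \<open>\<open>T\<close> below is \<open>1 / \<epsilon>\<close> times the inverse of
    \<open>N\<close>, that is, the inverse of \<open>1 - \<epsilon> A\<close>, on complex vectors
    since the eigenvalues may be complex.\<close>
  define N where "N = mat (of_real (1 / \<epsilon>)) - complex_matrix A"
  have Ninv: "invertible N" unfolding N_def using \<epsilon> by (intro hurwitz_resolvent_invertible A) auto
  note NN = invertible_matrix_inv[OF Ninv]
  define T where "T v = of_real (1 / \<epsilon>) *s (matrix_inv N *v v)" for v
  have Tl: "linear T" unfolding T_def
  proof (rule linearI)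
    fix b1 b2 :: "complex ^ 'n" and r :: real
    show "of_real (1 / \<epsilon>) *s (matrix_inv N *v (b1 + b2)) = of_real (1 / \<epsilon>) *s (matrix_inv N *v b1) + of_real (1 / \<epsilon>) *s (matrix_inv N *v b2)"
      by (simp only: matrix_vector_right_distrib vec.scale_right_distrib)
    show "of_real (1 / \<epsilon>) *s (matrix_inv N *v (r *\<^sub>R b1)) = r *\<^sub>R (of_real (1 / \<epsilon>) *s (matrix_inv N *v b1))"
      by (simp add: vec_eq_iff matrix_vector_mult_def sum_distrib_left vector_scaleR_component scaleR_conv_of_real[where 'a = complex] ac_simps)
  qed
  have Ts: "T (c *s v) = c *s T v" for c v unfolding T_def
    by (simp add: vec_eq_iff matrix_vector_mult_def sum_distrib_left ac_simps)
  have NT: "N *v T v = of_real (1 / \<epsilon>) *s v" for v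
  proof -
    have "N *v T v = of_real (1 / \<epsilon>) *s (N *v (matrix_inv N *v v))"
      unfolding T_def by (simp add: vec_eq_iff matrix_vector_mult_def sum_distrib_left ac_simps)
    then show ?thesis by (simp add: matrix_vector_mul_assoc NN)
  qed
  \<comment> \<open>A nonzero eigenvalue \<mu> of \<open>T\<close> comes from the eigenvalue
    \<open>(1 - 1 / \<mu>) / \<epsilon>\<close> of \<open>A\<close>, whose negative real part says
    \<open>Re (1 / \<mu>) > 1\<close>.\<close>
  have eig: "norm \<mu> < 1" if v: "v \<noteq> 0" "T v = \<mu> *s v" for \<mu> v
  proof (cases "\<mu> = 0")
    case False
    have "\<mu> *s (N *v v) = of_real (1 / \<epsilon>) *s v"
      using NT[of v] v(2) by (simp add: vec_eq_iff matrix_vector_mult_def sum_distrib_left ac_simps)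
    then have "\<mu> *s (complex_matrix A *v v) = (\<mu> * of_real (1 / \<epsilon>) - of_real (1 / \<epsilon>)) *s v"
      unfolding N_def matrix_vector_mult_diff_rdistrib mat_mult_vec
      by (simp add: vec_eq_iff algebra_simps)
    then have "(1 / \<mu>) *s (\<mu> *s (complex_matrix A *v v)) = (1 / \<mu>) *s ((\<mu> * of_real (1 / \<epsilon>) - of_real (1 / \<epsilon>)) *s v)"
      by (rule arg_cong)
    moreover have "(1 / \<mu>) * (\<mu> * of_real (1 / \<epsilon>) - of_real (1 / \<epsilon>)) = of_real (1 / \<epsilon>) * (1 - 1 / \<mu>)"
      using False by (simp add: algebra_simps)
    ultimately have "complex_matrix A *v v = (of_real (1 / \<epsilon>) * (1 - 1 / \<mu>)) *s v"
      using False by (simp only: vector_smult_assoc) simp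
    then have "Re (of_real (1 / \<epsilon>) * (1 - 1 / \<mu>)) < 0" using A v(1) unfolding hurwitz_def by blast
    then have "1 < Re (1 / \<mu>)" using \<epsilon> by (simp add: field_simps mult_less_0_iff)
    also have "\<dots> \<le> norm (1 / \<mu>)" by (rule complex_Re_le_cmod)
    finally show ?thesis using False by (simp add: norm_divide field_simps)
  qed simp
  define Nr where "Nr y = y - \<epsilon> *\<^sub>R (A *v y)" for y
  have cN: "cvec (Nr y) = of_real \<epsilon> *s (N *v cvec y)" for y
    using \<epsilon> unfolding N_def matrix_vector_mult_diff_rdistrib mat_mult_vec complex_matrix_cvec Nr_def
    by (simp add: vec_eq_iff algebra_simps)
  \<comment> \<open>Return to real vectors, on which \<open>V\<close> lives: the inverse
    \<open>R\<close> of \<open>Nr\<close> is the restriction of \<open>T\<close> to them.\<close>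
  have "\<exists>y. cvec y = T (cvec x) \<and> Nr y = x" for x
  proof -
    have "inj Nr"
    proof (rule injI)
      fix a b assume "Nr a = Nr b"
      then have "of_real \<epsilon> *s (N *v cvec a) = of_real \<epsilon> *s (N *v cvec b)" using cN by metis
      then have "N *v cvec a = N *v cvec b" using \<epsilon> by simp
      then have "matrix_inv N *v (N *v cvec a) = matrix_inv N *v (N *v cvec b)" by simp
      then show "a = b" by (simp add: matrix_vector_mul_assoc NN vec_eq_iff)
    qed
    moreover have "linear Nr" unfolding Nr_def
      by (rule linearI) (simp_all add: matrix_vector_right_distrib matrix_vector_mult_scaleR algebra_simps)
    ultimately have "surj Nr" by (simp add: linear_injective_imp_surjective)
    then obtain y where y: "Nr y = x" by (metis surjD)
    have "T (cvec x) = of_real (1 / \<epsilon>) *s (matrix_inv N *v (of_real \<epsilon> *s (N *v cvec y)))"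
      by (simp add: T_def cN flip: y)
    also have "\<dots> = matrix_inv N *v (N *v cvec y)" using \<epsilon>
      by (simp add: vec_eq_iff matrix_vector_mult_def[of "matrix_inv N"] sum_distrib_left)
    also have "\<dots> = cvec y" by (simp add: matrix_vector_mul_assoc NN)
    finally show ?thesis using y by auto
  qed
  then obtain R where R: "\<And>x. cvec (R x) = T (cvec x)" "\<And>x. Nr (R x) = x" by metis
  have cR: "cvec ((R ^^ k) x) = (T ^^ k) (cvec x)" for k by (induction k) (auto simp: R)
  have Vk: "V ((R ^^ k) x) \<le> V x" for k
  proof (induction k)
    case (Suc k)
    have "V ((R ^^ Suc k) x) \<le> V (Nr (R ((R ^^ k) x)))" using dec[of "(R ^^ Suc k) x"] by (simp add: Nr_def)
    then show ?case using Suc R(2) by simp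
  qed simp
  have "(\<lambda>k. (R ^^ k) x) \<longlonglongrightarrow> 0"
  proof (rule vec_tendstoI)
    fix i
    have "(\<lambda>k. (T ^^ k) (cvec x) $ i) \<longlonglongrightarrow> 0 $ i"
      by (intro tendsto_vec_nth power_iterates_tendsto_0[OF Tl Ts eig])
    then have "(\<lambda>k. Re (cvec ((R ^^ k) x) $ i)) \<longlonglongrightarrow> Re (0 $ i)" unfolding cR by (rule tendsto_Re)
    then show "(\<lambda>k. (R ^^ k) x $ i) \<longlonglongrightarrow> 0 $ i" by simp
  qed
  then have "(\<lambda>k. V ((R ^^ k) x)) \<longlonglongrightarrow> 0 \<bullet> (Q *v 0)" unfolding V_def
    by (intro tendsto_inner bounded_linear.tendsto[OF bl(1)])
  then have "(\<lambda>k. V ((R ^^ k) x)) \<longlonglongrightarrow> 0" by simp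
  then have "0 \<le> V x" by (rule LIMSEQ_le_const2) (use Vk in auto)
  then show ?thesis by (simp add: V_def)
qed

section \<open>Block matrices and the quadratic form of the matrix inequality\<close>

definition vapp :: "'a ^ 'm \<Rightarrow> 'a ^ 'n \<Rightarrow> 'a ^ ('m + 'n)" where
  "vapp x y = (\<chi> i. case i of Inl k \<Rightarrow> x $ k | Inr k \<Rightarrow> y $ k)"

lemma vapp_nth [simp]: "vapp x y $ Inl k = x $ k" "vapp x y $ Inr l = y $ l" by (simp_all add: vapp_def)

lemma sum_UNIV_sum: "(\<Sum>i\<in>UNIV. f i) = (\<Sum>k\<in>UNIV. f (Inl k)) + (\<Sum>k\<in>UNIV. f (Inr k))"
  for f :: "'m::finite + 'n::finite \<Rightarrow> 'a::comm_monoid_add"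
  by (simp add: UNIV_Plus_UNIV[symmetric] sum.Plus del: UNIV_Plus_UNIV)

lemma hcat_mult: "(M ||| N) *v vapp x y = M *v x + N *v y" for x :: "'a::semiring_1 ^ 'm"
  by (simp add: vec_eq_iff matrix_vector_mult_def hcat_def sum_UNIV_sum)

lemma vcat_mult: "(M /// N) *v x = vapp (M *v x) (N *v x)" for x :: "'a::semiring_1 ^ 'm"
  by (simp add: vec_eq_iff matrix_vector_mult_def vcat_def split_sum_all)

lemma inner_vapp: "vapp x y \<bullet> vapp x' y' = x \<bullet> x' + y \<bullet> y'" for x x' :: "real ^ 'm"
  by (simp add: inner_vec_def sum_UNIV_sum)

lemma quadratic_form_congruence: "x \<bullet> ((transpose M ** N ** M) *v x) = (M *v x) \<bullet> (N *v (M *v x))"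
  for M :: "real ^ 'n ^ 'm"
proof -
  have "x \<bullet> (transpose M *v u) = u \<bullet> (M *v x)" for u
    using dot_lmul_matrix[of u M x] by (simp add: transpose_matrix_vector inner_commute)
  then show ?thesis by (simp add: matrix_vector_mul_assoc[symmetric] inner_commute)
qed

text \<open>The minimum over the unit sphere, extended by homogeneity. The margin \<open>e\<close>
  later bounds the energy of \<open>w\<close> and absorbs the disturbance of
  \<open>y\<close>.\<close>

lemma positive_definite_lower_bound:
  fixes M :: "real ^ 'n ^ 'n"
  assumes "positive_definite M" obtains e where "0 < e" "\<And>x. e * (x \<bullet> x) \<le> x \<bullet> (M *v x)"
proof -
  have c: "continuous_on (sphere 0 1) (\<lambda>x. x \<bullet> (M *v x))" by (intro continuous_intros)
  have "sphere (0::real ^ 'n) 1 \<noteq> {}" by simp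
  then obtain y where y: "y \<in> sphere 0 1" "\<And>x. x \<in> sphere 0 1 \<Longrightarrow> y \<bullet> (M *v y) \<le> x \<bullet> (M *v x)"
    using continuous_attains_inf[OF compact_sphere _ c] by blast
  have "y \<noteq> 0" using y(1) by auto
  then have e: "0 < y \<bullet> (M *v y)" using assms by (simp add: positive_definite_def)
  have "(y \<bullet> (M *v y)) * (x \<bullet> x) \<le> x \<bullet> (M *v x)" for x
  proof (cases "x = 0")
    case False
    have "y \<bullet> (M *v y) \<le> (x /\<^sub>R norm x) \<bullet> (M *v (x /\<^sub>R norm x))" by (rule y(2)) (use False in simp)
    also have "\<dots> = (x \<bullet> (M *v x)) / (norm x)\<^sup>2"
      by (simp add: matrix_vector_mult_scaleR power2_eq_square field_simps)
    finally show ?thesis using False by (simp add: power2_norm_eq_inner field_simps)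
  qed simp
  then show ?thesis using that e by blast
qed

text \<open>The matrix inequality tested on the vector with blocks \<open>x\<close>,
  \<open>d\<close>, \<open>w\<close>. The first term is the derivative of the storage function along
  the state equation; the others are the performance supply and the two multipliers, with
  \<open>p\<close> collecting the weights of the squared \<open>v\<close>.\<close>

lemma lmi_dissipation:
  fixes A :: "real ^ 'n ^ 'n" and Bd Bw :: "real ^ 1 ^ 'n" and Cz Cv :: "real ^ 'n ^ 1"
    and Dzd Dzw Dvd Dvw :: "real ^ 1 ^ 1" and Q :: "real ^ 'n ^ 'n"
  assumes "let M1 = (A     ||| Bd ||| Bw) ///
                   (mat 1 ||| 0  ||| 0);
             N1 = (0 ||| Q) ///
                   (Q ||| 0);
             M2 = (Cz ||| Dzd  ||| Dzw) ///
                   (Cv ||| Dvd  ||| Dvw) ///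
                   (0  ||| mat 1 ||| 0) ///
                   (0  ||| 0     ||| mat 1);
             N2 = (mat 1 ||| 0                     ||| 0            ||| 0) ///
                   (0     ||| mat p ||| 0            ||| mat Y) ///
                   (0     ||| 0                     ||| mat (- (\<gamma>\<^sup>2)) ||| 0) ///
                   (0     ||| mat Y                 ||| 0            ||| mat (- X))
         in negative_definite (transpose M1 ** N1 ** M1 + transpose M2 ** N2 ** M2)"
    and Q: "Q = transpose Q"
  obtains e where "0 < e" "\<And>x d w. 2 * ((A *v x + Bd *v d + Bw *v w) \<bullet> (Q *v x))
      + (Cz *v x + Dzd *v d + Dzw *v w) \<bullet> (Cz *v x + Dzd *v d + Dzw *v w)
      + p * ((Cv *v x + Dvd *v d + Dvw *v w) \<bullet> (Cv *v x + Dvd *v d + Dvw *v w))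
      + 2 * Y * ((Cv *v x + Dvd *v d + Dvw *v w) \<bullet> w) - \<gamma>\<^sup>2 * (d \<bullet> d) - X * (w \<bullet> w)
      \<le> - e * (x \<bullet> x + d \<bullet> d + w \<bullet> w)"
proof -
  define M1 :: "real ^ ('n + 1 + 1) ^ ('n + 'n)" where "M1 = (A ||| Bd ||| Bw) /// (mat 1 ||| 0  ||| 0)"
  define N1 :: "real ^ ('n + 'n) ^ ('n + 'n)" where "N1 = (0 ||| Q) /// (Q ||| 0)"
  define M2 :: "real ^ ('n + 1 + 1) ^ (1 + 1 + 1 + 1)" where
    "M2 = (Cz ||| Dzd  ||| Dzw) /// (Cv ||| Dvd  ||| Dvw) /// (0  ||| mat 1 ||| 0) /// (0  ||| 0     ||| mat 1)"
  define N2 :: "real ^ (1 + 1 + 1 + 1) ^ (1 + 1 + 1 + 1)" where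
    "N2 = (mat 1 ||| 0 ||| 0 ||| 0) /// (0 ||| mat p ||| 0 ||| mat Y) /// (0 ||| 0 ||| mat (- (\<gamma>\<^sup>2)) ||| 0) /// (0 ||| mat Y ||| 0 ||| mat (- X))"
  have "positive_definite (- (transpose M1 ** N1 ** M1 + transpose M2 ** N2 ** M2))"
    using assms(1) unfolding Let_def negative_definite_def M1_def N1_def M2_def N2_def .
  then obtain e where e: "0 < e" "\<And>\<xi>. e * (\<xi> \<bullet> \<xi>) \<le> \<xi> \<bullet> ((- (transpose M1 ** N1 ** M1 + transpose M2 ** N2 ** M2)) *v \<xi>)"
    using positive_definite_lower_bound by blast
  have neg: "(- M) *v y = - (M *v y)" for M :: "real ^ 'a ^ 'b" and y
    by (simp add: vec_eq_iff matrix_vector_mult_def sum_negf)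
  have Qs: "a \<bullet> (Q *v b) = b \<bullet> (Q *v a)" for a b
    using dot_lmul_matrix[of a Q b] Q by (simp add: inner_commute flip: transpose_matrix_vector)
  have "2 * ((A *v x + Bd *v d + Bw *v w) \<bullet> (Q *v x))
      + (Cz *v x + Dzd *v d + Dzw *v w) \<bullet> (Cz *v x + Dzd *v d + Dzw *v w)
      + p * ((Cv *v x + Dvd *v d + Dvw *v w) \<bullet> (Cv *v x + Dvd *v d + Dvw *v w))
      + 2 * Y * ((Cv *v x + Dvd *v d + Dvw *v w) \<bullet> w) - \<gamma>\<^sup>2 * (d \<bullet> d) - X * (w \<bullet> w)
      \<le> - e * (x \<bullet> x + d \<bullet> d + w \<bullet> w)" for x d w
  proof -
    define \<xi> where "\<xi> = vapp x (vapp d w)"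
    define f where "f = A *v x + Bd *v d + Bw *v w"
    define z where "z = Cz *v x + Dzd *v d + Dzw *v w"
    define v where "v = Cv *v x + Dvd *v d + Dvw *v w"
    have m1: "M1 *v \<xi> = vapp f x" by (simp add: M1_def \<xi>_def vcat_mult hcat_mult f_def add.assoc)
    have m2: "M2 *v \<xi> = vapp z (vapp v (vapp d w))" by (simp add: M2_def \<xi>_def vcat_mult hcat_mult z_def v_def add.assoc)
    have n1: "vapp f x \<bullet> (N1 *v vapp f x) = 2 * (f \<bullet> (Q *v x))"
      using Qs[of x f] by (simp add: N1_def vcat_mult hcat_mult inner_vapp)
    have n2: "vapp z (vapp v (vapp d w)) \<bullet> (N2 *v vapp z (vapp v (vapp d w)))
        = z \<bullet> z + p * (v \<bullet> v) + 2 * Y * (v \<bullet> w) - \<gamma>\<^sup>2 * (d \<bullet> d) - X * (w \<bullet> w)"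
      by (simp add: N2_def vcat_mult hcat_mult inner_vapp mat_mult_vec scalar_mult_eq_scaleR inner_add_right inner_commute[of w v] algebra_simps)
    have "e * (\<xi> \<bullet> \<xi>) \<le> - (vapp f x \<bullet> (N1 *v vapp f x) + vapp z (vapp v (vapp d w)) \<bullet> (N2 *v vapp z (vapp v (vapp d w))))"
      using e(2)[of \<xi>] unfolding neg matrix_vector_mult_add_rdistrib inner_minus_right inner_add_right quadratic_form_congruence m1 m2 .
    moreover have "\<xi> \<bullet> \<xi> = x \<bullet> x + d \<bullet> d + w \<bullet> w" by (simp add: \<xi>_def inner_vapp)
    ultimately show ?thesis unfolding n1 n2 f_def[symmetric] z_def[symmetric] v_def[symmetric] by simp
  qed
  then show ?thesis using that e(1) by blast
qed

section \<open>The nominal loop\<close>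

text \<open>The instant \<tau> is a null set, so the strict inequality may be used; it fits the
  half-open intervals of the hold.\<close>

lemma trunc_eq_iff:
  "truncation \<tau> f \<simeq> truncation \<tau> g \<longleftrightarrow> (AE t in lebesgue_on {0..}. t < \<tau> \<longrightarrow> f t = g t)"
proof -
  have "{\<tau>} \<in> null_sets lebesgue" by (simp flip: negligible_iff_null_sets)
  then have "AE t in lebesgue. t \<notin> {\<tau>}" by (rule AE_not_in)
  then have ne: "AE t in lebesgue_on {0..}. t \<noteq> \<tau>" by (subst AE_restrict_space_iff) auto
  show ?thesis
  proof
    assume "truncation \<tau> f \<simeq> truncation \<tau> g"
    then show "AE t in lebesgue_on {0..}. t < \<tau> \<longrightarrow> f t = g t"
      unfolding signal_eq_def by eventually_elim (auto simp: truncation_def)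
  next
    assume "AE t in lebesgue_on {0..}. t < \<tau> \<longrightarrow> f t = g t"
    then show "truncation \<tau> f \<simeq> truncation \<tau> g"
      unfolding signal_eq_def using ne by eventually_elim (auto simp: truncation_def)
  qed
qed

lemma AE_half_line: "AE t in lebesgue_on {0..}. (0::real) \<le> t"
  by (subst AE_restrict_space_iff) auto

text \<open>\<open>causal\<close> compares a signal with its own truncation; compatibility of
  \<open>M\<close> with null sets extends this to two signals that agree up to \<tau>.\<close>

lemma causal_local:
  assumes M: "L2e_operator M" "causal M" and u: "u \<in> L2e" "u' \<in> L2e" and \<tau>: "0 < \<tau>"
    and eq: "truncation \<tau> u \<simeq> truncation \<tau> u'"
  shows "truncation \<tau> (M u) \<simeq> truncation \<tau> (M u')"
proof -
  have t: "truncation \<tau> u \<in> L2e" "truncation \<tau> u' \<in> L2e" using u L2e_truncation_L2 L2_subset_L2e by auto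
  have "truncation \<tau> (M u) \<simeq> truncation \<tau> (M (truncation \<tau> u))" using M(2) u \<tau> by (simp add: causal_def signal_eq_sym)
  also have "\<dots> \<simeq> truncation \<tau> (M (truncation \<tau> u'))" using M(1) t eq by (intro signal_eq_truncation) (simp add: L2e_operator_def)
  also have "\<dots> \<simeq> truncation \<tau> (M u')" using M(2) u \<tau> by (simp add: causal_def)
  finally show ?thesis .
qed

lemma feedback_eqs_cong:
  assumes "feedback_eqs G \<Delta> d x" "d \<simeq> d'" shows "feedback_eqs G \<Delta> d' x"
proof -
  have "fst \<circ> x \<simeq> (\<lambda>t. \<Delta> (snd \<circ> x) t + fst (d t))" "snd \<circ> x \<simeq> (\<lambda>t. G (fst \<circ> x) t + snd (d t))"
    using assms(1) by (auto simp: feedback_eqs_def)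
  moreover have "(\<lambda>t. \<Delta> (snd \<circ> x) t + fst (d t)) \<simeq> (\<lambda>t. \<Delta> (snd \<circ> x) t + fst (d' t))"
    "(\<lambda>t. G (fst \<circ> x) t + snd (d t)) \<simeq> (\<lambda>t. G (fst \<circ> x) t + snd (d' t))"
    using signal_eq_comp[OF assms(2), of "\<lambda>t x. \<Delta> (snd \<circ> _) t + fst x"] signal_eq_comp[OF assms(2), of "\<lambda>t y. G (fst \<circ> x) t + snd y"]
      signal_eq_comp[OF assms(2), of "\<lambda>t y. \<Delta> (snd \<circ> x) t + fst y"] by auto
  ultimately show ?thesis unfolding feedback_eqs_def using signal_eq_trans by blast
qed

lemma well_posed_closed_loop:
  assumes "well_posed G \<Delta>" "d \<in> L2e"
  shows "closed_loop G \<Delta> d \<in> L2e" "feedback_eqs G \<Delta> d (closed_loop G \<Delta> d)"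
    "\<And>x. x \<in> L2e \<Longrightarrow> feedback_eqs G \<Delta> d x \<Longrightarrow> x \<simeq> closed_loop G \<Delta> d"
proof -
  obtain x0 where x0: "x0 \<in> L2e" "feedback_eqs G \<Delta> d x0" "\<And>x'. x' \<in> L2e \<Longrightarrow> feedback_eqs G \<Delta> d x' \<Longrightarrow> x' \<simeq> x0"
    using assms unfolding well_posed_def by blast
  have *: "closed_loop G \<Delta> d \<in> L2e \<and> feedback_eqs G \<Delta> d (closed_loop G \<Delta> d)"
    unfolding closed_loop_def by (rule someI[of _ x0]) (use x0 in simp)
  then show "closed_loop G \<Delta> d \<in> L2e" "feedback_eqs G \<Delta> d (closed_loop G \<Delta> d)" by auto
  show "x \<simeq> closed_loop G \<Delta> d" if "x \<in> L2e" "feedback_eqs G \<Delta> d x" for x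
    using * by (intro signal_eq_trans[OF x0(3)[OF that] signal_eq_sym[OF x0(3)]]) auto
qed

text \<open>As \<open>causal_local\<close>, but compatibility of the closed-loop map with null sets
  comes from uniqueness of solutions: equivalent inputs satisfy the same feedback equations.\<close>

lemma well_posed_local:
  assumes wp: "well_posed G \<Delta>" and d: "d \<in> L2e" "d' \<in> L2e" and \<tau>: "0 < \<tau>"
    and eq: "truncation \<tau> d \<simeq> truncation \<tau> d'"
    and x: "x \<in> L2e" "feedback_eqs G \<Delta> d x" and x': "x' \<in> L2e" "feedback_eqs G \<Delta> d' x'"
  shows "truncation \<tau> x \<simeq> truncation \<tau> x'"
proof -
  let ?c = "closed_loop G \<Delta>"
  have caus: "truncation \<tau> (?c (truncation \<tau> d)) \<simeq> truncation \<tau> (?c d)" if "d \<in> L2e" for d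
    using wp \<tau> that by (simp add: well_posed_def causal_def)
  have t: "truncation \<tau> d \<in> L2e" "truncation \<tau> d' \<in> L2e" using d L2e_truncation_L2 L2_subset_L2e by auto
  have "?c (truncation \<tau> d) \<simeq> ?c (truncation \<tau> d')"
    by (rule well_posed_closed_loop(3)[OF wp t(2) well_posed_closed_loop(1)[OF wp t(1)]
          feedback_eqs_cong[OF well_posed_closed_loop(2)[OF wp t(1)] eq]])
  then have c: "truncation \<tau> (?c (truncation \<tau> d)) \<simeq> truncation \<tau> (?c (truncation \<tau> d'))" by (rule signal_eq_truncation)
  have "truncation \<tau> x \<simeq> truncation \<tau> (?c d)" by (rule signal_eq_truncation[OF well_posed_closed_loop(3)[OF wp d(1) x]])
  also have "\<dots> \<simeq> truncation \<tau> (?c (truncation \<tau> d))" by (rule signal_eq_sym[OF caus[OF d(1)]])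
  also note c
  also have "truncation \<tau> (?c (truncation \<tau> d')) \<simeq> truncation \<tau> (?c d')" by (rule caus[OF d(2)])
  also have "\<dots> \<simeq> truncation \<tau> x'" by (rule signal_eq_sym[OF signal_eq_truncation[OF well_posed_closed_loop(3)[OF wp d(2) x']]])
  finally show ?thesis .
qed

text \<open>The filter \<open>1 / (s + 1)\<close> on real signals; the pole -1 is a convenient
  choice. It produces smoother test signals with an explicit derivative.\<close>

lemma real_first_order_lag:
  fixes f :: "real \<Rightarrow> real"
  assumes f: "f \<in> L2"
  obtains e where "e \<in> L2" "continuous_on {0..} e" "\<And>t. 0 \<le> t \<Longrightarrow> e t = integral {0..t} (\<lambda>s. f s - e s)"
    "has_laplace e (\<lambda>s. rlap f s / (s + 1))"
proof -
  have fc: "(\<lambda>t. complex_of_real (f t)) \<in> L2"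
    using L2_linear[OF f bounded_linear_of_real[where 'a=complex], of 1] by simp
  obtain z where z: "z \<in> L2" "continuous_on {0..} z"
    "\<And>t. 0 \<le> t \<Longrightarrow> z t = integral {0..t} (\<lambda>s. - 1 * z s + complex_of_real (f s))"
    "has_laplace z (\<lambda>s. 1 / (of_real s - (- 1)) * rlap (\<lambda>t. complex_of_real (f t)) s)"
    by (rule first_order_lag[of "- 1" "\<lambda>t. complex_of_real (f t)"]) (use fc in auto)
  define e where "e t = Re (z t)" for t
  have e: "e \<in> L2" using L2_linear[OF z(1) bounded_linear_Re, of 1] by (auto simp: e_def[abs_def] abs_Re_le_cmod)
  have le: "z \<in> L2e" "(\<lambda>t. complex_of_real (f t)) \<in> L2e" using z(1) fc L2_subset_L2e by auto
  have "e t = integral {0..t} (\<lambda>s. f s - e s)" if t: "0 \<le> t" for t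
  proof -
    have i: "(\<lambda>s. - 1 * z s + complex_of_real (f s)) integrable_on {0..t}"
      using le by (intro abs_int_imp_int L2e_abs_int L2e_add L2e_linear[OF le(1) bounded_linear_mult_right]) auto
    have "e t = integral {0..t} (\<lambda>s. Re (- 1 * z s + complex_of_real (f s)))"
      using integral_linear[OF i bounded_linear_Re] z(3)[OF t] by (simp add: e_def o_def)
    then show ?thesis by (simp add: e_def algebra_simps)
  qed
  moreover have "has_laplace e (\<lambda>s. rlap f s / (s + 1))"
  proof (rule has_laplace_cong[OF has_laplace_linear[OF z(4) bounded_linear_Re, folded e_def]])
    have "\<forall>\<^sub>F s in at_top. rlap (\<lambda>t. complex_of_real (f t)) s = of_real (rlap f s)"
      by (rule has_laplace_unique_ev[OF L2_has_laplace[OF fc] has_laplace_linear[OF L2_has_laplace[OF f] bounded_linear_of_real]])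
    then show "\<forall>\<^sub>F s in at_top. Re (1 / (of_real s - (- 1)) * rlap (\<lambda>t. complex_of_real (f t)) s) = rlap f s / (s + 1)"
    proof eventually_elim
      case (elim s)
      have "1 / (complex_of_real s - (- 1)) * complex_of_real (rlap f s) = complex_of_real (rlap f s / (s + 1))" by simp
      then show ?case unfolding elim by (simp only: Re_complex_of_real)
    qed
  qed
  moreover have "continuous_on {0..} e" unfolding e_def by (intro continuous_intros z(2))
  ultimately show ?thesis using that e by blast
qed

lemma transfer_matrix_has_laplace:
  assumes M: "has_transfer_matrix M H" and u: "u \<in> L2"
  shows "has_laplace (fst \<circ> M u) (\<lambda>s. Re (H (of_real s) $ Inl 1 $ Inl 1) * rlap (fst \<circ> u) s + Re (H (of_real s) $ Inl 1 $ Inr 1) * rlap (snd \<circ> u) s)"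
    and "has_laplace (snd \<circ> M u) (\<lambda>s. Re (H (of_real s) $ Inr 1 $ Inl 1) * rlap (fst \<circ> u) s + Re (H (of_real s) $ Inr 1 $ Inr 1) * rlap (snd \<circ> u) s)"
proof -
  obtain \<sigma> where \<sigma>: "\<sigma> \<ge> 0" "\<And>s. Re s > \<sigma> \<Longrightarrow> integrable (lebesgue_on {0..}) (laplace_integrand (fst \<circ> M u) s)"
    "\<And>s. Re s > \<sigma> \<Longrightarrow> integrable (lebesgue_on {0..}) (laplace_integrand (snd \<circ> M u) s)"
    "\<And>s. Re s > \<sigma> \<Longrightarrow> laplace_pair (M u) s = H s *v laplace_pair u s"
    using M u unfolding has_transfer_matrix_def by blast
  have u12: "fst \<circ> u \<in> L2" "snd \<circ> u \<in> L2" using u by (auto simp: L2_pair(1))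
  have main: "lap_at (fst \<circ> M u) s \<and> lap_at (snd \<circ> M u) s \<and>
      rlap (fst \<circ> M u) s = Re (H (of_real s) $ Inl 1 $ Inl 1) * rlap (fst \<circ> u) s + Re (H (of_real s) $ Inl 1 $ Inr 1) * rlap (snd \<circ> u) s \<and>
      rlap (snd \<circ> M u) s = Re (H (of_real s) $ Inr 1 $ Inl 1) * rlap (fst \<circ> u) s + Re (H (of_real s) $ Inr 1 $ Inr 1) * rlap (snd \<circ> u) s"
    if s: "s > \<sigma>" for s
  proof -
    have l: "lap_at (fst \<circ> M u) s" "lap_at (snd \<circ> M u) s" using \<sigma>(2,3)[of "of_real s"] s by (simp_all add: laplace_of_real(1))
    have lu: "lap_at (fst \<circ> u) s" "lap_at (snd \<circ> u) s" using L2_lap_at[OF u12(1)] L2_lap_at[OF u12(2)] s \<sigma>(1) by auto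
    have eq: "laplace_pair (M u) (of_real s) $ i = (H (of_real s) *v laplace_pair u (of_real s)) $ i" for i
      using \<sigma>(4)[of "of_real s"] s by simp
    have "Re (laplace_pair (M u) (of_real s) $ i) = Re (H (of_real s) $ i $ Inl 1) * rlap (fst \<circ> u) s + Re (H (of_real s) $ i $ Inr 1) * rlap (snd \<circ> u) s" for i
      unfolding eq by (simp add: matrix_vector_mult_def sum_UNIV_sum sum_1 laplace_pair_def laplace_of_real(2)[OF lu(1)] laplace_of_real(2)[OF lu(2)])
    from this[of "Inl 1"] this[of "Inr 1"] show ?thesis
      using l by (simp add: laplace_pair_def laplace_of_real(2)[OF l(1)] laplace_of_real(2)[OF l(2)])
  qed
  show "has_laplace (fst \<circ> M u) (\<lambda>s. Re (H (of_real s) $ Inl 1 $ Inl 1) * rlap (fst \<circ> u) s + Re (H (of_real s) $ Inl 1 $ Inr 1) * rlap (snd \<circ> u) s)"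
    "has_laplace (snd \<circ> M u) (\<lambda>s. Re (H (of_real s) $ Inr 1 $ Inl 1) * rlap (fst \<circ> u) s + Re (H (of_real s) $ Inr 1 $ Inr 1) * rlap (snd \<circ> u) s)"
    using main by (auto intro!: has_laplaceI[of \<sigma>])
qed

section \<open>Locality and transforms in the stable nominal loop\<close>

locale filtered_loop =
  fixes P F :: "(real \<Rightarrow> real) \<Rightarrow> real \<Rightarrow> real" and P_tf F_tf :: "complex \<Rightarrow> complex"
  assumes P: "lti_system P P_tf" and F: "stable_low_pass F F_tf"
    and loop: "stable_interconnection P (neg_op F)"
begin

lemma P_op: "L2e_operator P" "causal P" "has_transfer_function P P_tf"
  and F_op: "L2e_operator F" "causal F" "has_transfer_function F F_tf" "bounded_operator F" 
  and F_right_continuous: "\<And>y t. y \<in> L2e \<Longrightarrow> 0 \<le> t \<Longrightarrow> continuous (at_right t) (F y)"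
  using P F unfolding stable_low_pass_def lti_system_def stable_operator_def by auto

lemma P_L2e: "u \<in> L2e \<Longrightarrow> P u \<in> L2e" and F_L2e: "u \<in> L2e \<Longrightarrow> F u \<in> L2e"
  using P_op(1) F_op(1) by (auto simp: L2e_operator_def)

lemma F_L2: "u \<in> L2 \<Longrightarrow> F u \<in> L2" using F_op(4) by (auto simp: bounded_operator_def)

lemma F_local_less:
  assumes y: "y \<in> L2e" "y' \<in> L2e" and t: "0 \<le> t" "t < \<tau>" and eq: "truncation \<tau> y \<simeq> truncation \<tau> y'"
  shows "F y t = F y' t"
  using t causal_local[OF F_op(1,2) y _ eq] F_right_continuous y
  by (intro right_continuous_eq[of \<tau>]) auto

text \<open>Up to any finite time \<open>F y\<close> agrees with the response to a truncated input
  in \<open>L2\<close>, and that response is an indefinite integral starting at 0.\<close>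

lemma F_continuous_zero:
  assumes y: "y \<in> L2e" shows "continuous_on {0..} (F y)" "F y 0 = 0"
proof -
  obtain K C where K: "\<And>y. y \<in> L2 \<Longrightarrow> K y \<in> L2" "\<And>y t. y \<in> L2 \<Longrightarrow> 0 \<le> t \<Longrightarrow> F y t = integral {0..t} (K y)"
    using low_pass_output_integral[OF F] by metis
  have eq: "F y t = integral {0..t} (K (truncation \<tau> y))" if "0 \<le> t" "t < \<tau>" for t \<tau>
  proof -
    have "truncation \<tau> y \<simeq> truncation \<tau> (truncation \<tau> y)" by (simp add: truncation_truncation)
    then have "F y t = F (truncation \<tau> y) t"
      using that y L2e_truncation_L2[OF y] L2_subset_L2e by (intro F_local_less) auto
    then show ?thesis using K(2) L2e_truncation_L2[OF y] that by simp
  qed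
  show "F y 0 = 0" using eq[of 0 1] by simp
  show "continuous_on {0..} (F y)"
  proof (rule continuous_on_halfline)
    fix T :: real assume "0 < T"
    have "K (truncation (T + 1) y) \<in> L2e" using K(1) L2e_truncation_L2[OF y] L2_subset_L2e by auto
    then have "continuous_on {0..T} (\<lambda>t. integral {0..t} (K (truncation (T + 1) y)))"
      by (rule continuous_on_subset[OF continuous_on_L2e_integral]) auto
    then show "continuous_on {0..T} (F y)" by (rule continuous_on_eq) (simp add: eq[of _ "T + 1"])
  qed
qed

text \<open>Left continuity adds the closing instant \<tau> to \<open>F_local_less\<close>. It
  matters because a sample may be taken at the event \<open>Ts k\<close> itself, when the loop is
  known only up to \<open>Ts k\<close>.\<close>

lemma F_local:
  assumes y: "y \<in> L2e" "y' \<in> L2e" and t: "0 \<le> t" "t \<le> \<tau>" and eq: "truncation \<tau> y \<simeq> truncation \<tau> y'"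
  shows "F y t = F y' t"
proof (cases "t = 0 \<or> t < \<tau>")
  case True
  then show ?thesis using F_continuous_zero(2) y F_local_less[OF y t(1) _ eq] by auto
next
  case False
  then have t': "t = \<tau>" "0 < \<tau>" using t by auto
  have lim: "((F z) \<longlongrightarrow> F z \<tau>) (at_left \<tau>)" if "z \<in> L2e" for z
  proof -
    have "continuous (at \<tau> within {0..}) (F z)"
      using F_continuous_zero(1)[OF that] t'(2) by (auto simp: continuous_on_eq_continuous_within)
    then have "continuous (at \<tau> within {0..\<tau>}) (F z)" by (rule continuous_within_subset) auto
    then show ?thesis using at_within_Icc_at_left[OF t'(2)] by (simp add: continuous_within)
  qed
  have "\<forall>\<^sub>F s in at_left \<tau>. F y s = F y' s"
    using eventually_at_left_real[OF t'(2)] by eventually_elim (use F_local_less[OF y _ _ eq] in auto)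
  then have "((F y) \<longlongrightarrow> F y' \<tau>) (at_left \<tau>)" using lim[OF y(2)] tendsto_cong by blast
  then show ?thesis using lim[OF y(1)] tendsto_unique[of "at_left \<tau>"] t'(1) by simp
qed

lemma base_loop: "well_posed P (neg_op F)" "bounded_operator (closed_loop P (neg_op F))"
  using loop by (auto simp: stable_interconnection_def)

text \<open>At real arguments the transforms of real signals are real, so the real part of the
  transfer function suffices.\<close>

definition Fr :: "real \<Rightarrow> real" where "Fr s = Re (F_tf (of_real s))"
definition Pr :: "real \<Rightarrow> real" where "Pr s = Re (P_tf (of_real s))"

lemma P_laplace: "u \<in> L2 \<Longrightarrow> has_laplace (P u) (\<lambda>s. Pr s * rlap u s)"
  and F_laplace: "u \<in> L2 \<Longrightarrow> has_laplace (F u) (\<lambda>s. Fr s * rlap u s)"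
  unfolding Pr_def Fr_def by (auto intro: transfer_function_has_laplace P_op F_op)

lemma base_loop_laplace:
  assumes d: "d \<in> L2" and x: "x \<in> L2" "feedback_eqs P (neg_op F) d x"
  shows "\<forall>\<^sub>F s in at_top. rlap (fst \<circ> x) s = rlap (fst \<circ> d) s - Fr s * rlap (snd \<circ> x) s"
    "\<forall>\<^sub>F s in at_top. rlap (snd \<circ> x) s = Pr s * rlap (fst \<circ> x) s + rlap (snd \<circ> d) s"
proof -
  have L: "fst \<circ> d \<in> L2" "snd \<circ> d \<in> L2" "fst \<circ> x \<in> L2" "snd \<circ> x \<in> L2" using d x(1) by (auto simp: L2_pair(1))
  have eqs: "fst \<circ> x \<simeq> (\<lambda>t. (fst \<circ> d) t - F (snd \<circ> x) t)" "snd \<circ> x \<simeq> (\<lambda>t. P (fst \<circ> x) t + (snd \<circ> d) t)"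
    using x(2) by (auto simp: feedback_eqs_def neg_op_def)
  have "has_laplace (fst \<circ> x) (\<lambda>s. rlap (fst \<circ> d) s - Fr s * rlap (snd \<circ> x) s)"
    by (rule has_laplace_signal_eq[OF has_laplace_diff[OF L2_has_laplace[OF L(1)] F_laplace[OF L(4)]] signal_eq_sym[OF eqs(1)]])
  then show "\<forall>\<^sub>F s in at_top. rlap (fst \<circ> x) s = rlap (fst \<circ> d) s - Fr s * rlap (snd \<circ> x) s"
    by (rule has_laplace_unique_ev[OF L2_has_laplace[OF L(3)]])
  have "has_laplace (snd \<circ> x) (\<lambda>s. Pr s * rlap (fst \<circ> x) s + rlap (snd \<circ> d) s)"
    by (rule has_laplace_signal_eq[OF has_laplace_add[OF P_laplace[OF L(3)] L2_has_laplace[OF L(2)]] signal_eq_sym[OF eqs(2)]])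
  then show "\<forall>\<^sub>F s in at_top. rlap (snd \<circ> x) s = Pr s * rlap (fst \<circ> x) s + rlap (snd \<circ> d) s"
    by (rule has_laplace_unique_ev[OF L2_has_laplace[OF L(4)]])
qed

lemma base_loop_single:
  assumes f: "f \<in> L2"
  defines "x \<equiv> closed_loop P (neg_op F) (\<lambda>t. (f t, 0))"
  shows "x \<in> L2" "fst \<circ> x \<in> L2" "snd \<circ> x \<in> L2"
    "\<forall>\<^sub>F s in at_top. (1 + Fr s * Pr s) * rlap (fst \<circ> x) s = rlap f s"
    "\<forall>\<^sub>F s in at_top. rlap (snd \<circ> x) s = Pr s * rlap (fst \<circ> x) s"
proof -
  have d: "(\<lambda>t. (f t, 0::real)) \<in> L2" using f L2_zero by (simp add: L2_pair(1) o_def)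
  then have de: "(\<lambda>t. (f t, 0::real)) \<in> L2e" using L2_subset_L2e by auto
  show x: "x \<in> L2" using base_loop(2) d by (auto simp: x_def bounded_operator_def)
  then show "fst \<circ> x \<in> L2" "snd \<circ> x \<in> L2" by (auto simp: L2_pair(1))
  have eqs: "feedback_eqs P (neg_op F) (\<lambda>t. (f t, 0)) x"
    unfolding x_def by (rule well_posed_closed_loop(2)[OF base_loop(1) de])
  have z: "rlap (\<lambda>t. 0::real) s = 0" for s by (simp add: rlap_def)
  have l: "\<forall>\<^sub>F s in at_top. rlap (fst \<circ> x) s = rlap f s - Fr s * rlap (snd \<circ> x) s"
    "\<forall>\<^sub>F s in at_top. rlap (snd \<circ> x) s = Pr s * rlap (fst \<circ> x) s"
    using base_loop_laplace[OF d x eqs] by (simp_all add: o_def z)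
  show "\<forall>\<^sub>F s in at_top. rlap (snd \<circ> x) s = Pr s * rlap (fst \<circ> x) s" by (rule l(2))
  show "\<forall>\<^sub>F s in at_top. (1 + Fr s * Pr s) * rlap (fst \<circ> x) s = rlap f s"
    using l by eventually_elim (simp add: algebra_simps)
qed

text \<open>
  A single test input identifies the transfer matrix of the generalized plant. It is smooth enough
  for the derivative of the filtered output to exist at every positive time.
\<close>
lemma generalized_plant_transfer:
  assumes M: "has_transfer_matrix (generalized_plant F P F) H"
  shows "\<forall>\<^sub>F s in at_top. 1 + Fr s * Pr s \<noteq> 0 \<and>
      (1 + Fr s * Pr s) * Re (H (of_real s) $ Inl 1 $ Inl 1) = Fr s \<and>
      (1 + Fr s * Pr s) * Re (H (of_real s) $ Inl 1 $ Inr 1) = Fr s \<and>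
      (1 + Fr s * Pr s) * Re (H (of_real s) $ Inr 1 $ Inl 1) = s * (Fr s * Pr s) \<and>
      (1 + Fr s * Pr s) * Re (H (of_real s) $ Inr 1 $ Inr 1) = s * (Fr s * Pr s)"
proof -
  define f0 :: "real \<Rightarrow> real" where "f0 t = exp (- t)" for t
  have f0: "f0 \<in> L2"
  proof -
    have "f0 \<in> L2e" unfolding f0_def by (intro L2e_continuous continuous_intros)
    moreover have "(\<lambda>t. (norm (f0 t))\<^sup>2) = (\<lambda>t. exp (- 2 * t))" by (auto simp: f0_def fun_eq_iff power2_eq_square mult_exp_exp)
    moreover have "(\<lambda>t. exp (- 2 * t) :: real) absolutely_integrable_on {0..}"
      by (intro nonnegative_absolutely_integrable_1 integrable_on_exp_minus_to_infinity) auto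
    ultimately show ?thesis by (simp add: L2_iff L2e_measurable)
  qed
  have lf0: "rlap f0 s = 1 / (s + 1)" if "s > 0" for s
  proof -
    have "rlap f0 s = integral {0..} (\<lambda>t. exp (- (s + 1) * t))"
      unfolding rlap_def f0_def by (rule HK_integral_cong) (simp add: mult_exp_exp algebra_simps)
    also have "\<dots> = exp (- (s + 1) * 0) / (s + 1)" using has_integral_exp_minus_to_infinity[of "s + 1" 0] that by (intro integral_unique) auto
    finally show ?thesis by simp
  qed
  define x0 where "x0 = closed_loop P (neg_op F) (\<lambda>t. (f0 t, 0))"
  note b0 = base_loop_single[OF f0, folded x0_def]
  \<comment> \<open>Filtering the input by \<open>1 / (s + 1)\<close> filters every signal of the
    loop likewise. Hence \<open>F (snd \<circ> x1)\<close> is the lag \<open>e\<close> of the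
    continuous signal \<open>g0\<close>, with derivative \<open>g0 t - e t\<close> at every positive
    time.\<close>
  obtain f1 where f1: "f1 \<in> L2" "has_laplace f1 (\<lambda>s. rlap f0 s / (s + 1))" using real_first_order_lag[OF f0] by blast
  define x1 where "x1 = closed_loop P (neg_op F) (\<lambda>t. (f1 t, 0))"
  note b1 = base_loop_single[OF f1(1), folded x1_def]
  define g0 where "g0 = F (snd \<circ> x0)"
  have g0: "g0 \<in> L2" unfolding g0_def by (rule F_L2[OF b0(3)])
  have g0c: "continuous_on {0..} g0" unfolding g0_def using b0(3) L2_subset_L2e by (intro F_continuous_zero(1)) auto
  obtain e where e: "e \<in> L2" "continuous_on {0..} e" "\<And>t. 0 \<le> t \<Longrightarrow> e t = integral {0..t} (\<lambda>s. g0 s - e s)"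
    "has_laplace e (\<lambda>s. rlap g0 s / (s + 1))" using real_first_order_lag[OF g0] by blast
  have lf1: "\<forall>\<^sub>F s in at_top. rlap f1 s = rlap f0 s / (s + 1)" by (rule has_laplace_unique_ev[OF L2_has_laplace[OF f1(1)] f1(2)])
  have lg0: "\<forall>\<^sub>F s in at_top. rlap g0 s = Fr s * rlap (snd \<circ> x0) s"
    by (rule has_laplace_unique_ev[OF L2_has_laplace[OF g0]]) (simp add: g0_def F_laplace b0(3))
  \<comment> \<open>\<open>1 + Fr s * Pr s\<close> times the transform of the bounded response is
    \<open>1 / (s + 1)\<close>, so stability of the nominal loop keeps this factor from vanishing
    for large \<open>s\<close>.\<close>
  have D: "\<forall>\<^sub>F s in at_top. 1 + Fr s * Pr s \<noteq> 0 \<and> rlap f0 s = 1 / (s + 1) \<and> rlap f1 s \<noteq> 0 \<and> s > 0"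
    using b0(4) lf1 eventually_gt_at_top[of 0] by eventually_elim (auto simp: lf0)
  have l1: "\<forall>\<^sub>F s in at_top. rlap (fst \<circ> x1) s = rlap (fst \<circ> x0) s / (s + 1) \<and> rlap (snd \<circ> x1) s = rlap (snd \<circ> x0) s / (s + 1)"
    using b0(4) b0(5) b1(4) b1(5) lf1 D
  proof eventually_elim
    case (elim s)
    have "(1 + Fr s * Pr s) * rlap (fst \<circ> x1) s = (1 + Fr s * Pr s) * (rlap (fst \<circ> x0) s / (s + 1))"
      using elim by simp
    moreover have "1 + Fr s * Pr s \<noteq> 0" using elim by blast
    ultimately have "rlap (fst \<circ> x1) s = rlap (fst \<circ> x0) s / (s + 1)" by (metis mult_left_cancel)
    then show ?case using elim by simp
  qed
  have "has_laplace (F (snd \<circ> x1)) (\<lambda>s. rlap g0 s / (s + 1))"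
    by (rule has_laplace_cong[OF F_laplace[OF b1(3)]]) (use l1 lg0 in eventually_elim, simp)
  from laplace_unique[OF this e(4)] have Fe: "F (snd \<circ> x1) \<simeq> e" .
  have x1e: "snd \<circ> x1 \<in> L2e" using b1(3) L2_subset_L2e by auto
  have Fe': "F (snd \<circ> x1) t = e t" if "0 \<le> t" for t
    using that F_right_continuous[OF x1e] continuous_on_halfline_at_right[OF e(2)]
    by (intro right_continuous_eq[OF signal_eq_truncation[OF Fe, of "t + 1"]]) auto
  have der: "deriv (F (snd \<circ> x1)) t = g0 t - e t" if t: "0 < t" for t
  proof -
    have c: "continuous_on {0..t + 1} (\<lambda>s. g0 s - e s)"
      by (intro continuous_intros continuous_on_subset[OF g0c] continuous_on_subset[OF e(2)]) auto
    have "((\<lambda>r. integral {0..r} (\<lambda>s. g0 s - e s)) has_real_derivative (g0 t - e t)) (at t within {0..t + 1})"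
      by (rule integral_has_real_derivative[OF c]) (use t in auto)
    then have dd: "((\<lambda>r. integral {0..r} (\<lambda>s. g0 s - e s)) has_real_derivative (g0 t - e t)) (at t)"
      using at_within_Icc_at[of 0 t "t + 1"] t by simp
    have ev: "\<forall>\<^sub>F r in nhds t. integral {0..r} (\<lambda>s. g0 s - e s) = F (snd \<circ> x1) r"
      using eventually_nhds_in_open[of "{0<..}" t] t by (auto elim!: eventually_mono simp: Fe' e(3)[symmetric])
    have "((F (snd \<circ> x1)) has_real_derivative (g0 t - e t)) (at t)"
      using dd unfolding DERIV_cong_ev[OF refl ev refl] .
    then show ?thesis by (rule DERIV_imp_deriv)
  qed
  have dl: "has_laplace (differentiate (F (snd \<circ> x1))) (\<lambda>s. rlap g0 s - rlap g0 s / (s + 1))"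
  proof (rule has_laplace_signal_eq[OF has_laplace_diff[OF L2_has_laplace[OF g0] e(4)]])
    show "(\<lambda>t. g0 t - e t) \<simeq> differentiate (F (snd \<circ> x1))"
      unfolding signal_eq_negligible
      by (rule negligible_subset[of "{0}"]) (auto simp: differentiate_def, metis der less_le)
  qed
  have zl: "has_laplace (F (fst \<circ> x1)) (\<lambda>s. Fr s * rlap (fst \<circ> x1) s)" by (rule F_laplace[OF b1(2)])
  \<comment> \<open>The generalized plant depends only on the sum of \<open>d\<close> and
    \<open>w\<close>; the inputs \<open>(f1, 0)\<close> and \<open>(0, f1)\<close>, one for each
    column of \<open>H\<close>, give the same output.\<close>
  have u1: "(\<lambda>t. (f1 t, 0::real)) \<in> L2" "(\<lambda>t. (0::real, f1 t)) \<in> L2" using f1(1) L2_zero[where 'a = real] by (simp_all add: L2_pair(1) o_def)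
  have gp: "generalized_plant F P F (\<lambda>t. (f1 t, 0)) = (\<lambda>t. (F (fst \<circ> x1) t, differentiate (F (snd \<circ> x1)) t))"
    "generalized_plant F P F (\<lambda>t. (0, f1 t)) = (\<lambda>t. (F (fst \<circ> x1) t, differentiate (F (snd \<circ> x1)) t))"
    by (simp_all add: generalized_plant_def x1_def Let_def)
  have rz: "rlap (\<lambda>t. 0::real) s = 0" for s by (simp add: rlap_def)
  note t1 = transfer_matrix_has_laplace[OF M u1(1), unfolded gp o_def fst_conv snd_conv rz, folded o_def]
  note t2 = transfer_matrix_has_laplace[OF M u1(2), unfolded gp o_def fst_conv snd_conv rz, folded o_def]
  have eta: "(\<lambda>x. F y x) = F y" "(\<lambda>x. differentiate y x) = differentiate y" for y by auto
  have E: "\<forall>\<^sub>F s in at_top. Re (H (of_real s) $ Inl 1 $ Inl 1) * rlap f1 s = Fr s * rlap (fst \<circ> x1) s"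
    "\<forall>\<^sub>F s in at_top. Re (H (of_real s) $ Inr 1 $ Inl 1) * rlap f1 s = rlap g0 s - rlap g0 s / (s + 1)"
    "\<forall>\<^sub>F s in at_top. Re (H (of_real s) $ Inl 1 $ Inr 1) * rlap f1 s = Fr s * rlap (fst \<circ> x1) s"
    "\<forall>\<^sub>F s in at_top. Re (H (of_real s) $ Inr 1 $ Inr 1) * rlap f1 s = rlap g0 s - rlap g0 s / (s + 1)"
    using has_laplace_unique_ev[OF t1(1) zl] has_laplace_unique_ev[OF t1(2) dl]
      has_laplace_unique_ev[OF t2(1) zl] has_laplace_unique_ev[OF t2(2) dl]
    by (simp_all add: o_def)
  show ?thesis using E D l1 lg0 b1(4) b1(5)
  proof eventually_elim
    case (elim s)
    have s: "s + 1 \<noteq> 0" using elim by simp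
    have g: "rlap g0 s - rlap g0 s / (s + 1) = s * (Fr s * rlap (snd \<circ> x1) s)"
    proof -
      have "rlap g0 s - rlap g0 s / (s + 1) = s * (rlap g0 s / (s + 1))" using s by (simp add: field_simps)
      moreover have "rlap (snd \<circ> x1) s = rlap (snd \<circ> x0) s / (s + 1)" "rlap g0 s = Fr s * rlap (snd \<circ> x0) s"
        using elim by blast+
      ultimately show ?thesis by simp
    qed
    have key: "(1 + Fr s * Pr s) * r = c" if "r * rlap f1 s = c * rlap (fst \<circ> x1) s" for r c
    proof -
      have "((1 + Fr s * Pr s) * r) * rlap f1 s = (1 + Fr s * Pr s) * (c * rlap (fst \<circ> x1) s)" using that by simp
      also have "\<dots> = c * rlap f1 s" using elim by (metis mult.left_commute)
      finally show ?thesis using elim by simp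
    qed
    have "(1 + Fr s * Pr s) * Re (H (of_real s) $ Inr 1 $ j) = s * (Fr s * Pr s)"
      if "Re (H (of_real s) $ Inr 1 $ j) * rlap f1 s = rlap g0 s - rlap g0 s / (s + 1)" for j
    proof (rule key)
      have "rlap (snd \<circ> x1) s = Pr s * rlap (fst \<circ> x1) s" using elim by blast
      then show "Re (H (of_real s) $ Inr 1 $ j) * rlap f1 s = s * (Fr s * Pr s) * rlap (fst \<circ> x1) s"
        unfolding that g by simp
    qed
    then show ?case using elim key by blast
  qed
qed

end

section \<open>Dissipation\<close>

lemma L2_bounded_linear:
  fixes f :: "real \<Rightarrow> 'a::euclidean_space" and L :: "'a \<Rightarrow> 'b::euclidean_space"
  assumes "f \<in> L2" "bounded_linear L" shows "(\<lambda>t. L (f t)) \<in> L2"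
  using L2_linear(1)[OF assms onorm[OF assms(2)]] .

lemma bounded_linear_mult_vec1: "bounded_linear (\<lambda>r. B *v (vec r :: real ^ 1))" for B :: "real ^ 1 ^ 'n"
  by (rule linear_conv_bounded_linear[THEN iffD1], rule linearI)
    (simp_all add: vec_eq_iff matrix_vector_mult_def sum_1 algebra_simps)

lemma bounded_linear_mult_vec1_nth: "bounded_linear (\<lambda>r. (B *v (vec r :: real ^ 1)) $ i)" for B :: "real ^ 1 ^ 'n"
  by (rule bounded_linear_compose[OF bounded_linear_vec_nth bounded_linear_mult_vec1])

lemma bounded_linear_mult_nth: "bounded_linear (\<lambda>x. (C *v x) $ i)" for C :: "real ^ 'n ^ 'm"
  by (rule bounded_linear_compose[OF bounded_linear_vec_nth matrix_vector_mul_bounded_linear])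

text \<open>The realization is driven from the zero state. Only the transforms of its outputs are
  matched with \<open>H\<close>; the outputs are identified with signals of the loop later, through
  \<open>laplace_unique\<close>.\<close>

lemma state_space_realization:
  fixes A :: "real ^ 'n ^ 'n" and Bd Bw :: "real ^ 1 ^ 'n" and Cz Cv :: "real ^ 'n ^ 1"
    and Dzd Dzw Dvd Dvw :: "real ^ 1 ^ 1" and d w :: "real \<Rightarrow> real"
  defines "H \<equiv> state_space_transfer A (Bd ||| Bw) (Cz /// Cv) ((Dzd ||| Dzw) /// (Dvd ||| Dvw))"
  assumes A: "hurwitz A" and d: "d \<in> L2" and w: "w \<in> L2"
  obtains x where "continuous_on {0..} x"
    "\<And>t. 0 \<le> t \<Longrightarrow> x t = integral {0..t} (\<lambda>s. A *v x s + Bd *v vec (d s) + Bw *v vec (w s))"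
    "has_laplace (\<lambda>t. (Cz *v x t + Dzd *v vec (d t) + Dzw *v vec (w t)) $ 1)
       (\<lambda>s. Re (H (of_real s) $ Inl 1 $ Inl 1) * rlap d s + Re (H (of_real s) $ Inl 1 $ Inr 1) * rlap w s)"
    "has_laplace (\<lambda>t. (Cv *v x t + Dvd *v vec (d t) + Dvw *v vec (w t)) $ 1)
       (\<lambda>s. Re (H (of_real s) $ Inr 1 $ Inl 1) * rlap d s + Re (H (of_real s) $ Inr 1 $ Inr 1) * rlap w s)"
proof -
  have bA: "bounded_linear (\<lambda>x. A *v x)" by (rule matrix_vector_mul_bounded_linear)
  define f where "f t = Bd *v vec (d t) + Bw *v vec (w t)" for t
  have f: "f \<in> L2" unfolding f_def
    by (rule L2_add(1)[OF L2_bounded_linear[OF d bounded_linear_mult_vec1] L2_bounded_linear[OF w bounded_linear_mult_vec1]])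
  obtain x where x: "continuous_on {0..} x" "\<And>t. 0 \<le> t \<Longrightarrow> x t = integral {0..t} (\<lambda>s. A *v x s + f s)" "\<exists>s0. \<forall>s>s0. lap_at x s"
    using linear_ode_exists[OF bA f] by blast
  have lx: "has_laplace x (rlap x)" "\<forall>\<^sub>F s in at_top. s *\<^sub>R rlap x s = A *v rlap x s + rlap f s"
    using linear_ode_laplace[OF bA f x(2,3)] by auto
  have lf: "\<forall>\<^sub>F s in at_top. rlap f s = Bd *v vec (rlap d s) + Bw *v vec (rlap w s)"
    unfolding f_def by (rule has_laplace_unique_ev[OF L2_has_laplace[OF f[unfolded f_def]]
          has_laplace_add[OF has_laplace_linear[OF L2_has_laplace[OF d] bounded_linear_mult_vec1] has_laplace_linear[OF L2_has_laplace[OF w] bounded_linear_mult_vec1]]])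
  have tr: "\<forall>\<^sub>F s in at_top.
      (Cz *v rlap x s + Dzd *v vec (rlap d s) + Dzw *v vec (rlap w s)) $ 1 = Re (H (of_real s) $ Inl 1 $ Inl 1) * rlap d s + Re (H (of_real s) $ Inl 1 $ Inr 1) * rlap w s \<and>
      (Cv *v rlap x s + Dvd *v vec (rlap d s) + Dvw *v vec (rlap w s)) $ 1 = Re (H (of_real s) $ Inr 1 $ Inl 1) * rlap d s + Re (H (of_real s) $ Inr 1 $ Inr 1) * rlap w s"
    using lx(2) lf eventually_gt_at_top[of 0]
  proof eventually_elim
    case (elim s)
    define \<xi> :: "real ^ (1 + 1)" where "\<xi> = vapp (vec (rlap d s)) (vec (rlap w s))"
    define B where "B = Bd ||| Bw"
    define C where "C = Cz /// Cv"
    define D where "D = (Dzd ||| Dzw) /// (Dvd ||| Dvw)"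
    define R where "R = mat (complex_of_real s) - complex_matrix A"
    have R: "matrix_inv R ** R = mat 1" unfolding R_def
      using elim by (intro invertible_matrix_inv(2) hurwitz_resolvent_invertible A) auto
    have "B *v \<xi> = s *\<^sub>R rlap x s - A *v rlap x s" using elim by (simp add: B_def \<xi>_def hcat_mult)
    then have "R *v cvec (rlap x s) = complex_matrix B *v cvec \<xi>"
      unfolding R_def matrix_vector_mult_diff_rdistrib mat_mult_vec complex_matrix_cvec by (simp add: vec_eq_iff)
    then have "matrix_inv R *v (complex_matrix B *v cvec \<xi>) = cvec (rlap x s)"
      by (metis R matrix_vector_mul_assoc matrix_vector_mul_lid)
    moreover have "H (of_real s) *v cvec \<xi> = complex_matrix C *v (matrix_inv R *v (complex_matrix B *v cvec \<xi>)) + complex_matrix D *v cvec \<xi>"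
      unfolding H_def state_space_transfer_def B_def[symmetric] C_def[symmetric] D_def[symmetric] R_def[symmetric]
      by (simp only: matrix_vector_mult_add_rdistrib matrix_vector_mul_assoc[symmetric])
    ultimately have HX: "H (of_real s) *v cvec \<xi> = cvec (C *v rlap x s + D *v \<xi>)"
      by (simp only: complex_matrix_cvec) (simp add: vec_eq_iff)
    have "(C *v rlap x s + D *v \<xi>) $ i = Re (H (of_real s) $ i $ Inl 1) * rlap d s + Re (H (of_real s) $ i $ Inr 1) * rlap w s" for i
    proof -
      have "(C *v rlap x s + D *v \<xi>) $ i = Re ((H (of_real s) *v cvec \<xi>) $ i)" unfolding HX by simp
      also have "\<dots> = Re (H (of_real s) $ i $ Inl 1) * rlap d s + Re (H (of_real s) $ i $ Inr 1) * rlap w s"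
        by (simp add: matrix_vector_mult_def sum_UNIV_sum sum_1 \<xi>_def)
      finally show ?thesis .
    qed
    from this[of "Inl 1"] this[of "Inr 1"] show ?case
      by (simp add: C_def D_def \<xi>_def vcat_mult hcat_mult add.assoc)
  qed
  have z: "has_laplace (\<lambda>t. (C *v x t + D *v vec (d t) + E *v vec (w t)) $ 1)
      (\<lambda>s. (C *v rlap x s + D *v vec (rlap d s) + E *v vec (rlap w s)) $ 1)" for C :: "real ^ 'n ^ 1" and D E :: "real ^ 1 ^ 1"
    unfolding vector_add_component
    by (rule has_laplace_add[OF has_laplace_add[OF has_laplace_linear[OF lx(1) bounded_linear_mult_nth]
          has_laplace_linear[OF L2_has_laplace[OF d] bounded_linear_mult_vec1_nth]]
        has_laplace_linear[OF L2_has_laplace[OF w] bounded_linear_mult_vec1_nth]])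
  show ?thesis
  proof (rule that[OF x(1)])
    show "x t = integral {0..t} (\<lambda>s. A *v x s + Bd *v vec (d s) + Bw *v vec (w s))" if "0 \<le> t" for t
      using x(2)[OF that] by (simp add: f_def add.assoc)
  qed (rule has_laplace_cong[OF z eventually_mono[OF tr]], blast)+
qed

text \<open>
  The signal \<open>v2\<close> perturbs the input \<open>v\<close> of the uncertainty; the strictness of the matrix
  inequality absorbs the cross terms.
\<close>
lemma lmi_pointwise:
  fixes A :: "real ^ 'n ^ 'n" and Bd Bw :: "real ^ 1 ^ 'n" and Cz Cv :: "real ^ 'n ^ 1"
    and Dzd Dzw Dvd Dvw :: "real ^ 1 ^ 1" and Q :: "real ^ 'n ^ 'n"
  assumes e: "0 < e" and diss: "\<And>x d w. 2 * ((A *v x + Bd *v d + Bw *v w) \<bullet> (Q *v x))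
      + (Cz *v x + Dzd *v d + Dzw *v w) \<bullet> (Cz *v x + Dzd *v d + Dzw *v w)
      + (\<beta> * X + \<eta> * Y) * ((Cv *v x + Dvd *v d + Dvw *v w) \<bullet> (Cv *v x + Dvd *v d + Dvw *v w))
      + 2 * Y * ((Cv *v x + Dvd *v d + Dvw *v w) \<bullet> w) - \<gamma>\<^sup>2 * (d \<bullet> d) - X * (w \<bullet> w)
      \<le> - e * (x \<bullet> x + d \<bullet> d + w \<bullet> w)"
  obtains K where "0 \<le> K" "\<And>(x :: real ^ 'n) (d::real) (w::real) (v2::real) z v.
      z = (Cz *v x + Dzd *v vec d + Dzw *v vec w) $ 1 \<Longrightarrow> v = (Cv *v x + Dvd *v vec d + Dvw *v vec w) $ 1 \<Longrightarrow>
      2 * ((A *v x + Bd *v vec d + Bw *v vec w) \<bullet> (Q *v x)) + z\<^sup>2 - \<gamma>\<^sup>2 * d\<^sup>2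
        + X * (\<beta> * (v + v2)\<^sup>2 - w\<^sup>2) + Y * (2 * ((v + v2) * w) + \<eta> * (v + v2)\<^sup>2) \<le> K * v2\<^sup>2 - e / 2 * w\<^sup>2"
proof -
  define p where "p = \<beta> * X + \<eta> * Y"
  obtain k1 where k1: "0 < k1" "\<And>x. norm ((Cv *v x) $ 1) \<le> norm x * k1"
    using bounded_linear.pos_bounded[OF bounded_linear_mult_nth[of Cv 1]] by blast
  define k2 where "k2 = \<bar>Dvd $ 1 $ 1\<bar>"
  define k3 where "k3 = \<bar>Dvw $ 1 $ 1\<bar>"
  define c where "c = 3 * k1\<^sup>2 + 3 * k2\<^sup>2 + 3 * k3\<^sup>2 + 1"
  have c: "c > 0" by (simp add: c_def add_nonneg_pos)
  \<comment> \<open>One summand for each term brought in by \<open>v2\<close>: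
    \<open>2 * p * (v * v2)\<close>, \<open>p * v2\<^sup>2\<close> and
    \<open>2 * Y * (v2 * w)\<close>. The two mixed terms spend \<open>e / 4\<close> of the margin
    each, which leaves \<open>e / 2\<close> for \<open>w\<close>; \<open>c\<close> bounds the
    squared \<open>v\<close> by \<open>c * n\<close>.\<close>
  define K where "K = 4 * c * p\<^sup>2 / e + \<bar>p\<bar> + 4 * Y\<^sup>2 / e"
  have "0 \<le> K" using c e by (simp add: K_def)
  moreover have "2 * ((A *v x + Bd *v vec d + Bw *v vec w) \<bullet> (Q *v x)) + z\<^sup>2 - \<gamma>\<^sup>2 * d\<^sup>2
        + X * (\<beta> * (v + v2)\<^sup>2 - w\<^sup>2) + Y * (2 * ((v + v2) * w) + \<eta> * (v + v2)\<^sup>2) \<le> K * v2\<^sup>2 - e / 2 * w\<^sup>2"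
    if z: "z = (Cz *v x + Dzd *v vec d + Dzw *v vec w) $ 1" and v: "v = (Cv *v x + Dvd *v vec d + Dvw *v vec w) $ 1"
    for x :: "real ^ 'n" and d w v2 z v :: real
  proof -
    define S where "S = 2 * ((A *v x + Bd *v vec d + Bw *v vec w) \<bullet> (Q *v x))"
    define n where "n = x \<bullet> x + d\<^sup>2 + w\<^sup>2"
    have i1: "a \<bullet> b = a $ 1 * b $ 1" for a b :: "real ^ 1" by (simp add: inner_vec_def sum_1)
    have main: "S + z\<^sup>2 + p * v\<^sup>2 + 2 * Y * (v * w) - \<gamma>\<^sup>2 * d\<^sup>2 - X * w\<^sup>2 \<le> - e * n"
      using diss[of x "vec d" "vec w"] unfolding i1 z[symmetric] v[symmetric] S_def p_def n_def
      by (simp add: power2_eq_square)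
    have v2c: "v\<^sup>2 \<le> c * n"
    proof -
      define a where "a = (Cv *v x) $ 1"
      define b1 where "b1 = Dvd $ 1 $ 1 * d"
      define b2 where "b2 = Dvw $ 1 $ 1 * w"
      have va: "v = a + b1 + b2" by (simp add: v a_def b1_def b2_def matrix_vector_mult_def sum_1)
      have "v\<^sup>2 \<le> 3 * a\<^sup>2 + 3 * b1\<^sup>2 + 3 * b2\<^sup>2"
        unfolding va using sum_squares_bound[of a b1] sum_squares_bound[of a b2] sum_squares_bound[of b1 b2]
        by (simp add: power2_eq_square algebra_simps)
      also have "\<dots> \<le> 3 * (k1\<^sup>2 * (x \<bullet> x)) + 3 * (k2\<^sup>2 * d\<^sup>2) + 3 * (k3\<^sup>2 * w\<^sup>2)"
      proof -
        have "a\<^sup>2 \<le> k1\<^sup>2 * (x \<bullet> x)"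
          using power_mono[OF k1(2)[of x], of 2] by (simp add: a_def power_mult_distrib power2_norm_eq_inner mult.commute)
        then show ?thesis by (simp add: b1_def b2_def k2_def k3_def power_mult_distrib)
      qed
      also have "\<dots> \<le> c * (x \<bullet> x) + c * d\<^sup>2 + c * w\<^sup>2"
        unfolding mult.assoc[symmetric] by (intro add_mono mult_right_mono) (auto simp: c_def)
      finally show ?thesis by (simp add: n_def algebra_simps)
    qed
    have y1: "2 * p * (v * v2) \<le> e / 4 * n + 4 * c * p\<^sup>2 / e * v2\<^sup>2"
    proof -
      define a where "a = e / (4 * c)"
      have a: "a > 0" using e c by (simp add: a_def)
      have "0 \<le> (a * v - p * v2)\<^sup>2 / a" using a by simp
      also have "\<dots> = a * v\<^sup>2 - 2 * p * (v * v2) + p\<^sup>2 / a * v2\<^sup>2" using a by (simp add: power2_eq_square field_simps)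
      finally have "2 * p * (v * v2) \<le> a * v\<^sup>2 + p\<^sup>2 / a * v2\<^sup>2" by simp
      moreover have "a * v\<^sup>2 \<le> a * (c * n)" using a v2c by (intro mult_left_mono) auto
      moreover have "a * (c * n) = e / 4 * n" "p\<^sup>2 / a = 4 * c * p\<^sup>2 / e" using e c by (simp_all add: a_def)
      ultimately show ?thesis by simp
    qed
    have y2: "2 * Y * (v2 * w) \<le> e / 4 * w\<^sup>2 + 4 * Y\<^sup>2 / e * v2\<^sup>2"
    proof -
      have "0 \<le> (e / 4 * w - Y * v2)\<^sup>2 * (4 / e)" using e by simp
      also have "\<dots> = e / 4 * w\<^sup>2 - 2 * Y * (v2 * w) + 4 * Y\<^sup>2 / e * v2\<^sup>2" using e by (simp add: power2_eq_square field_simps)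
      finally show ?thesis by simp
    qed
    have y3: "p * v2\<^sup>2 \<le> \<bar>p\<bar> * v2\<^sup>2" by (intro mult_right_mono) auto
    have wn: "e / 4 * w\<^sup>2 \<le> e / 4 * n" using e by (intro mult_left_mono) (auto simp: n_def)
    have "S + z\<^sup>2 - \<gamma>\<^sup>2 * d\<^sup>2 + X * (\<beta> * (v + v2)\<^sup>2 - w\<^sup>2) + Y * (2 * ((v + v2) * w) + \<eta> * (v + v2)\<^sup>2)
      = (S + z\<^sup>2 + p * v\<^sup>2 + 2 * Y * (v * w) - \<gamma>\<^sup>2 * d\<^sup>2 - X * w\<^sup>2) + 2 * p * (v * v2) + 2 * Y * (v2 * w) + p * v2\<^sup>2"
      by (simp add: p_def power2_eq_square algebra_simps)
    also have "\<dots> \<le> - e * n + (e / 4 * n + 4 * c * p\<^sup>2 / e * v2\<^sup>2) + (e / 4 * w\<^sup>2 + 4 * Y\<^sup>2 / e * v2\<^sup>2) + \<bar>p\<bar> * v2\<^sup>2"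
      using main y1 y2 y3 by linarith
    also have "\<dots> \<le> - (e / 2) * n + K * v2\<^sup>2" using wn by (simp add: K_def algebra_simps)
    also have "\<dots> \<le> K * v2\<^sup>2 - e / 2 * w\<^sup>2"
    proof -
      have "e / 2 * w\<^sup>2 \<le> e / 2 * n" using e by (intro mult_left_mono) (auto simp: n_def)
      then show ?thesis by simp
    qed
    finally show ?thesis by (simp add: S_def)
  qed
  ultimately show ?thesis using that by blast
qed

lemma energy_cong: "(\<And>t. 0 \<le> t \<Longrightarrow> t < \<tau> \<Longrightarrow> f t = g t) \<Longrightarrow> energy f \<tau> = energy g \<tau>"
  unfolding energy_def by (rule integral_spike[of "{\<tau>}"]) auto

lemma energy_real: "energy f \<tau> = integral {0..\<tau>} (\<lambda>t. (f t)\<^sup>2)" for f :: "real \<Rightarrow> real"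
  by (simp add: energy_def)

lemma dissipation_energy:
  fixes x f :: "real \<Rightarrow> real ^ 'n" and d w v v2 z :: "real \<Rightarrow> real" and Q :: "real ^ 'n ^ 'n"
  assumes \<tau>: "0 \<le> \<tau>" and f: "f \<in> L2e" and x: "\<And>t. 0 \<le> t \<Longrightarrow> x t = integral {0..t} f"
    and Q: "transpose Q = Q" "\<And>a. 0 \<le> a \<bullet> (Q *v a)"
    and L: "d \<in> L2e" "w \<in> L2e" "v \<in> L2e" "v2 \<in> L2e" "z \<in> L2e"
    and pw: "\<And>t. 0 \<le> t \<Longrightarrow> 2 * (f t \<bullet> (Q *v x t)) + (z t)\<^sup>2 - \<gamma>\<^sup>2 * (d t)\<^sup>2
        + X * (\<beta> * (v t + v2 t)\<^sup>2 - (w t)\<^sup>2) + Y * (2 * ((v t + v2 t) * w t) + \<eta> * (v t + v2 t)\<^sup>2) \<le> K * (v2 t)\<^sup>2 - e / 2 * (w t)\<^sup>2"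
    and XY: "0 \<le> X" "0 \<le> Y"
    and iqc: "energy w \<tau> \<le> \<beta> * energy (\<lambda>t. v t + v2 t) \<tau>"
      "0 \<le> integral {0..\<tau>} (\<lambda>t. 2 * ((v t + v2 t) * w t) + \<eta> * (v t + v2 t)\<^sup>2)"
  shows "energy z \<tau> + e / 2 * energy w \<tau> \<le> \<gamma>\<^sup>2 * energy d \<tau> + K * energy v2 \<tau>"
proof -
  have bQ: "bounded_linear (\<lambda>y. Q *v y)" by (rule matrix_vector_mul_bounded_linear)
  have Qs: "a \<bullet> (Q *v b) = b \<bullet> (Q *v a)" for a b
    using dot_lmul_matrix[of a Q b] Q(1) by (simp add: inner_commute flip: transpose_matrix_vector)
  have st: "(\<lambda>t. f t \<bullet> (Q *v x t) + x t \<bullet> (Q *v f t)) integrable_on {0..\<tau>}"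
    "x \<tau> \<bullet> (Q *v x \<tau>) = integral {0..\<tau>} (\<lambda>t. f t \<bullet> (Q *v x t) + x t \<bullet> (Q *v f t))"
    using quadratic_storage[OF \<tau> L2e_abs_int[OF f order_refl] bQ x] by auto
  have q: "f t \<bullet> (Q *v x t) + x t \<bullet> (Q *v f t) = 2 * (f t \<bullet> (Q *v x t))" for t using Qs[of "x t" "f t"] by simp
  have S: "(\<lambda>t. 2 * (f t \<bullet> (Q *v x t))) integrable_on {0..\<tau>}" "0 \<le> integral {0..\<tau>} (\<lambda>t. 2 * (f t \<bullet> (Q *v x t)))"
    using st Q(2)[of "x \<tau>"] unfolding q by auto
  have vv: "(\<lambda>t. v t + v2 t) \<in> L2e" by (rule L2e_add[OF L(3,4)])
  have sq: "(\<lambda>t. (g t)\<^sup>2) integrable_on {0..\<tau>}" if "g \<in> L2e" for g :: "real \<Rightarrow> real"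
    using abs_int_imp_int[OF L2e_abs_int_sq[OF that order_refl]] by simp
  have pr: "(\<lambda>t. (v t + v2 t) * w t) integrable_on {0..\<tau>}" using abs_int_imp_int[OF L2e_abs_int_prod[OF vv L(2) order_refl]] by simp
  define T1 where "T1 t = 2 * (f t \<bullet> (Q *v x t)) + (z t)\<^sup>2 - \<gamma>\<^sup>2 * (d t)\<^sup>2" for t
  define T2 where "T2 t = X * (\<beta> * (v t + v2 t)\<^sup>2 - (w t)\<^sup>2)" for t
  define T3 where "T3 t = 2 * ((v t + v2 t) * w t) + \<eta> * (v t + v2 t)\<^sup>2" for t
  define T4 where "T4 t = K * (v2 t)\<^sup>2 - e / 2 * (w t)\<^sup>2" for t
  have i1: "T1 integrable_on {0..\<tau>}" unfolding T1_def by (intro integrable_diff integrable_add S(1) sq L integrable_on_mult_right)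
  have i2: "T2 integrable_on {0..\<tau>}" unfolding T2_def by (intro integrable_diff sq vv L integrable_on_mult_right)
  have i3: "T3 integrable_on {0..\<tau>}" unfolding T3_def by (intro integrable_add pr sq vv integrable_on_mult_right)
  have i4: "T4 integrable_on {0..\<tau>}" unfolding T4_def by (intro integrable_diff sq L integrable_on_mult_right)
  have e1: "integral {0..\<tau>} T1 = integral {0..\<tau>} (\<lambda>t. 2 * (f t \<bullet> (Q *v x t))) + energy z \<tau> - \<gamma>\<^sup>2 * energy d \<tau>"
    unfolding T1_def energy_real using S(1) sq[OF L(5)] integrable_on_mult_right[OF sq[OF L(1)], of "\<gamma>\<^sup>2"]
    by (simp only: HK_integral_add HK_integral_diff integrable_add integral_mult_right)
  have e2: "integral {0..\<tau>} T2 = X * (\<beta> * energy (\<lambda>t. v t + v2 t) \<tau> - energy w \<tau>)"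
    unfolding T2_def energy_real using sq[OF L(2)] integrable_on_mult_right[OF sq[OF vv], of \<beta>]
    by (simp only: HK_integral_diff integral_mult_right)
  have e4: "integral {0..\<tau>} T4 = K * energy v2 \<tau> - e / 2 * energy w \<tau>"
    unfolding T4_def energy_real using integrable_on_mult_right[OF sq[OF L(2)], of "e / 2"] integrable_on_mult_right[OF sq[OF L(4)], of K]
    by (simp only: HK_integral_diff integral_mult_right)
  have "integral {0..\<tau>} (\<lambda>t. T1 t + T2 t + Y * T3 t) \<le> integral {0..\<tau>} T4"
  proof (rule integral_le[OF _ i4])
    show "(\<lambda>t. T1 t + T2 t + Y * T3 t) integrable_on {0..\<tau>}" by (intro integrable_add integrable_on_mult_right i1 i2 i3)
    show "T1 t + T2 t + Y * T3 t \<le> T4 t" if "t \<in> {0..\<tau>}" for t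
      using pw[of t] that by (simp add: T1_def T2_def T3_def T4_def)
  qed
  moreover have "integral {0..\<tau>} (\<lambda>t. T1 t + T2 t + Y * T3 t) = integral {0..\<tau>} T1 + integral {0..\<tau>} T2 + Y * integral {0..\<tau>} T3"
    using i1 i2 integrable_on_mult_right[OF i3, of Y]
    by (simp only: HK_integral_add integrable_add integral_mult_right)
  moreover have "0 \<le> integral {0..\<tau>} T2" unfolding e2 using XY(1) iqc(1) by simp
  moreover have "0 \<le> Y * integral {0..\<tau>} T3" using XY(2) iqc(2) by (simp add: T3_def[abs_def])
  ultimately show ?thesis using e1 e4 S(2) by linarith
qed

section \<open>The sampled loop\<close>

lemma (in filtered_loop) F_zero:
  assumes "0 \<le> t" shows "F (\<lambda>t. 0) t = 0"
proof -
  have "linear_operator F" using F by (simp add: stable_low_pass_def lti_system_def)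
  from this[unfolded linear_operator_def, rule_format, OF L2e_zero L2e_zero, of 0 0]
  have "F (\<lambda>t. 0) \<simeq> (\<lambda>t. 0)" by simp
  from signal_eq_truncation[OF this, of "t + 1"] show ?thesis
    by (rule right_continuous_eq) (use assms F_right_continuous[OF L2e_zero] in auto)
qed

text \<open>Of the sampling instants the locale keeps only that held values come from the past,
  which is what well-posedness rests on. The timing bounds enter through the hypothesis
  \<open>iqc\<close> of \<open>loop_energy_bound\<close>.\<close>

locale sampled_loop = filtered_loop +
  fixes Ts s :: "nat \<Rightarrow> real" and \<Delta> :: "(real \<Rightarrow> real) \<Rightarrow> real \<Rightarrow> real"
  assumes Ts: "admissible Ts" and s: "\<And>k. 0 \<le> s k" "\<And>k. s k \<le> Ts k"
    and \<Delta>: "\<And>y t. \<Delta> y t = - hold Ts (\<lambda>k. F y (s k)) t"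
begin

lemma eqs_AE:
  assumes "feedback_eqs P \<Delta> d x"
  shows "AE t in lebesgue_on {0..}. fst (x t) = fst (d t) - hold Ts (\<lambda>k. F (snd \<circ> x) (s k)) t"
    "AE t in lebesgue_on {0..}. snd (x t) = P (fst \<circ> x) t + snd (d t)"
  using assms unfolding feedback_eqs_def signal_eq_def \<Delta> by (simp_all add: add.commute)

lemma nominal_loop_eqs:
  assumes x: "feedback_eqs P \<Delta> d x" and w: "w = (\<lambda>t. F (snd \<circ> x) t - hold Ts (\<lambda>k. F (snd \<circ> x) (s k)) t)"
  shows "feedback_eqs P (neg_op F) (\<lambda>t. (fst (d t) + w t, snd (d t))) x"
  unfolding feedback_eqs_def signal_eq_def neg_op_def
proof
  show "AE t in lebesgue_on {0..}. (fst \<circ> x) t = - F (snd \<circ> x) t + fst (fst (d t) + w t, snd (d t))"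
    using eqs_AE(1)[OF x] by eventually_elim (simp add: w)
  show "AE t in lebesgue_on {0..}. (snd \<circ> x) t = P (fst \<circ> x) t + snd (fst (d t) + w t, snd (d t))"
    using eqs_AE(2)[OF x] by eventually_elim simp
qed

text \<open>Induction over the events: values held before \<open>Ts (Suc k)\<close> depend on
  \<open>y\<close> up to \<open>Ts k\<close>, where the two solutions agree already; then the inputs
  agree up to the next event, and causality of \<open>P\<close> carries this to the outputs.
  Uniqueness and causality of the loop both follow.\<close>

lemma loop_local:
  assumes d: "d \<in> L2e" "d' \<in> L2e" and x: "x \<in> L2e" "feedback_eqs P \<Delta> d x" and x': "x' \<in> L2e" "feedback_eqs P \<Delta> d' x'"
    and \<tau>: "0 < \<tau>" and eq: "truncation \<tau> d \<simeq> truncation \<tau> d'"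
  shows "truncation \<tau> x \<simeq> truncation \<tau> x'"
proof -
  have xe: "fst \<circ> x \<in> L2e" "snd \<circ> x \<in> L2e" "fst \<circ> x' \<in> L2e" "snd \<circ> x' \<in> L2e" using x(1) x'(1) by (auto simp: L2e_pair)
  have sm: "Ts k < Ts (Suc k)" for k using Ts by (simp add: admissible_def)
  have main: "truncation (min \<tau> (Ts k)) x \<simeq> truncation (min \<tau> (Ts k)) x'" for k
  proof (induction k)
    case 0
    have T0: "Ts 0 = 0" using Ts by (simp add: admissible_def)
    show ?case unfolding trunc_eq_iff using AE_half_line by eventually_elim (simp add: T0)
  next
    case (Suc k)
    define \<rho>' where "\<rho>' = min \<tau> (Ts k)"
    define \<rho> where "\<rho> = min \<tau> (Ts (Suc k))"
    have \<rho>: "0 < \<rho>" using \<tau> sm[of k] admissible_nonneg[OF Ts, of k] by (simp add: \<rho>_def)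
    have y': "truncation \<rho>' (snd \<circ> x) \<simeq> truncation \<rho>' (snd \<circ> x')"
      using Suc unfolding trunc_eq_iff \<rho>'_def by eventually_elim auto
    have hold: "hold Ts (\<lambda>k. F (snd \<circ> x) (s k)) t = hold Ts (\<lambda>k. F (snd \<circ> x') (s k)) t" if t: "0 \<le> t" "t < \<rho>" for t
    proof -
      obtain j where j: "Ts j \<le> t" "t < Ts (Suc j)" using event_index[OF Ts t(1)] by blast
      have "Ts j < Ts (Suc k)" using j(1) t(2) by (simp add: \<rho>_def)
      then have "j \<le> k" using admissible_strict_mono[OF Ts] by (simp add: strict_mono_less)
      then have "Ts j \<le> \<rho>'" using j(1) t(2) admissible_strict_mono[OF Ts] by (simp add: \<rho>_def \<rho>'_def strict_mono_less_eq)
      then have "F (snd \<circ> x) (s j) = F (snd \<circ> x') (s j)"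
        using s(1)[of j] s(2)[of j] y' by (intro F_local[OF xe(2,4)]) auto
      then show ?thesis using hold_eq[OF Ts j] by simp
    qed
    have u: "AE t in lebesgue_on {0..}. t < \<rho> \<longrightarrow> fst (x t) = fst (x' t)"
      using eqs_AE(1)[OF x(2)] eqs_AE(1)[OF x'(2)] eq[unfolded trunc_eq_iff] AE_half_line
      by eventually_elim (auto simp: hold \<rho>_def)
    then have "truncation \<rho> (fst \<circ> x) \<simeq> truncation \<rho> (fst \<circ> x')" by (simp add: trunc_eq_iff)
    from causal_local[OF P_op(1,2) xe(1,3) \<rho> this]
    have "AE t in lebesgue_on {0..}. t < \<rho> \<longrightarrow> P (fst \<circ> x) t = P (fst \<circ> x') t" by (simp add: trunc_eq_iff)
    then have "AE t in lebesgue_on {0..}. t < \<rho> \<longrightarrow> x t = x' t"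
      using u eqs_AE(2)[OF x(2)] eqs_AE(2)[OF x'(2)] eq[unfolded trunc_eq_iff]
      by eventually_elim (auto intro!: prod_eqI simp: \<rho>_def)
    then show ?case by (simp add: trunc_eq_iff \<rho>_def)
  qed
  obtain n where "\<tau> < Ts n" using admissible_unbounded[OF Ts] .
  then show ?thesis using main[of n] by (simp add: min_def)
qed

text \<open>By causality each held value is determined by the earlier ones, which defines them recursively.\<close>
lemma loop_exists:
  assumes d: "d \<in> L2e"
  obtains x where "x \<in> L2e" "feedback_eqs P \<Delta> d x"
proof -
  have de: "(\<lambda>t. fst (d t)) \<in> L2e" "(\<lambda>t. snd (d t)) \<in> L2e" using d by (auto simp: L2e_pair o_def)
  define U where "U c t = fst (d t) - hold Ts c t" for c t
  define Y where "Y c t = P (U c) t + snd (d t)" for c t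
  have U: "U c \<in> L2e" for c unfolding U_def by (rule L2e_diff[OF de(1) hold_L2e[OF Ts]])
  have Y: "Y c \<in> L2e" for c unfolding Y_def by (rule L2e_add[OF P_L2e[OF U] de(2)])
  \<comment> \<open>\<open>g k\<close> holds the values with index below \<open>k\<close> and 0
    beyond; the value at \<open>k\<close> is sampled from the response to \<open>g k\<close>. The
    diagonal sequence \<open>c\<close> agrees with \<open>g k\<close> below
    \<open>k\<close>.\<close>
  define g where "g = rec_nat (\<lambda>j. 0) (\<lambda>k g. g(k := F (Y g) (s k)))"
  have gS: "g (Suc k) = (g k)(k := F (Y (g k)) (s k))" for k by (simp add: g_def)
  define c where "c j = g (Suc j) j" for j
  have gc: "g k j = c j" if "j < k" for j k using that
  proof (induction k)
    case (Suc k)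
    then show ?case by (cases "j = k") (auto simp: c_def gS)
  qed simp
  have key: "F (Y c) (s k) = c k" for k
  proof -
    have "F (Y c) (s k) = F (Y (g k)) (s k)"
    proof (cases "Ts k = 0")
      \<comment> \<open>Causality is stated for positive horizons; at time 0 every output of
        \<open>F\<close> is 0.\<close>
      case True
      then have "s k = 0" using s(1)[of k] s(2)[of k] by simp
      then show ?thesis using F_continuous_zero(2)[OF Y] by simp
    next
      case False
      then have pos: "0 < Ts k" using admissible_nonneg[OF Ts, of k] by simp
      have h: "hold Ts c t = hold Ts (g k) t" if t: "0 \<le> t" "t < Ts k" for t
      proof -
        obtain j where j: "Ts j \<le> t" "t < Ts (Suc j)" using event_index[OF Ts t(1)] by blast
        then have "Ts j < Ts k" using t by simp
        then have "j < k" using admissible_strict_mono[OF Ts] by (simp add: strict_mono_less)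
        then show ?thesis using hold_eq[OF Ts j] gc by simp
      qed
      have "truncation (Ts k) (U c) \<simeq> truncation (Ts k) (U (g k))"
        unfolding trunc_eq_iff U_def using AE_half_line by eventually_elim (simp add: h)
      from causal_local[OF P_op(1,2) U U pos this]
      have "truncation (Ts k) (Y c) \<simeq> truncation (Ts k) (Y (g k))"
        unfolding trunc_eq_iff Y_def by eventually_elim simp
      then show ?thesis by (rule F_local[OF Y Y s])
    qed
    then show ?thesis by (simp add: c_def gS)
  qed
  define x where "x t = (U c t, Y c t)" for t
  have fx: "fst \<circ> x = U c" "snd \<circ> x = Y c" by (auto simp: x_def)
  have "x \<in> L2e" using U Y by (simp add: L2e_pair fx)
  moreover have "feedback_eqs P \<Delta> d x"
    unfolding feedback_eqs_def fx \<Delta> by (auto intro!: signal_eqI simp: key U_def Y_def)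
  ultimately show ?thesis using that by blast
qed

lemma loop_sol:
  assumes "d \<in> L2e" shows "closed_loop P \<Delta> d \<in> L2e" "feedback_eqs P \<Delta> d (closed_loop P \<Delta> d)"
proof -
  have "closed_loop P \<Delta> d \<in> L2e \<and> feedback_eqs P \<Delta> d (closed_loop P \<Delta> d)"
    unfolding closed_loop_def using loop_exists[OF assms] by (metis (mono_tags, lifting) someI_ex)
  then show "closed_loop P \<Delta> d \<in> L2e" "feedback_eqs P \<Delta> d (closed_loop P \<Delta> d)" by auto
qed

lemma loop_well_posed: "well_posed P \<Delta>"
  unfolding well_posed_def
proof (intro conjI ballI)
  fix d :: "real \<Rightarrow> real \<times> real" assume d: "d \<in> L2e"
  have "x' \<simeq> closed_loop P \<Delta> d" if "x' \<in> L2e" "feedback_eqs P \<Delta> d x'" for x'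
    by (rule signal_eq_if_truncations, rule loop_local[OF d d that loop_sol[OF d]]) simp_all
  then show "\<exists>x\<in>L2e. feedback_eqs P \<Delta> d x \<and> (\<forall>x'\<in>L2e. feedback_eqs P \<Delta> d x' \<longrightarrow> x' \<simeq> x)"
    using loop_sol[OF d] by (intro bexI[of _ "closed_loop P \<Delta> d"] conjI ballI impI) auto
next
  show "causal (closed_loop P \<Delta>)"
    unfolding causal_def
  proof (intro allI impI ballI)
    fix \<tau> :: real and d :: "real \<Rightarrow> real \<times> real" assume \<tau>: "0 < \<tau>" and d: "d \<in> L2e"
    have td: "truncation \<tau> d \<in> L2e" using L2e_truncation_L2[OF d] L2_subset_L2e by auto
    show "truncation \<tau> (closed_loop P \<Delta> (truncation \<tau> d)) \<simeq> truncation \<tau> (closed_loop P \<Delta> d)"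
      by (rule loop_local[OF td d loop_sol[OF td] loop_sol[OF d] \<tau>]) (simp add: truncation_truncation)
  qed
qed

text \<open>
  On \<open>{0..\<tau>}\<close> the sampled loop is the nominal loop with the sampling error \<open>w\<close> as an additional
  input. The disturbance of \<open>y\<close> enters the plant as \<open>- F b\<close> and the sampled signal as \<open>v2\<close>.
\<close>
lemma loop_energy_bound:
  fixes A :: "real ^ 'n ^ 'n" and Bd Bw :: "real ^ 1 ^ 'n" and Cz Cv :: "real ^ 'n ^ 1"
    and Dzd Dzw Dvd Dvw :: "real ^ 1 ^ 1" and Q :: "real ^ 'n ^ 'n"
  defines "H \<equiv> state_space_transfer A (Bd ||| Bw) (Cz /// Cv) ((Dzd ||| Dzw) /// (Dvd ||| Dvw))"
  assumes A: "hurwitz A" and M: "has_transfer_matrix (generalized_plant F P F) H"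
    and Q: "transpose Q = Q" "\<And>a. 0 \<le> a \<bullet> (Q *v a)" and XY: "0 \<le> X" "0 \<le> Y"
    and pw: "\<And>(x :: real ^ 'n) (d::real) (w::real) (v2::real) z v.
      z = (Cz *v x + Dzd *v vec d + Dzw *v vec w) $ 1 \<Longrightarrow> v = (Cv *v x + Dvd *v vec d + Dvw *v vec w) $ 1 \<Longrightarrow>
      2 * ((A *v x + Bd *v vec d + Bw *v vec w) \<bullet> (Q *v x)) + z\<^sup>2 - \<gamma>\<^sup>2 * d\<^sup>2
        + X * (\<beta> * (v + v2)\<^sup>2 - w\<^sup>2) + Y * (2 * ((v + v2) * w) + \<eta> * (v + v2)\<^sup>2) \<le> K * v2\<^sup>2 - e / 2 * w\<^sup>2"
    and iqc: "\<And>v w \<tau>. v \<in> L2e \<Longrightarrow> w = (\<lambda>t. integral {0..t} v - hold Ts (\<lambda>k. integral {0..s k} v) t) \<Longrightarrow> 0 \<le> \<tau> \<Longrightarrow>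
      w \<in> L2e \<and> energy w \<tau> \<le> \<beta> * energy v \<tau> \<and> 0 \<le> integral {0..\<tau>} (\<lambda>t. 2 * (v t * w t) + \<eta> * (v t)\<^sup>2)"
    and N: "0 \<le> C" "\<And>y. y \<in> L2 \<Longrightarrow> N y \<in> L2" "\<And>y. y \<in> L2 \<Longrightarrow> (L2_norm (N y))\<^sup>2 \<le> C * (L2_norm y)\<^sup>2"
      "\<And>y t. y \<in> L2 \<Longrightarrow> 0 \<le> t \<Longrightarrow> F y t = integral {0..t} (N y)"
    and K: "0 \<le> K"
    and d: "d \<in> L2" and x: "x \<in> L2e" "feedback_eqs P \<Delta> d x" and \<tau>: "0 < \<tau>"
    and w_def: "w = (\<lambda>t. F (snd \<circ> x) t - hold Ts (\<lambda>k. F (snd \<circ> x) (s k)) t)"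
  shows "energy (F (fst \<circ> x)) \<tau> + e / 2 * energy w \<tau>
    \<le> \<gamma>\<^sup>2 * energy (\<lambda>t. fst (d t) - F (truncation \<tau> (snd \<circ> d)) t) \<tau> + K * C * (L2_norm (snd \<circ> d))\<^sup>2"
proof -
  have d12: "fst \<circ> d \<in> L2" "snd \<circ> d \<in> L2" using d by (auto simp: L2_pair(1))
  then have d12e: "fst \<circ> d \<in> L2e" "snd \<circ> d \<in> L2e" using L2_subset_L2e by auto
  have xe: "fst \<circ> x \<in> L2e" "snd \<circ> x \<in> L2e" using x(1) by (auto simp: L2e_pair)
  have we: "w \<in> L2e" unfolding w_def by (rule L2e_diff[OF F_L2e[OF xe(2)] hold_L2e[OF Ts]])
  define b where "b = truncation \<tau> (snd \<circ> d)"
  have b: "b \<in> L2" unfolding b_def by (rule L2e_truncation_L2[OF d12e(2)])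
  define a1 where "a1 = truncation \<tau> (fst \<circ> d)"
  have a1: "a1 \<in> L2" unfolding a1_def by (rule L2e_truncation_L2[OF d12e(1)])
  define wL where "wL = truncation \<tau> w"
  have wL: "wL \<in> L2" unfolding wL_def by (rule L2e_truncation_L2[OF we])
  \<comment> \<open>With \<open>y = P u + b\<close> the loop reads
    \<open>u = (a1 - F b) + w - F (P u)\<close>, which is the loop of the generalized plant.
    \<open>F y\<close> exceeds its filtered output \<open>F (P u)\<close> by \<open>F b\<close>,
    whose derivative is \<open>v2 = N b\<close>.\<close>
  define dL where "dL t = a1 t - F b t" for t
  have dL: "dL \<in> L2" unfolding dL_def by (rule L2_diff[OF a1 F_L2[OF b]])
  define v2 where "v2 = N b"
  have v2: "v2 \<in> L2" unfolding v2_def by (rule N(2)[OF b])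
  define D where "D t = (fst (d t) + w t, snd (d t))" for t
  have D12: "fst \<circ> D = (\<lambda>t. (fst \<circ> d) t + w t)" "snd \<circ> D = snd \<circ> d" by (auto simp: D_def)
  have De: "D \<in> L2e" unfolding L2e_pair D12 using L2e_add[OF d12e(1) we] d12e(2) by simp
  have eqD: "feedback_eqs P (neg_op F) D x" unfolding D_def by (rule nominal_loop_eqs[OF x(2) w_def])
  \<comment> \<open>\<open>x\<close> itself may have no Laplace transform. The truncated input has
    finite energy, so the nominal response \<open>xL\<close> lies in \<open>L2\<close>, and it
    agrees with \<open>x\<close> up to \<tau>.\<close>
  define DL where "DL = truncation \<tau> D"
  have DL: "DL \<in> L2" unfolding DL_def by (rule L2e_truncation_L2[OF De])
  then have DLe: "DL \<in> L2e" using L2_subset_L2e by auto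
  have DL12: "fst \<circ> DL = (\<lambda>t. a1 t + wL t)" "snd \<circ> DL = b"
    by (auto simp: DL_def D_def truncation_def a1_def wL_def b_def fun_eq_iff)
  define xL where "xL = closed_loop P (neg_op F) DL"
  have xL: "xL \<in> L2" using base_loop(2) DL by (auto simp: xL_def bounded_operator_def)
  then have xL12: "fst \<circ> xL \<in> L2" "snd \<circ> xL \<in> L2" by (auto simp: L2_pair(1))
  then have xL12e: "fst \<circ> xL \<in> L2e" "snd \<circ> xL \<in> L2e" using L2_subset_L2e by auto
  have xLe: "xL \<in> L2e" using xL L2_subset_L2e by auto
  have eqL: "feedback_eqs P (neg_op F) DL xL" unfolding xL_def by (rule well_posed_closed_loop(2)[OF base_loop(1) DLe])
  have xx: "truncation \<tau> x \<simeq> truncation \<tau> xL"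
    by (rule well_posed_local[OF base_loop(1) De DLe \<tau> _ x(1) eqD xLe eqL]) (simp add: DL_def truncation_truncation)
  have uu: "truncation \<tau> (fst \<circ> x) \<simeq> truncation \<tau> (fst \<circ> xL)" and yy: "truncation \<tau> (snd \<circ> x) \<simeq> truncation \<tau> (snd \<circ> xL)"
    using xx unfolding trunc_eq_iff by (auto elim!: eventually_mono)
  obtain X' where X': "continuous_on {0..} X'"
    "\<And>t. 0 \<le> t \<Longrightarrow> X' t = integral {0..t} (\<lambda>s. A *v X' s + Bd *v vec (dL s) + Bw *v vec (wL s))"
    "has_laplace (\<lambda>t. (Cz *v X' t + Dzd *v vec (dL t) + Dzw *v vec (wL t)) $ 1)
       (\<lambda>s. Re (H (of_real s) $ Inl 1 $ Inl 1) * rlap dL s + Re (H (of_real s) $ Inl 1 $ Inr 1) * rlap wL s)"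
    "has_laplace (\<lambda>t. (Cv *v X' t + Dvd *v vec (dL t) + Dvw *v vec (wL t)) $ 1)
       (\<lambda>s. Re (H (of_real s) $ Inr 1 $ Inl 1) * rlap dL s + Re (H (of_real s) $ Inr 1 $ Inr 1) * rlap wL s)"
    using state_space_realization[OF A dL wL, where Bd = Bd and Bw = Bw and Cz = Cz and Cv = Cv
        and Dzd = Dzd and Dzw = Dzw and Dvd = Dvd and Dvw = Dvw]
    unfolding H_def by blast
  define z where "z t = (Cz *v X' t + Dzd *v vec (dL t) + Dzw *v vec (wL t)) $ 1" for t
  define v1 where "v1 t = (Cv *v X' t + Dvd *v vec (dL t) + Dvw *v vec (wL t)) $ 1" for t
  define f where "f t = A *v X' t + Bd *v vec (dL t) + Bw *v vec (wL t)" for t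
  have le: "dL \<in> L2e" "wL \<in> L2e" "v2 \<in> L2e" "X' \<in> L2e" using dL wL v2 L2_subset_L2e L2e_continuous[OF X'(1)] by auto
  have fe: "f \<in> L2e" unfolding f_def
    by (rule L2e_add[OF L2e_add[OF L2e_linear[OF le(4) matrix_vector_mul_bounded_linear] L2e_linear[OF le(1) bounded_linear_mult_vec1]] L2e_linear[OF le(2) bounded_linear_mult_vec1]])
  have ze: "z \<in> L2e" unfolding z_def vector_add_component
    by (rule L2e_add[OF L2e_add[OF L2e_linear[OF le(4) bounded_linear_mult_nth] L2e_linear[OF le(1) bounded_linear_mult_vec1_nth]] L2e_linear[OF le(2) bounded_linear_mult_vec1_nth]])
  have v1e: "v1 \<in> L2e" unfolding v1_def vector_add_component
    by (rule L2e_add[OF L2e_add[OF L2e_linear[OF le(4) bounded_linear_mult_nth] L2e_linear[OF le(1) bounded_linear_mult_vec1_nth]] L2e_linear[OF le(2) bounded_linear_mult_vec1_nth]])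
  define v where "v t = v1 t + v2 t" for t
  have ve: "v \<in> L2e" unfolding v_def by (rule L2e_add[OF v1e le(3)])
  have lA: "\<forall>\<^sub>F s in at_top. rlap (fst \<circ> DL) s = rlap a1 s + rlap wL s"
    unfolding DL12 by (rule has_laplace_unique_ev[OF L2_has_laplace[OF L2_add(1)[OF a1 wL]] has_laplace_add[OF L2_has_laplace[OF a1] L2_has_laplace[OF wL]]])
  have ldL: "\<forall>\<^sub>F s in at_top. rlap dL s = rlap a1 s - Fr s * rlap b s"
    using has_laplace_unique_ev[OF L2_has_laplace[OF dL] has_laplace_diff[OF L2_has_laplace[OF a1] F_laplace[OF b], folded dL_def]] .
  have tr: "\<forall>\<^sub>F s in at_top. Re (H (of_real s) $ Inl 1 $ Inl 1) * rlap dL s + Re (H (of_real s) $ Inl 1 $ Inr 1) * rlap wL s = Fr s * rlap (fst \<circ> xL) s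
      \<and> Re (H (of_real s) $ Inr 1 $ Inl 1) * rlap dL s + Re (H (of_real s) $ Inr 1 $ Inr 1) * rlap wL s = s * (Fr s * Pr s) * rlap (fst \<circ> xL) s
      \<and> rlap (snd \<circ> xL) s = Pr s * rlap (fst \<circ> xL) s + rlap b s \<and> s > 0"
    using generalized_plant_transfer[OF M] lA ldL base_loop_laplace(1)[OF DL xL eqL] base_loop_laplace(2)[OF DL xL eqL] eventually_gt_at_top[of 0]
  proof eventually_elim
    case (elim s)
    define E where "E = 1 + Fr s * Pr s"
    have E: "E \<noteq> 0" using elim by (simp add: E_def)
    have y: "rlap (snd \<circ> xL) s = Pr s * rlap (fst \<circ> xL) s + rlap b s" using elim(5) by (simp add: DL12)
    have u: "E * rlap (fst \<circ> xL) s = rlap dL s + rlap wL s"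
      using elim(2,3,4) y by (simp add: E_def algebra_simps)
    \<comment> \<open>\<open>d\<close> and \<open>w\<close> enter the plant at the same point, so
      both entries of a row of \<open>H\<close> are the same multiple of \<open>1 / E\<close>, and
      only the sum \<open>rlap dL s + rlap wL s = E * rlap (fst \<circ> xL) s\<close>
      matters.\<close>
    have *: "g1 * rlap dL s + g2 * rlap wL s = c * rlap (fst \<circ> xL) s" if g: "E * g1 = c" "E * g2 = c" for g1 g2 c
    proof -
      have "E * (g1 * rlap dL s + g2 * rlap wL s) = (E * g1) * rlap dL s + (E * g2) * rlap wL s" by (simp add: algebra_simps)
      also have "\<dots> = c * (rlap dL s + rlap wL s)" using g by (simp add: algebra_simps)
      also have "\<dots> = E * (c * rlap (fst \<circ> xL) s)" by (simp flip: u)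
      finally show ?thesis using E by (metis mult_left_cancel)
    qed
    show ?case using *[of "Re (H (of_real s) $ Inl 1 $ Inl 1)" "Fr s" "Re (H (of_real s) $ Inl 1 $ Inr 1)"]
        *[of "Re (H (of_real s) $ Inr 1 $ Inl 1)" "s * (Fr s * Pr s)" "Re (H (of_real s) $ Inr 1 $ Inr 1)"]
        elim(1,6) y unfolding E_def by blast
  qed
  have "has_laplace z (\<lambda>s. Fr s * rlap (fst \<circ> xL) s)"
    unfolding z_def by (rule has_laplace_cong[OF X'(3) eventually_mono[OF tr]]) blast
  then have zF: "z \<simeq> F (fst \<circ> xL)" by (rule laplace_unique[OF _ F_laplace[OF xL12(1)]])
  \<comment> \<open>The derivative is compared through its integral: dividing the transform of
    \<open>v1\<close> by \<open>s\<close> leaves that of \<open>F (P u)\<close>, so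
    \<open>F y\<close> need not be differentiated.\<close>
  have lv1: "has_laplace (\<lambda>t. integral {0..t} v1) (\<lambda>s. Fr s * Pr s * rlap (fst \<circ> xL) s)"
  proof (rule has_laplace_cong[OF has_laplace_integral])
    show "has_laplace v1 (\<lambda>s. s * (Fr s * Pr s) * rlap (fst \<circ> xL) s)"
      unfolding v1_def by (rule has_laplace_cong[OF X'(4) eventually_mono[OF tr]]) blast
    show "\<forall>\<^sub>F s in at_top. (s * (Fr s * Pr s) * rlap (fst \<circ> xL) s) /\<^sub>R s = Fr s * Pr s * rlap (fst \<circ> xL) s"
      using eventually_gt_at_top[of 0] by eventually_elim simp
  qed
  have "has_laplace (\<lambda>t. integral {0..t} v1 + F b t) (\<lambda>s. Fr s * rlap (snd \<circ> xL) s)"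
    by (rule has_laplace_cong[OF has_laplace_add[OF lv1 F_laplace[OF b]] eventually_mono[OF tr]]) (simp add: algebra_simps)
  note Fxi = laplace_unique[OF F_laplace[OF xL12(2)] this]
  have iv: "integral {0..t} v1 + F b t = integral {0..t} v" if "0 \<le> t" for t
    unfolding v_def N(4)[OF b that] v2_def[symmetric]
    using abs_int_imp_int[OF L2e_abs_int[OF v1e order_refl]] abs_int_imp_int[OF L2e_abs_int[OF le(3) order_refl]]
    by (simp add: HK_integral_add)
  have "F (snd \<circ> xL) \<simeq> (\<lambda>t. integral {0..t} v1 + F b t)" by (rule Fxi)
  also have "\<dots> \<simeq> (\<lambda>t. integral {0..t} v)" by (rule signal_eqI) (rule iv)
  finally have Fyv: "F (snd \<circ> xL) \<simeq> (\<lambda>t. integral {0..t} v)" .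
  have FLv: "F (snd \<circ> xL) t = integral {0..t} v" if "0 \<le> t" for t
    using that F_right_continuous[OF xL12e(2)] continuous_on_halfline_at_right[OF continuous_on_L2e_integral[OF ve]]
    by (intro right_continuous_eq[OF signal_eq_truncation[OF Fyv, of "t + 1"]]) auto
  have Fv: "F (snd \<circ> x) t = integral {0..t} v" if "0 \<le> t" "t \<le> \<tau>" for t
    using F_local[OF xe(2) xL12e(2) that yy] FLv that by simp
  \<comment> \<open>The sampling error of the integral of \<open>v\<close> on the whole half line,
    to which \<open>iqc\<close> applies. It equals \<open>w\<close> before \<tau>, since a value in
    use before \<tau> was sampled no later than \<tau>.\<close>
  define w' where "w' = (\<lambda>t. integral {0..t} v - hold Ts (\<lambda>k. integral {0..s k} v) t)"
  have ww: "w t = w' t" if t: "0 \<le> t" "t < \<tau>" for t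
  proof -
    obtain j where j: "Ts j \<le> t" "t < Ts (Suc j)" using event_index[OF Ts t(1)] by blast
    then have "s j \<le> \<tau>" using s(2)[of j] t by simp
    then show ?thesis using t Fv[of t] Fv[of "s j"] s(1)[of j] hold_eq[OF Ts j] by (simp add: w_def w'_def)
  qed
  have wLw': "wL t = w' t" if "0 \<le> t" "t < \<tau>" for t using ww[OF that] that by (simp add: wL_def truncation_def)
  note I = iqc[OF ve w'_def less_imp_le[OF \<tau>]]
  have "energy z \<tau> + e / 2 * energy wL \<tau> \<le> \<gamma>\<^sup>2 * energy dL \<tau> + K * energy v2 \<tau>"
  proof (rule dissipation_energy[OF less_imp_le[OF \<tau>] fe _ Q le(1,2) v1e le(3) ze _ XY])
    show "X' t = integral {0..t} f" if "0 \<le> t" for t using X'(2)[OF that] by (simp add: f_def[abs_def])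
    show "2 * (f t \<bullet> (Q *v X' t)) + (z t)\<^sup>2 - \<gamma>\<^sup>2 * (dL t)\<^sup>2
        + X * (\<beta> * (v1 t + v2 t)\<^sup>2 - (wL t)\<^sup>2) + Y * (2 * ((v1 t + v2 t) * wL t) + \<eta> * (v1 t + v2 t)\<^sup>2) \<le> K * (v2 t)\<^sup>2 - e / 2 * (wL t)\<^sup>2" for t
      unfolding f_def by (rule pw) (simp_all only: z_def v1_def)
    have "energy wL \<tau> = energy w' \<tau>" by (rule energy_cong[OF wLw'])
    then show "energy wL \<tau> \<le> \<beta> * energy (\<lambda>t. v1 t + v2 t) \<tau>" using I by (simp add: v_def[abs_def])
    have "integral {0..\<tau>} (\<lambda>t. 2 * (v t * wL t) + \<eta> * (v t)\<^sup>2) = integral {0..\<tau>} (\<lambda>t. 2 * (v t * w' t) + \<eta> * (v t)\<^sup>2)"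
      by (rule integral_spike[of "{\<tau>}"]) (auto simp: wLw')
    then show "0 \<le> integral {0..\<tau>} (\<lambda>t. 2 * ((v1 t + v2 t) * wL t) + \<eta> * (v1 t + v2 t)\<^sup>2)" using I by (simp add: v_def)
  qed
  moreover have "energy z \<tau> = energy (F (fst \<circ> x)) \<tau>"
  proof -
    have "energy z \<tau> = energy (F (fst \<circ> xL)) \<tau>" by (rule signal_eq_energy[OF signal_eq_truncation[OF zF]])
    also have "\<dots> = energy (F (fst \<circ> x)) \<tau>"
      by (rule signal_eq_energy[OF causal_local[OF F_op(1,2) xL12e(1) xe(1) \<tau> signal_eq_sym[OF uu]]])
    finally show ?thesis .
  qed
  moreover have "energy wL \<tau> = energy w \<tau>" unfolding wL_def by (simp add: energy_truncation)
  moreover have "energy dL \<tau> = energy (\<lambda>t. fst (d t) - F (truncation \<tau> (snd \<circ> d)) t) \<tau>"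
    by (rule energy_cong) (simp add: dL_def a1_def b_def truncation_def o_def)
  moreover have "K * energy v2 \<tau> \<le> K * C * (L2_norm (snd \<circ> d))\<^sup>2"
  proof -
    have "energy v2 \<tau> \<le> C * (L2_norm b)\<^sup>2" using energy_le_L2_norm[OF v2, of \<tau>] N(3)[OF b] by (simp add: v2_def)
    also have "\<dots> \<le> C * (L2_norm (snd \<circ> d))\<^sup>2"
      using N(1) energy_le_L2_norm[OF d12(2), of \<tau>] L2_norm_truncation[OF d12e(2) \<tau>] by (intro mult_left_mono) (auto simp: b_def)
    finally show ?thesis using K by (simp add: mult.assoc mult_left_mono)
  qed
  ultimately show ?thesis by simp
qed

text \<open>The bound on the energy of \<open>w\<close> is uniform in the horizon, so
  \<open>w\<close> lies in \<open>L2\<close>; then the solution is the response of the stable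
  nominal loop to a finite-energy input. When the second input is 0, the term with \<open>K\<close>
  vanishes, and dropping the energy of \<open>w\<close> leaves the gain \<gamma>.\<close>

lemma loop_stable_if_energy_bound:
  assumes e: "0 < e" and \<gamma>: "0 < \<gamma>" and K: "0 \<le> K"
    and en: "\<And>d x \<tau> w. d \<in> L2 \<Longrightarrow> x \<in> L2e \<Longrightarrow> feedback_eqs P \<Delta> d x \<Longrightarrow> 0 < \<tau> \<Longrightarrow>
      w = (\<lambda>t. F (snd \<circ> x) t - hold Ts (\<lambda>k. F (snd \<circ> x) (s k)) t) \<Longrightarrow>
      energy (F (fst \<circ> x)) \<tau> + e / 2 * energy w \<tau>
        \<le> \<gamma>\<^sup>2 * energy (\<lambda>t. fst (d t) - F (truncation \<tau> (snd \<circ> d)) t) \<tau> + K * (L2_norm (snd \<circ> d))\<^sup>2"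
  shows "stable_interconnection P \<Delta>" "bounded_operator (performance_map F P \<Delta>)"
    "induced_norm (performance_map F P \<Delta>) \<le> ennreal \<gamma>"
proof -
  obtain CF where CF: "0 \<le> CF" "\<And>u. u \<in> L2 \<Longrightarrow> (L2_norm (F u))\<^sup>2 \<le> CF * (L2_norm u)\<^sup>2"
    using bounded_operatorE[OF F_op(4)] by metis
  obtain Cb where Cb: "0 \<le> Cb" "\<And>u. u \<in> L2 \<Longrightarrow> closed_loop P (neg_op F) u \<in> L2"
      "\<And>u. u \<in> L2 \<Longrightarrow> (L2_norm (closed_loop P (neg_op F) u))\<^sup>2 \<le> Cb * (L2_norm u)\<^sup>2"
    using bounded_operatorE[OF base_loop(2)] by metis
  \<comment> \<open>Solving the hypothesis for the energy of \<open>w\<close> gives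
    \<open>2 / e\<close>; \<open>2 + 2 * CF\<close> bounds the energy of \<open>fst d\<close> minus
    the filtered second input.\<close>
  define kw where "kw = 2 / e * (\<gamma>\<^sup>2 * (2 + 2 * CF) + K)"
  have kw: "0 \<le> kw" using e K CF(1) by (simp add: kw_def)
  have main: "closed_loop P \<Delta> d \<in> L2 \<and> (L2_norm (closed_loop P \<Delta> d))\<^sup>2 \<le> Cb * (3 + 2 * kw) * (L2_norm d)\<^sup>2" if d: "d \<in> L2" for d
  proof -
    have de: "d \<in> L2e" using d L2_subset_L2e by auto
    define x where "x = closed_loop P \<Delta> d"
    have x: "x \<in> L2e" "feedback_eqs P \<Delta> d x" using loop_sol[OF de] by (auto simp: x_def)
    define w where "w = (\<lambda>t. F (snd \<circ> x) t - hold Ts (\<lambda>k. F (snd \<circ> x) (s k)) t)"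
    have xe: "snd \<circ> x \<in> L2e" "fst \<circ> x \<in> L2e" using x(1) by (auto simp: L2e_pair)
    have we: "w \<in> L2e" unfolding w_def by (rule L2e_diff[OF F_L2e[OF xe(1)] hold_L2e[OF Ts]])
    have d12: "fst \<circ> d \<in> L2" "snd \<circ> d \<in> L2" using d by (auto simp: L2_pair(1))
    then have d12e: "fst \<circ> d \<in> L2e" "snd \<circ> d \<in> L2e" using L2_subset_L2e by auto
    define n where "n = (L2_norm d)\<^sup>2"
    have n: "(L2_norm (fst \<circ> d))\<^sup>2 \<le> n" "(L2_norm (snd \<circ> d))\<^sup>2 \<le> n" using L2_pair(2)[OF d] by (auto simp: n_def)
    have wb: "energy w \<tau> \<le> kw * n" if \<tau>: "0 < \<tau>" for \<tau>
    proof -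
      define b where "b = truncation \<tau> (snd \<circ> d)"
      have b: "b \<in> L2" unfolding b_def by (rule L2e_truncation_L2[OF d12e(2)])
      have bn: "(L2_norm b)\<^sup>2 \<le> n"
        using L2_norm_truncation[OF d12e(2) \<tau>] energy_le_L2_norm[OF d12(2), of \<tau>] n(2) by (simp add: b_def)
      have Fb: "F b \<in> L2e" using F_L2[OF b] L2_subset_L2e by auto
      have "energy (\<lambda>t. (fst \<circ> d) t + - F b t) \<tau> \<le> 2 * energy (fst \<circ> d) \<tau> + 2 * energy (\<lambda>t. - F b t) \<tau>"
        by (rule energy_add[OF d12e(1) L2e_uminus[OF Fb]])
      moreover have "energy (\<lambda>t. - F b t) \<tau> = energy (F b) \<tau>" by (simp add: energy_def)
      moreover have "energy (F b) \<tau> \<le> CF * n"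
        using energy_le_L2_norm[OF F_L2[OF b], of \<tau>] CF(2)[OF b] mult_left_mono[OF bn CF(1)] by linarith
      moreover have "energy (fst \<circ> d) \<tau> \<le> n" using energy_le_L2_norm[OF d12(1), of \<tau>] n(1) by linarith
      ultimately have "energy (\<lambda>t. fst (d t) - F b t) \<tau> \<le> (2 + 2 * CF) * n" by (simp add: algebra_simps)
      then have "\<gamma>\<^sup>2 * energy (\<lambda>t. fst (d t) - F b t) \<tau> \<le> \<gamma>\<^sup>2 * ((2 + 2 * CF) * n)" by (intro mult_left_mono) auto
      moreover have "K * (L2_norm (snd \<circ> d))\<^sup>2 \<le> K * n" using n(2) K by (rule mult_left_mono)
      moreover have "0 \<le> energy (F (fst \<circ> x)) \<tau>" by (rule energy_nonneg[OF F_L2e[OF xe(2)]])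
      ultimately have "e / 2 * energy w \<tau> \<le> (\<gamma>\<^sup>2 * (2 + 2 * CF) + K) * n"
        using en[OF d x \<tau> w_def] by (simp add: b_def algebra_simps)
      then have "2 / e * (e / 2 * energy w \<tau>) \<le> 2 / e * ((\<gamma>\<^sup>2 * (2 + 2 * CF) + K) * n)" using e by (intro mult_left_mono) auto
      then show ?thesis using e by (simp add: kw_def algebra_simps)
    qed
    have w: "w \<in> L2" "(L2_norm w)\<^sup>2 \<le> kw * n" using L2_if_energy_bounded[OF we wb] by auto
    define D where "D t = (fst (d t) + w t, snd (d t))" for t
    have D12: "fst \<circ> D = (\<lambda>t. (fst \<circ> d) t + w t)" "snd \<circ> D = snd \<circ> d" by (auto simp: D_def)
    have D: "D \<in> L2" unfolding L2_pair(1) D12 using L2_add(1)[OF d12(1) w(1)] d12(2) by simp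
    then have De: "D \<in> L2e" using L2_subset_L2e by auto
    \<comment> \<open>\<open>2 + 2 * kw\<close> comes from the sum of \<open>fst \<circ> d\<close>
      and \<open>w\<close>, and 1 from the second component.\<close>
    have "(L2_norm D)\<^sup>2 \<le> (3 + 2 * kw) * n"
      unfolding L2_pair(2)[OF D] D12 using L2_add(2)[OF d12(1) w(1)] w(2) n by (simp add: algebra_simps)
    then have nc: "(L2_norm (closed_loop P (neg_op F) D))\<^sup>2 \<le> Cb * ((3 + 2 * kw) * n)"
      using Cb(3)[OF D] mult_left_mono[OF _ Cb(1)] by fastforce
    have "feedback_eqs P (neg_op F) D x" unfolding D_def by (rule nominal_loop_eqs[OF x(2) w_def])
    then have eq: "closed_loop P (neg_op F) D \<simeq> x" by (rule signal_eq_sym[OF well_posed_closed_loop(3)[OF base_loop(1) De x(1)]])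
    show ?thesis using signal_eq_L2[OF eq Cb(2)[OF D]] nc by (simp add: x_def n_def mult.assoc)
  qed
  have "bounded_operator (closed_loop P \<Delta>)"
    by (rule bounded_operatorI(1)[where C = "sqrt (Cb * (3 + 2 * kw))"]) (use main Cb(1) kw in auto)
  then show "stable_interconnection P \<Delta>" using loop_well_posed by (simp add: stable_interconnection_def)
  have perf: "performance_map F P \<Delta> u \<in> L2 \<and> (L2_norm (performance_map F P \<Delta> u))\<^sup>2 \<le> \<gamma>\<^sup>2 * (L2_norm u)\<^sup>2" if u: "u \<in> L2" for u
  proof -
    define d where "d t = (u t, 0::real)" for t
    have d: "d \<in> L2" using u L2_zero[where 'a = real] by (simp add: L2_pair(1) o_def d_def)
    then have de: "d \<in> L2e" using L2_subset_L2e by auto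
    define x where "x = closed_loop P \<Delta> d"
    have x: "x \<in> L2e" "feedback_eqs P \<Delta> d x" using loop_sol[OF de] by (auto simp: x_def)
    have xe: "snd \<circ> x \<in> L2e" "fst \<circ> x \<in> L2e" using x(1) by (auto simp: L2e_pair)
    have sd: "snd \<circ> d = (\<lambda>t. 0)" "truncation \<tau> (\<lambda>t. 0::real) = (\<lambda>t. 0)" for \<tau> by (auto simp: d_def truncation_def fun_eq_iff)
    have z: "L2_norm (\<lambda>t. 0::real) = 0" by (simp add: L2_norm_def)
    have "energy (F (fst \<circ> x)) \<tau> \<le> \<gamma>\<^sup>2 * (L2_norm u)\<^sup>2" if \<tau>: "0 < \<tau>" for \<tau>
    proof -
      define w where "w = (\<lambda>t. F (snd \<circ> x) t - hold Ts (\<lambda>k. F (snd \<circ> x) (s k)) t)"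
      have "w \<in> L2e" unfolding w_def by (rule L2e_diff[OF F_L2e[OF xe(1)] hold_L2e[OF Ts]])
      then have "0 \<le> e / 2 * energy w \<tau>" using e energy_nonneg[of w \<tau>] by simp
      moreover have "energy (\<lambda>t. fst (d t) - F (\<lambda>t. 0) t) \<tau> = energy u \<tau>" by (rule energy_cong) (simp add: d_def F_zero)
      moreover have "\<gamma>\<^sup>2 * energy u \<tau> \<le> \<gamma>\<^sup>2 * (L2_norm u)\<^sup>2" by (intro mult_left_mono energy_le_L2_norm u) auto
      ultimately show ?thesis using en[OF d x \<tau> w_def] by (simp add: sd z)
    qed
    from L2_if_energy_bounded[OF F_L2e[OF xe(2)] this]
    show ?thesis by (simp add: performance_map_def x_def d_def[abs_def])
  qed
  show "bounded_operator (performance_map F P \<Delta>)" "induced_norm (performance_map F P \<Delta>) \<le> ennreal \<gamma>"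
    using bounded_operatorI[where M = "performance_map F P \<Delta>" and C = \<gamma>] perf \<gamma> by auto
qed

end

theorem theorem3:
  fixes P F W :: "(real \<Rightarrow> real) \<Rightarrow> real \<Rightarrow> real"
    and P_tf F_tf :: "complex \<Rightarrow> complex"
    and A :: "real ^ 'n ^ 'n"
    and B\<^sub>d B\<^sub>w :: "real ^ 1 ^ 'n"
    and C\<^sub>z C\<^sub>v :: "real ^ 'n ^ 1"
    and D\<^sub>z\<^sub>d D\<^sub>z\<^sub>w D\<^sub>v\<^sub>d D\<^sub>v\<^sub>w :: "real ^ 1 ^ 1"
    and h \<delta> \<beta> \<eta> \<gamma> X Y :: real
    and Q :: "real ^ 'n ^ 'n"
  assumes "lti_system P P_tf"
    and "stable_low_pass F F_tf"
    and "W = F"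
    and "stable_interconnection P (neg_op F)"
    and "hurwitz A"
    and "has_transfer_matrix (generalized_plant W P F)
           (state_space_transfer A (B\<^sub>d ||| B\<^sub>w) (C\<^sub>z /// C\<^sub>v)
              ((D\<^sub>z\<^sub>d ||| D\<^sub>z\<^sub>w) /// (D\<^sub>v\<^sub>d ||| D\<^sub>v\<^sub>w)))"
    and "h > 0" and "\<delta> \<ge> 0"
    and "\<beta> = (2 * (1 + \<delta>) * h / pi + sqrt ((1 + \<delta>) * h\<^sup>2 * min \<delta> 1))\<^sup>2"
    and "\<eta> = h * min \<delta> 1"
    and "\<gamma> > 0"
    and "X \<ge> 0" and "Y \<ge> 0" and "Q = transpose Q"
    and "let M\<^sub>1 = (A     ||| B\<^sub>d ||| B\<^sub>w) ///
                   (mat 1 ||| 0  ||| 0);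
             N\<^sub>1 = (0 ||| Q) ///
                   (Q ||| 0);
             M\<^sub>2 = (C\<^sub>z ||| D\<^sub>z\<^sub>d  ||| D\<^sub>z\<^sub>w) ///
                   (C\<^sub>v ||| D\<^sub>v\<^sub>d  ||| D\<^sub>v\<^sub>w) ///
                   (0  ||| mat 1 ||| 0) ///
                   (0  ||| 0     ||| mat 1);
             N\<^sub>2 = (mat 1 ||| 0                     ||| 0            ||| 0) ///
                   (0     ||| mat (\<beta> * X + \<eta> * Y) ||| 0            ||| mat Y) ///
                   (0     ||| 0                     ||| mat (- (\<gamma>\<^sup>2)) ||| 0) ///
                   (0     ||| mat Y                 ||| 0            ||| mat (- X))
         in negative_definite (transpose M\<^sub>1 ** N\<^sub>1 ** M\<^sub>1 + transpose M\<^sub>2 ** N\<^sub>2 ** M\<^sub>2)"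
  shows "\<forall>T' Ts. admissible T' \<longrightarrow> admissible Ts \<longrightarrow>
           event_bounds T' Ts h ((1 + \<delta>) * h) (\<delta> * h) (h * min \<delta> 1) \<longrightarrow>
           stable_interconnection P (neg_op (sampled_feedback T' Ts F)) \<and>
           bounded_operator (performance_map W P (neg_op (sampled_feedback T' Ts F))) \<and>
           induced_norm (performance_map W P (neg_op (sampled_feedback T' Ts F))) \<le> ennreal \<gamma>"
proof (intro allI impI)
  fix T' Ts :: "nat \<Rightarrow> real"
  assume T': "admissible T'" and Ts: "admissible Ts"
    and eb: "event_bounds T' Ts h ((1 + \<delta>) * h) (\<delta> * h) (h * min \<delta> 1)"
  have F_low: "stable_low_pass F F_tf" and W: "W = F" by fact+
  have Q: "Q = transpose Q" by fact
  have XY: "X \<ge> 0" "Y \<ge> 0" by fact+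
  define H where "H = state_space_transfer A (B\<^sub>d ||| B\<^sub>w) (C\<^sub>z /// C\<^sub>v) ((D\<^sub>z\<^sub>d ||| D\<^sub>z\<^sub>w) /// (D\<^sub>v\<^sub>d ||| D\<^sub>v\<^sub>w))"
  have M: "has_transfer_matrix (generalized_plant F P F) H" using assms(6) by (simp only: H_def W)
  define s where "s = sample_time T' Ts"
  \<comment> \<open>The greatest age of a sample in use: the next sampling instant comes within
    \<open>h\<close>, and an event of \<open>Ts\<close> follows it within
    \<open>\<delta> * h\<close>.\<close>
  define L where "L = (1 + \<delta>) * h"
  have L: "L > 0" "L = h + \<delta> * h" using assms(7,8) by (simp_all add: L_def algebra_simps add_pos_nonneg)
  have \<eta>0: "0 \<le> \<eta>" using assms(7,8,10) by simp
  have eb': "event_bounds T' Ts h L (\<delta> * h) \<eta>" using eb assms(10) by (simp add: L_def)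
  note sp = sample_time_props[OF T' Ts eb' L(2), folded s_def]
  define \<Delta> where "\<Delta> = neg_op (sampled_feedback T' Ts F)"
  interpret sampled_loop P F P_tf F_tf Ts s \<Delta>
    by unfold_locales (use assms(1,2,4) Ts sp(1,2) in \<open>auto simp: \<Delta>_def neg_op_def sampled_feedback_hold[OF T' Ts] s_def\<close>)
  \<comment> \<open>\<open>L * \<eta>\<close> equals
    \<open>(1 + \<delta>) * h\<^sup>2 * min \<delta> 1\<close>, so \<beta> is the constant of
    \<open>sample_hold_iqc\<close> for the age \<open>L\<close> and the delay \<eta>.\<close>
  have \<beta>: "\<beta> = (2 * L / pi + sqrt (L * \<eta>))\<^sup>2"
    unfolding assms(9,10) L_def by (simp add: power2_eq_square algebra_simps)
  have p0: "0 \<le> \<beta> * X + \<eta> * Y" using XY \<eta>0 by (simp add: \<beta>)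
  obtain e where e: "0 < e" and diss: "\<And>x d w. 2 * ((A *v x + B\<^sub>d *v d + B\<^sub>w *v w) \<bullet> (Q *v x))
      + (C\<^sub>z *v x + D\<^sub>z\<^sub>d *v d + D\<^sub>z\<^sub>w *v w) \<bullet> (C\<^sub>z *v x + D\<^sub>z\<^sub>d *v d + D\<^sub>z\<^sub>w *v w)
      + (\<beta> * X + \<eta> * Y) * ((C\<^sub>v *v x + D\<^sub>v\<^sub>d *v d + D\<^sub>v\<^sub>w *v w) \<bullet> (C\<^sub>v *v x + D\<^sub>v\<^sub>d *v d + D\<^sub>v\<^sub>w *v w))
      + 2 * Y * ((C\<^sub>v *v x + D\<^sub>v\<^sub>d *v d + D\<^sub>v\<^sub>w *v w) \<bullet> w) - \<gamma>\<^sup>2 * (d \<bullet> d) - X * (w \<bullet> w)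
      \<le> - e * (x \<bullet> x + d \<bullet> d + w \<bullet> w)"
    using lmi_dissipation[OF assms(15) Q] by blast
  \<comment> \<open>At \<open>d = w = 0\<close> the matrix inequality is a Lyapunov inequality,
    because the squares of both outputs carry nonnegative weights.\<close>
  have Q0: "0 \<le> a \<bullet> (Q *v a)" for a
  proof (rule hurwitz_lyapunov_nonneg[OF assms(5) Q[symmetric] e])
    fix x :: "real ^ 'n"
    have "0 \<le> (C\<^sub>z *v x) \<bullet> (C\<^sub>z *v x)" "0 \<le> (\<beta> * X + \<eta> * Y) * ((C\<^sub>v *v x) \<bullet> (C\<^sub>v *v x))" using p0 by simp_all
    moreover have "2 * ((A *v x) \<bullet> (Q *v x)) + (C\<^sub>z *v x) \<bullet> (C\<^sub>z *v x)
        + (\<beta> * X + \<eta> * Y) * ((C\<^sub>v *v x) \<bullet> (C\<^sub>v *v x)) \<le> - e * (x \<bullet> x)"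
      using diss[of x 0 0] by simp
    ultimately show "2 * ((A *v x) \<bullet> (Q *v x)) \<le> - e * (x \<bullet> x)" by linarith
  qed
  obtain K where K: "0 \<le> K" and pw: "\<And>(x :: real ^ 'n) (d::real) (w::real) (v2::real) z v.
      z = (C\<^sub>z *v x + D\<^sub>z\<^sub>d *v vec d + D\<^sub>z\<^sub>w *v vec w) $ 1 \<Longrightarrow> v = (C\<^sub>v *v x + D\<^sub>v\<^sub>d *v vec d + D\<^sub>v\<^sub>w *v vec w) $ 1 \<Longrightarrow>
      2 * ((A *v x + B\<^sub>d *v vec d + B\<^sub>w *v vec w) \<bullet> (Q *v x)) + z\<^sup>2 - \<gamma>\<^sup>2 * d\<^sup>2
        + X * (\<beta> * (v + v2)\<^sup>2 - w\<^sup>2) + Y * (2 * ((v + v2) * w) + \<eta> * (v + v2)\<^sup>2) \<le> K * v2\<^sup>2 - e / 2 * w\<^sup>2"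
    using lmi_pointwise[OF e diss] by blast
  obtain N C where N: "0 \<le> C" "\<And>y. y \<in> L2 \<Longrightarrow> N y \<in> L2" "\<And>y. y \<in> L2 \<Longrightarrow> (L2_norm (N y))\<^sup>2 \<le> C * (L2_norm y)\<^sup>2"
      "\<And>y t. y \<in> L2 \<Longrightarrow> 0 \<le> t \<Longrightarrow> F y t = integral {0..t} (N y)"
    using low_pass_output_integral[OF F_low] by metis
  have iqc: "w \<in> L2e \<and> energy w \<tau> \<le> \<beta> * energy v \<tau> \<and> 0 \<le> integral {0..\<tau>} (\<lambda>t. 2 * (v t * w t) + \<eta> * (v t)\<^sup>2)"
    if "v \<in> L2e" "w = (\<lambda>t. integral {0..t} v - hold Ts (\<lambda>k. integral {0..s k} v) t)" "0 \<le> \<tau>" for v w \<tau>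
    using sample_hold_iqc[OF Ts that(1) L(1) \<eta>0 sp that(2,3)] by (simp add: energy_real \<beta>)
  have en: "energy (F (fst \<circ> x)) \<tau> + e / 2 * energy w \<tau>
        \<le> \<gamma>\<^sup>2 * energy (\<lambda>t. fst (d t) - F (truncation \<tau> (snd \<circ> d)) t) \<tau> + (K * C) * (L2_norm (snd \<circ> d))\<^sup>2"
    if "d \<in> L2" "x \<in> L2e" "feedback_eqs P \<Delta> d x" "0 < \<tau>"
      "w = (\<lambda>t. F (snd \<circ> x) t - hold Ts (\<lambda>k. F (snd \<circ> x) (s k)) t)" for d x \<tau> w
    by (rule loop_energy_bound[OF assms(5) M[unfolded H_def] Q[symmetric] Q0 XY pw iqc N K that])
  have "0 \<le> K * C" using K N(1) by simp
  from loop_stable_if_energy_bound[OF e assms(11) this en]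
  show "stable_interconnection P (neg_op (sampled_feedback T' Ts F)) \<and>
      bounded_operator (performance_map W P (neg_op (sampled_feedback T' Ts F))) \<and>
      induced_norm (performance_map W P (neg_op (sampled_feedback T' Ts F))) \<le> ennreal \<gamma>"
    unfolding \<Delta>_def W by blast
qed

end
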